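(* Let $s>1$, $r\ge0$, $1\le p<\infty$ with $2-s<r+2/p<s$. Then one can choose a compact neighbourhood $U$ of the identity in $G$, $U$-dense points $\{x_i\}_{i\in I}\subseteq G$ and a partition of unity $\{\psi_i\}_{i\in I}$ with $\mathrm{supp}(\psi_i)\subseteq x_iU$ such that the operators $T_1,T_2,T_3:L^p_r(G)*W_u^s(u)\to L^p_r(G)*W_u^s(u)$ defined by (a) $T_1f=\sum_if(x_i)\,\psi_i*W_u^s(u)$, (b) $T_2f=\sum_ic_i\,f(x_i)\,\ell_{x_i}W_u^s(u)$ with $c_i=\int_G\psi_i$, (c) $T_3f=\sum_i\Big(\int_Gf(x)\psi_i(x)\,dx\Big)\ell_{x_i}W_u^s(u)$ are invertible with continuous inverses.
   Context: $G=\left\{\begin{pmatrix}a&b\\0&a^{-1}\end{pmatrix}: a>0,\ b\in\mathbb{R}\right\}$, with elements written $(a,b)$ and left Haar measure $dx=\frac{da\,db}{a^2}$. For $s>1$, $$W_u^s(u)(a,b)=2^s(a+a^{-1}-ib)^{-s}$$ (principal branch); this is the wavelet coefficient $(u,\pi_s(a,b)u)_s$ of the constant function $u=1$ on the unit disc $\mathbb{D}$, where $\pi_s$ is the discrete series representation $\pi_s(a,b)v(z)=(-\bar\beta z+\alpha)^{-s}v\big(\frac{\bar\alpha z-\beta}{-\bar\beta z+\alpha}\big)$, $\alpha=\frac12(a+a^{-1}+ib)$, $\beta=\frac12(b+i(a-a^{-1}))$, on the weighted Bergman space $A^2_s(\mathbb{D})$ with inner product $(f,g)_s=\frac{s-1}{\pi}\int_{\mathbb{D}}f\bar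 g\,(1-|z|^2)^{s-2}dz$. With $w_r(a,b)=2^r[(a+a^{-1})^2+b^2]^{r/2}$, $L^p_r(G)$ has norm $\|f\|_{L^p_r}=\big(\int|f(a,b)w_r(a,b)|^p\frac{da\,db}{a^2}\big)^{1/p}$. Convolution is $f*h(y)=\int_Gf(x)h(x^{-1}y)\,dx$, and $\ell_xF(y)=F(x^{-1}y)$. $L^p_r(G)*W_u^s(u)=\{f*W_u^s(u): f\in L^p_r(G)\}$, a space of continuous functions contained in $L^p_r(G)$ and equipped with the $L^p_r$-norm. Points $\{x_i\}$ are $U$-dense if $\bigcup_ix_iU=G$. A partition of unity consists of functions $\psi_i\ge0$ with $\sum_i\psi_i=1$. Sums over $i$ are limits, in $L^p_r(G)$, of the net of partial sums over finite subsets of the index set. *)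

theory Defs
  imports "HOL-Analysis.Analysis" "HOL-Algebra.Coset"
begin

text \<open>
  The pair \<open>(a, b)\<close> stands for the upper triangular matrix with diagonal \<open>a\<close>, \<open>1/a\<close> and
  off-diagonal entry \<open>b\<close>; the multiplication is the matrix product.
\<close>

definition G :: "(real \<times> real) monoid" where
  "G = \<lparr>carrier = {(a, b). a > 0},
        mult = (\<lambda>(a, b) (c, d). (a * c, a * d + b * inverse c)),
        one = (1, 0)\<rparr>"

lemma group_G: "group G"
proof (rule groupI)
  fix x assume "x \<in> carrier G"
  then show "\<exists>y\<in>carrier G. y \<otimes>\<^bsub>G\<^esub> x = \<one>\<^bsub>G\<^esub>"
    by (intro bexI[of _ "(inverse (fst x), - snd x)"]) (auto simp: G_def)
qed (auto simp: G_def field_simps)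

lemma inv_G: "a > 0 \<Longrightarrow> inv\<^bsub>G\<^esub> (a, b) = (inverse a, - b)"
  by (rule group.inv_equality[OF group_G]) (auto simp: G_def)

definition haar :: "(real \<times> real) measure" where
  "haar = density (restrict_space lborel (carrier G)) (\<lambda>(a, b). ennreal (1 / a\<^sup>2))"

definition weight :: "real \<Rightarrow> real \<times> real \<Rightarrow> real" where
  "weight r = (\<lambda>(a, b). 2 powr r * ((a + inverse a)\<^sup>2 + b\<^sup>2) powr (r / 2))"

text \<open>
  Complex \<open>powr\<close> is the principal branch.  This is the wavelet coefficient \<open>(u, \<pi>\<^sub>s(a, b) u)\<^sub>s\<close>
  of the constant function \<open>u = 1\<close> in the weighted Bergman space on the unit disc.
\<close>

definition W :: "real \<Rightarrow> real \<times> real \<Rightarrow> complex" where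
  "W s = (\<lambda>(a, b). 2 powr complex_of_real s *
            Complex (a + inverse a) (- b) powr complex_of_real (- s))"

definition Lp_space :: "real \<Rightarrow> real \<Rightarrow> (real \<times> real \<Rightarrow> complex) set" where
  "Lp_space p r = {f \<in> borel_measurable haar.
                     integrable haar (\<lambda>x. cmod (f x * weight r x) powr p)}"

text \<open>
  Meaningful on \<open>Lp_space p r\<close> only: the Bochner integral of a non-integrable function is \<open>0\<close>.
\<close>

definition Lp_norm :: "real \<Rightarrow> real \<Rightarrow> (real \<times> real \<Rightarrow> complex) \<Rightarrow> real" where
  "Lp_norm p r f = (LINT x|haar. cmod (f x * weight r x) powr p) powr (1 / p)"

text \<open>
  A function on the group is a function on the plane of which only the values on \<open>carrier G\<close>
  matter.  Convolutions are extended by \<open>0\<close> off \<open>carrier G\<close>, so that two of them are equal in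
  HOL exactly when they agree on the group.
\<close>

definition conv ::
  "(real \<times> real \<Rightarrow> complex) \<Rightarrow> (real \<times> real \<Rightarrow> complex) \<Rightarrow> real \<times> real \<Rightarrow> complex" where
  "conv f h y = (if y \<in> carrier G
                 then LINT x|haar. f x * h (inv\<^bsub>G\<^esub> x \<otimes>\<^bsub>G\<^esub> y) else 0)"

definition ltrans ::
  "real \<times> real \<Rightarrow> (real \<times> real \<Rightarrow> complex) \<Rightarrow> real \<times> real \<Rightarrow> complex" where
  "ltrans x F y = F (inv\<^bsub>G\<^esub> x \<otimes>\<^bsub>G\<^esub> y)"

definition conv_space :: "real \<Rightarrow> real \<Rightarrow> real \<Rightarrow> (real \<times> real \<Rightarrow> complex) set" where
  "conv_space p r s = (\<lambda>f. conv f (W s)) ` Lp_space p r"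

definition compact_nhd_one :: "(real \<times> real) set \<Rightarrow> bool" where
  "compact_nhd_one U \<longleftrightarrow> compact U \<and> U \<subseteq> carrier G \<and> \<one>\<^bsub>G\<^esub> \<in> interior U"

definition U_dense ::
  "(real \<times> real) set \<Rightarrow> 'i set \<Rightarrow> ('i \<Rightarrow> real \<times> real) \<Rightarrow> bool" where
  "U_dense U I x \<longleftrightarrow> x ` I \<subseteq> carrier G \<and> (\<Union>i\<in>I. x i <#\<^bsub>G\<^esub> U) = carrier G"

definition partition_of_unity :: "'i set \<Rightarrow> ('i \<Rightarrow> real \<times> real \<Rightarrow> real) \<Rightarrow> bool" where
  "partition_of_unity I \<psi> \<longleftrightarrow>
     (\<forall>i\<in>I. \<psi> i \<in> borel_measurable haar \<and> (\<forall>y\<in>carrier G. \<psi> i y \<ge> 0)) \<and>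
     (\<forall>y\<in>carrier G. ((\<lambda>i. \<psi> i y) has_sum 1) I)"

definition supp :: "(real \<times> real \<Rightarrow> real) \<Rightarrow> (real \<times> real) set" where
  "supp g = top_of_set (carrier G) closure_of {y \<in> carrier G. g y \<noteq> 0}"

definition Lp_has_sum :: "real \<Rightarrow> real \<Rightarrow> ('i \<Rightarrow> real \<times> real \<Rightarrow> complex) \<Rightarrow>
    (real \<times> real \<Rightarrow> complex) \<Rightarrow> 'i set \<Rightarrow> bool" where
  "Lp_has_sum p r t g I \<longleftrightarrow>
     (\<forall>i\<in>I. t i \<in> Lp_space p r) \<and> g \<in> Lp_space p r \<and>
     ((\<lambda>F. Lp_norm p r (\<lambda>y. (\<Sum>i\<in>F. t i y) - g y)) \<longlongrightarrow> 0) (finite_subsets_at_top I)"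

definition Lp_continuous_on :: "real \<Rightarrow> real \<Rightarrow> (real \<times> real \<Rightarrow> complex) set \<Rightarrow>
    ((real \<times> real \<Rightarrow> complex) \<Rightarrow> (real \<times> real \<Rightarrow> complex)) \<Rightarrow> bool" where
  "Lp_continuous_on p r X S \<longleftrightarrow>
     (\<forall>f\<in>X. \<forall>\<epsilon>>0. \<exists>\<delta>>0. \<forall>g\<in>X.
        Lp_norm p r (\<lambda>y. g y - f y) < \<delta> \<longrightarrow> Lp_norm p r (\<lambda>y. S g y - S f y) < \<epsilon>)"

text \<open>
  The elements of \<open>conv_space p r s\<close> are continuous on the group and vanish off it, so a sum
  has at most one representative there, and \<open>t\<close> determines \<open>T\<close> on \<open>X = conv_space p r s\<close>.
\<close>

definition sum_operator :: "real \<Rightarrow> real \<Rightarrow> 'i set \<Rightarrow> (real \<times> real \<Rightarrow> complex) set \<Rightarrow>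
    ((real \<times> real \<Rightarrow> complex) \<Rightarrow> 'i \<Rightarrow> real \<times> real \<Rightarrow> complex) \<Rightarrow>
    ((real \<times> real \<Rightarrow> complex) \<Rightarrow> (real \<times> real \<Rightarrow> complex)) \<Rightarrow> bool" where
  "sum_operator p r I X t T \<longleftrightarrow> (\<forall>f\<in>X. T f \<in> X \<and> Lp_has_sum p r (t f) (T f) I)"

definition continuously_invertible :: "real \<Rightarrow> real \<Rightarrow> (real \<times> real \<Rightarrow> complex) set \<Rightarrow>
    ((real \<times> real \<Rightarrow> complex) \<Rightarrow> (real \<times> real \<Rightarrow> complex)) \<Rightarrow> bool" where
  "continuously_invertible p r X T \<longleftrightarrow>
     bij_betw T X X \<and> Lp_continuous_on p r X (inv_into X T)"

end

theory Submission imports Defs begin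

text \<open>
  Write \<open>f * W\<close> for the convolution with the wavelet coefficient and let \<open>N x\<close> be the norm-like function with
  \<open>\<bar>W x\<bar> = 2 powr s * N x powr (- s)\<close>; the weight is a multiple of \<open>N x powr r\<close>. The group acts simply transitively
  on the upper half-plane, its left Haar measure is a multiple of the hyperbolic area, and \<open>\<bar>W (x\<^sup>-\<^sup>1 y)\<bar>\<close> depends only on the
  hyperbolic distance of the two points. The proof rests on four facts.

  First, \<open>f \<mapsto> f * \<bar>W\<bar>\<close> is bounded on the weighted space (\<open>KF_Schur\<close>). This is Schur's test with a power of \<open>N\<close> as
  test function, and it needs that convolution with \<open>\<bar>W\<bar>\<close> maps \<open>N powr (- c)\<close> below a multiple of itself for
  \<open>2 - s < c < s\<close> (\<open>kernel_preserves_N_power\<close>). By left invariance the function \<open>a powr c\<close> is an eigenfunction, and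
  so is its image under \<open>z \<mapsto> - 1 / z\<close>, because that map preserves the area and the distance; \<open>N powr (- c)\<close> is comparable to the
  minimum of the two eigenfunctions, or to their sum if \<open>c\<close> is negative. With \<open>c = r + 2 / p\<close> the two exponents of
  Schur's test are \<open>c\<close> and \<open>2 - c\<close>, so the hypotheses of the theorem are exactly what the test needs.

  Second, \<open>W * W = C W\<close> (\<open>W_reproducing\<close>): in the disc the integrand is a rotation invariant function times an
  antiholomorphic one, and the mean value property applies. The space \<open>L\<^sup>p\<^sub>r * W\<close> is therefore the eigenspace
  \<open>f * W = C f\<close> (\<open>conv_space_iff\<close>), and it is complete (\<open>metB_complete\<close>).

  Third, translating the argument of \<open>W\<close> by a small group element, on either side, changes its value by a small
  relative amount, uniformly on the group (\<open>W_oscillation\<close>). Through the reproducing formula every function of the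
  space satisfies \<open>\<bar>f (x) - f (x u)\<bar> \<le> const \<epsilon> (\<bar>f\<bar> * \<bar>W\<bar>) (x u)\<close> for \<open>u\<close> in the neighbourhood \<open>U\<close>.

  Fourth, take a countable \<open>U\<close>-dense family, cut the group into disjoint cells contained in the translates
  \<open>x\<^sub>i U\<close>, and let \<open>\<psi>\<^sub>i\<close> be their indicators and \<open>\<tau>\<close> the map that sends a point to the node of its cell. The
  operators are then integrals over \<open>x\<close>, with integrands \<open>f (\<tau> x) W (x\<^sup>-\<^sup>1 y)\<close>, \<open>f (\<tau> x) W ((\<tau> x)\<^sup>-\<^sup>1 y)\<close> and
  \<open>f (x) W ((\<tau> x)\<^sup>-\<^sup>1 y)\<close>. Each of them differs from \<open>f * W = C f\<close> by an operator of small norm, hence it is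
  invertible on the complete space (\<open>sampled_operator\<close>, \<open>near_multiple_invertible\<close>). The series converge because the
  remainders are tails of one absolutely convergent integral (\<open>wconv_Lp_has_sum\<close>).
\<close>

section \<open>The group and its left Haar measure\<close>

abbreviation gmult :: "real \<times> real \<Rightarrow> real \<times> real \<Rightarrow> real \<times> real" (infixl "\<cdot>" 70)
  where "x \<cdot> y \<equiv> x \<otimes>\<^bsub>G\<^esub> y"

abbreviation ginv :: "real \<times> real \<Rightarrow> real \<times> real"
  where "ginv x \<equiv> inv\<^bsub>G\<^esub> x"

lemma carrier_G: "x \<in> carrier G \<longleftrightarrow> fst x > 0"
  by (cases x) (simp add: G_def)

lemma gmult_eq: "x \<cdot> y = (fst x * fst y, fst x * snd y + snd x * inverse (fst y))"
  by (cases x; cases y) (simp add: G_def)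

lemma ginv_eq: "x \<in> carrier G \<Longrightarrow> ginv x = (inverse (fst x), - snd x)"
  by (cases x) (simp add: carrier_G inv_G)

lemma gquot_eq: "x \<in> carrier G \<Longrightarrow>
    ginv x \<cdot> y = (inverse (fst x) * fst y, inverse (fst x) * snd y - snd x * inverse (fst y))"
  by (simp add: gmult_eq ginv_eq)

lemma open_carrier_G: "open (carrier G)"
proof -
  have "carrier G = {0<..} \<times> UNIV" by (auto simp: G_def)
  then show ?thesis by (simp add: open_Times)
qed

lemma G_closed [simp]:
  "x \<in> carrier G \<Longrightarrow> y \<in> carrier G \<Longrightarrow> x \<cdot> y \<in> carrier G"
  "x \<in> carrier G \<Longrightarrow> ginv x \<in> carrier G"
  by (auto intro: group.subgroup_self group.is_monoid monoid.m_closed group.inv_closed group_G)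

lemma space_haar [simp]: "space haar = carrier G"
  by (simp add: haar_def space_restrict_space)

lemma sets_haar: "sets haar = sets (restrict_space borel (carrier G))"
  by (auto simp: haar_def sets_restrict_space)

lemma borel_carrier_G [measurable]: "carrier G \<in> sets borel"
  by (rule borel_open[OF open_carrier_G])

lemma measurable_to_haar:
  "f \<in> measurable M borel \<Longrightarrow> (\<And>x. x \<in> space M \<Longrightarrow> f x \<in> carrier G) \<Longrightarrow> f \<in> measurable M haar"
  by (subst measurable_cong_sets[OF refl sets_haar]) (auto intro!: measurable_restrict_space2)

lemma measurable_of_borel: "f \<in> measurable borel N \<Longrightarrow> f \<in> measurable haar N"
  by (subst measurable_cong_sets[OF sets_haar refl]) (auto intro: measurable_restrict_space1)

lemma measurable_haar_continuous:
  "continuous_on (carrier G) f \<Longrightarrow> f \<in> borel_measurable haar"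
  by (subst measurable_cong_sets[OF sets_haar refl]) (auto intro: borel_measurable_continuous_on_restrict)

lemma measurable_fst_haar [measurable]: "fst \<in> borel_measurable haar"
  and measurable_snd_haar [measurable]: "snd \<in> borel_measurable haar"
proof -
  show "fst \<in> borel_measurable haar"
    by (rule measurable_haar_continuous) (intro continuous_intros)
  show "snd \<in> borel_measurable haar"
    by (rule measurable_haar_continuous) (intro continuous_intros)
qed

lemma measurable_gmult [measurable (raw)]:
  assumes "f \<in> measurable M haar" "g \<in> measurable M haar"
  shows "(\<lambda>x. f x \<cdot> g x) \<in> measurable M haar"
proof (rule measurable_to_haar)
  note [measurable] = assms
  show "(\<lambda>x. f x \<cdot> g x) \<in> borel_measurable M" unfolding gmult_eq by measurable
  show "f x \<cdot> g x \<in> carrier G" if "x \<in> space M" for x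
    using measurable_space[OF assms(1) that] measurable_space[OF assms(2) that] by simp
qed

lemma measurable_ginv [measurable (raw)]:
  assumes "f \<in> measurable M haar"
  shows "(\<lambda>x. ginv (f x)) \<in> measurable M haar"
proof (rule measurable_to_haar)
  note [measurable] = assms
  have *: "f x \<in> carrier G" if "x \<in> space M" for x
    using measurable_space[OF assms(1) that] by simp
  have "(\<lambda>x. (inverse (fst (f x)), - snd (f x))) \<in> borel_measurable M" by measurable
  then show "(\<lambda>x. ginv (f x)) \<in> borel_measurable M"
    by (rule measurable_cong[THEN iffD1, rotated]) (simp add: * ginv_eq)
qed (use measurable_space[OF assms] in auto)

text \<open>
  Every later invariance proof reduces to iterated Lebesgue integrals; the indicator confines the integration to
  positive \<open>a\<close>, because the values of \<open>F\<close> off the group are arbitrary.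
\<close>

lemma nn_integral_haar:
  assumes F: "F \<in> borel_measurable haar"
  shows "(\<integral>\<^sup>+x. F x \<partial>haar) =
    (\<integral>\<^sup>+a. \<integral>\<^sup>+b. F (a, b) * indicator {0<..} a * ennreal (1 / a\<^sup>2) \<partial>lborel \<partial>lborel)"
proof -
  have F': "F \<in> borel_measurable (restrict_space lborel (carrier G))"
    using F by (rule measurable_cong_sets[THEN equalityD1, THEN subsetD, rotated -1])
      (auto simp: sets_haar sets_restrict_space)
  have FG: "(\<lambda>x. F x * indicator (carrier G) x) \<in> borel_measurable borel"
    using F' by (subst (asm) borel_measurable_restrict_space_iff_ennreal) (auto cong: measurable_cong_sets)
  have [measurable]: "(\<lambda>x::real \<times> real. 1 / (fst x)\<^sup>2) \<in> borel_measurable borel"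
    unfolding borel_prod[symmetric] by measurable
  have "(\<integral>\<^sup>+x. F x \<partial>haar) = (\<integral>\<^sup>+x. F x * (case x of (a, b) \<Rightarrow> ennreal (1 / a\<^sup>2)) * indicator (carrier G) x \<partial>lborel)"
    unfolding haar_def using F'
    by (subst nn_integral_density) (auto simp: nn_integral_restrict_space mult_ac case_prod_beta' intro!: measurable_restrict_space1)
  also have "\<dots> = (\<integral>\<^sup>+x. (F x * indicator (carrier G) x) * ennreal (1 / (fst x)\<^sup>2) \<partial>(lborel \<Otimes>\<^sub>M lborel))"
    by (simp add: lborel_prod mult_ac case_prod_beta')
  also have "\<dots> = (\<integral>\<^sup>+a. \<integral>\<^sup>+b. (F (a, b) * indicator (carrier G) (a, b)) * ennreal (1 / a\<^sup>2) \<partial>lborel \<partial>lborel)"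
    by (subst lborel.nn_integral_fst[symmetric]) (use FG in \<open>auto simp: lborel_prod\<close>)
  also have "\<dots> = (\<integral>\<^sup>+a. \<integral>\<^sup>+b. F (a, b) * indicator {0<..} a * ennreal (1 / a\<^sup>2) \<partial>lborel \<partial>lborel)"
    by (intro nn_integral_cong) (auto simp: carrier_G indicator_def)
  finally show ?thesis .
qed

section \<open>Left translations and the measure da/a on the half-line\<close>

text \<open>
  Invariance is recorded as an equality of measures, so that it applies to Bochner integrals as well as to
  nonnegative ones.
\<close>

lemma haar_eq_distrI:
  assumes [measurable]: "\<phi> \<in> measurable haar haar"
    and inv: "\<And>F :: _ \<Rightarrow> ennreal. F \<in> borel_measurable haar \<Longrightarrow> (\<integral>\<^sup>+x. F (\<phi> x) \<partial>haar) = (\<integral>\<^sup>+x. F x \<partial>haar)"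
  shows "distr haar haar \<phi> = haar"
proof (rule measure_eqI)
  fix A assume "A \<in> sets (distr haar haar \<phi>)"
  then have A: "A \<in> sets haar" by simp
  have "emeasure (distr haar haar \<phi>) A = (\<integral>\<^sup>+x. indicator A x \<partial>distr haar haar \<phi>)"
    using A by simp
  also have "\<dots> = (\<integral>\<^sup>+x. indicator A (\<phi> x) \<partial>haar)"
    by (rule nn_integral_distr) (use A in auto)
  also have "\<dots> = (\<integral>\<^sup>+x. indicator A x \<partial>haar)" by (rule inv) (use A in auto)
  also have "\<dots> = emeasure haar A" using A by simp
  finally show "emeasure (distr haar haar \<phi>) A = emeasure haar A" .
qed simp

lemma measurable_haar_plane:
  fixes F :: "real \<times> real \<Rightarrow> ennreal"
  assumes F: "F \<in> borel_measurable haar"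
  shows "(\<lambda>x. F x * indicator {0<..} (fst x)) \<in> borel_measurable (lborel \<Otimes>\<^sub>M lborel)"
proof -
  have F': "F \<in> borel_measurable (restrict_space lborel (carrier G))"
    using F by (rule measurable_cong_sets[THEN equalityD1, THEN subsetD, rotated -1])
      (auto simp: sets_haar sets_restrict_space)
  have "(\<lambda>x. F x * indicator (carrier G) x) \<in> borel_measurable borel"
    using F' by (subst (asm) borel_measurable_restrict_space_iff_ennreal) (auto cong: measurable_cong_sets)
  moreover have "(\<lambda>x. F x * indicator (carrier G) x) = (\<lambda>x. F x * indicator {0<..} (fst x))"
    by (auto simp: carrier_G indicator_def)
  ultimately show ?thesis by (simp add: lborel_prod)
qed

text \<open>
  In the coordinates of \<open>g \<cdot> (a, b)\<close> the variable \<open>b\<close> undergoes, for fixed \<open>a\<close>, an affine map of slope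
  \<open>\<alpha>\<close>, and \<open>a\<close> is scaled by \<open>\<alpha>\<close>; the density \<open>1/a\<^sup>2\<close> absorbs the two Jacobians.
\<close>

lemma haar_left_invariant:
  assumes g: "g \<in> carrier G"
  shows "distr haar haar (\<lambda>x. g \<cdot> x) = haar"
proof (rule haar_eq_distrI)
  have [measurable]: "(\<lambda>_. g) \<in> measurable haar haar" using g by (intro measurable_const) simp
  show m[measurable]: "(\<lambda>x. g \<cdot> x) \<in> measurable haar haar" by measurable
  obtain \<alpha> \<beta> where g_eq: "g = (\<alpha>, \<beta>)" by (cases g)
  have \<alpha>: "\<alpha> > 0" using g by (simp add: g_eq carrier_G)
  fix F :: "real \<times> real \<Rightarrow> ennreal" assume F [measurable]: "F \<in> borel_measurable haar"
  define H where "H = (\<lambda>x. F x * indicator {0<..} (fst x))"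
  have H[measurable]: "H \<in> borel_measurable (borel \<Otimes>\<^sub>M borel)"
    using measurable_haar_plane[OF F] unfolding H_def by (simp add: lborel_prod borel_prod)
  define P where "P a = (\<integral>\<^sup>+b. H (a, b) \<partial>lborel) * ennreal (1 / a\<^sup>2)" for a
  have [measurable]: "P \<in> borel_measurable borel" unfolding P_def by measurable
  have ind: "indicator {0<..} (\<alpha> * a) = (indicator {0<..} a :: ennreal)" for a :: real
    using \<alpha> by (simp add: indicator_def zero_less_mult_iff)
  have inner: "(\<integral>\<^sup>+b. H (\<alpha> * a, \<alpha> * b + \<beta> * inverse a) \<partial>lborel) * ennreal (1 / a\<^sup>2) = ennreal \<alpha> * P (\<alpha> * a)" for a
  proof -
    have "(\<integral>\<^sup>+b. H (\<alpha> * a, b) \<partial>lborel) = ennreal \<alpha> * (\<integral>\<^sup>+b. H (\<alpha> * a, \<beta> * inverse a + \<alpha> * b) \<partial>lborel)"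
      using \<alpha> by (subst nn_integral_real_affine[where c=\<alpha> and t="\<beta> * inverse a"]) auto
    moreover have "ennreal \<alpha> * (X * ennreal (1 / a\<^sup>2)) = ennreal \<alpha> * (ennreal \<alpha> * (ennreal \<alpha> * X * ennreal (1 / (\<alpha> * a)\<^sup>2)))" for X
    proof -
      have "ennreal (\<alpha> * \<alpha> * (1 / (\<alpha> * a)\<^sup>2)) = ennreal \<alpha> * ennreal \<alpha> * ennreal (1 / (\<alpha> * a)\<^sup>2)"
        using \<alpha> by (subst ennreal_mult, simp, simp, subst ennreal_mult) auto
      moreover have "\<alpha> * \<alpha> * (1 / (\<alpha> * a)\<^sup>2) = 1 / a\<^sup>2" using \<alpha> by (simp add: power2_eq_square)
      ultimately show ?thesis by (simp add: mult_ac)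
    qed
    ultimately have "ennreal \<alpha> * ((\<integral>\<^sup>+b. H (\<alpha> * a, \<alpha> * b + \<beta> * inverse a) \<partial>lborel) * ennreal (1 / a\<^sup>2)) = ennreal \<alpha> * (ennreal \<alpha> * P (\<alpha> * a))"
      unfolding P_def by (simp add: add.commute)
    then show ?thesis using \<alpha> by (simp add: ennreal_mult_cancel_left)
  qed
  have "(\<integral>\<^sup>+x. F (g \<cdot> x) \<partial>haar) =
      (\<integral>\<^sup>+a. \<integral>\<^sup>+b. F (g \<cdot> (a, b)) * indicator {0<..} a * ennreal (1 / a\<^sup>2) \<partial>lborel \<partial>lborel)"
    by (rule nn_integral_haar) measurable
  also have "\<dots> = (\<integral>\<^sup>+a. \<integral>\<^sup>+b. H (\<alpha> * a, \<alpha> * b + \<beta> * inverse a) * ennreal (1 / a\<^sup>2) \<partial>lborel \<partial>lborel)"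
    by (simp add: H_def gmult_eq g_eq ind)
  also have "\<dots> = (\<integral>\<^sup>+a. ennreal \<alpha> * P (\<alpha> * a) \<partial>lborel)"
    by (subst nn_integral_multc) (auto simp: inner)
  also have "\<dots> = (\<integral>\<^sup>+a. P a \<partial>lborel)"
    using \<alpha> by (subst nn_integral_real_affine[where c=\<alpha> and t=0 and f=P]) (auto simp: nn_integral_cmult)
  also have "\<dots> = (\<integral>\<^sup>+x. F x \<partial>haar)"
  proof -
    have "P a = (\<integral>\<^sup>+b. H (a, b) * ennreal (1 / a\<^sup>2) \<partial>lborel)" for a
      unfolding P_def by (rule nn_integral_multc[symmetric]) measurable
    then show ?thesis unfolding nn_integral_haar[OF F] H_def by simp
  qed
  finally show "(\<integral>\<^sup>+x. F (g \<cdot> x) \<partial>haar) = (\<integral>\<^sup>+x. F x \<partial>haar)" .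
qed

text \<open>
  The Haar measure of the multiplicative group of positive reals. In the coordinates \<open>(a, u)\<close> with \<open>b = u a\<close>
  the left Haar measure is its product with Lebesgue measure in \<open>u\<close>.
\<close>

definition mulhaar :: "real measure" where
  "mulhaar = density lborel (\<lambda>a. indicator {0<..} a * ennreal (1 / a))"

lemma nn_integral_mulhaar:
  "f \<in> borel_measurable borel \<Longrightarrow>
    (\<integral>\<^sup>+a. f a \<partial>mulhaar) = (\<integral>\<^sup>+a. f a * (indicator {0<..} a * ennreal (1 / a)) \<partial>lborel)"
  unfolding mulhaar_def by (subst nn_integral_density) (auto simp: mult_ac)

lemma nn_integral_mulhaar_scale:
  fixes c :: real
  assumes [measurable]: "f \<in> borel_measurable borel" and c: "c > 0"
  shows "(\<integral>\<^sup>+a. f (c * a) \<partial>mulhaar) = (\<integral>\<^sup>+a. f a \<partial>mulhaar)"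
proof -
  have *: "f (c * a) * (indicator {0<..} a * ennreal (1 / a)) =
     ennreal c * (f (c * a) * (indicator {0<..} (c * a) * ennreal (1 / (c * a))))" for a
    using c by (auto simp: indicator_def zero_less_mult_iff ennreal_mult[symmetric] mult_ac)
      (simp add: mult.assoc[symmetric] ennreal_mult[symmetric] mult.commute)
  show ?thesis
    using c apply (simp add: nn_integral_mulhaar *)
    apply (subst (2) nn_integral_real_affine[where c=c and t=0])
    by (auto simp: nn_integral_cmult)
qed

text \<open>
  The substitution rule for increasing maps on compact intervals is applied to \<open>- inverse x\<close> on \<open>[1/(n+1), n+1]\<close>, followed by a reflection and monotone convergence in \<open>n\<close>.
\<close>

lemma mulhaar_inverse: "distr mulhaar borel inverse = mulhaar"
proof (rule measure_eqI)
  show "sets (distr mulhaar borel inverse) = sets mulhaar" by (simp add: mulhaar_def)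
  fix A assume "A \<in> sets (distr mulhaar borel inverse)"
  then have A[measurable]: "A \<in> sets borel" by simp
  define f :: "nat \<Rightarrow> real \<Rightarrow> ennreal" where
    "f n a = indicator A a * (indicator {inverse (Suc n)..Suc n} a * ennreal (1 / a))" for n a
  define h :: "nat \<Rightarrow> real \<Rightarrow> ennreal" where
    "h n a = indicator A (inverse a) * (indicator {inverse (Suc n)..Suc n} a * ennreal (1 / a))" for n a
  have [measurable]: "f n \<in> borel_measurable borel" "h n \<in> borel_measurable borel" for n
    unfolding f_def h_def by measurable
  have fh: "(\<integral>\<^sup>+a. f n a \<partial>lborel) = (\<integral>\<^sup>+a. h n a \<partial>lborel)" for n
  proof -
    define u v :: real where "u = inverse (real (Suc n))" and "v = real (Suc n)"
    have uv: "0 < u" "u \<le> v"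
    proof -
      have "u \<le> 1" unfolding u_def by (subst inverse_le_1_iff) simp
      then show "u \<le> v" unfolding v_def by linarith
    qed (simp add: u_def)
    have vu: "inverse u = v" "inverse v = u" "1 / v = u" "1 / u = v" by (simp_all add: u_def v_def field_simps)
    let ?s = "\<lambda>x::real. - inverse x"
    have pos: "x > 0" if "x \<in> {u..v}" for x using that uv(1) by (meson atLeastAtMost_iff less_le_trans)
    have "(\<integral>\<^sup>+x. ennreal (indicator A (- x) * (1 / (- x)) * indicator {?s u..?s v} x) \<partial>lborel) =
        (\<integral>\<^sup>+x. ennreal ((indicator A (- ?s x) * (1 / (- ?s x))) * (1 / x\<^sup>2) * indicator {u..v} x) \<partial>lborel)"
    proof (rule nn_integral_substitution[where g = ?s and g' = "\<lambda>x. 1 / x\<^sup>2" and f = "\<lambda>x. indicator A (- x) * (1 / (- x))" and a = u and b = v])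
      show "set_borel_measurable borel {?s u..?s v} (\<lambda>x. indicator A (- x) * (1 / (- x)))"
        unfolding set_borel_measurable_def by measurable
      show "(?s has_real_derivative 1 / x\<^sup>2) (at x)" if "x \<in> {u..v}" for x
        using pos[OF that] by (auto intro!: derivative_eq_intros simp: power2_eq_square field_simps)
      show "continuous_on {u..v} (\<lambda>x. 1 / x\<^sup>2)"
        by (intro continuous_intros ballI) (use pos in fastforce)
      show "u \<le> v" by fact
    qed simp
    also have "\<dots> = (\<integral>\<^sup>+a. h n a \<partial>lborel)"
      unfolding h_def u_def[symmetric] v_def[symmetric]
      by (intro nn_integral_cong) (auto simp: indicator_def vu power2_eq_square divide_simps dest!: pos)
    also have "(\<integral>\<^sup>+x. ennreal (indicator A (- x) * (1 / (- x)) * indicator {?s u..?s v} x) \<partial>lborel)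
        = (\<integral>\<^sup>+x. f n x \<partial>lborel)"
    proof -
      have "(\<integral>\<^sup>+x. ennreal (indicator A (- x) * (1 / (- x)) * indicator {?s u..?s v} x) \<partial>lborel)
          = (\<integral>\<^sup>+x. ennreal (indicator A x * (1 / x) * indicator {?s u..?s v} (- x)) \<partial>lborel)"
        by (subst nn_integral_real_affine[where c="-1" and t=0]) auto
      also have "\<dots> = (\<integral>\<^sup>+x. f n x \<partial>lborel)"
        unfolding vu f_def u_def[symmetric] v_def[symmetric]
        by (intro nn_integral_cong) (auto simp: indicator_def)
      finally show ?thesis .
    qed
    finally show ?thesis .
  qed
  have sub: "{inverse (real (Suc m))..Suc m} \<subseteq> {inverse (real (Suc n))..Suc n}" if "m \<le> n" for m n
  proof -
    have "inverse (real (Suc n)) \<le> inverse (real (Suc m))" using that by (intro le_imp_inverse_le) auto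
    moreover have "real (Suc m) \<le> real (Suc n)" using that by simp
    ultimately show ?thesis by (simp only: atLeastatMost_subset_iff) simp
  qed
  have ind_mono: "indicator {inverse (real (Suc m))..Suc m} a \<le> (indicator {inverse (real (Suc n))..Suc n} a :: ennreal)"
    if "m \<le> n" for m n a
  proof -
    have "indicator A x \<le> (indicator B x :: ennreal)" if "A \<subseteq> B" for A B and x :: real
      using that by (auto simp: indicator_def)
    then show ?thesis using sub[OF that] by blast
  qed
  have inc: "incseq f" "incseq h"
    unfolding f_def h_def incseq_def le_fun_def
    by (intro allI impI mult_left_mono mult_right_mono ind_mono zero_le; assumption)+
  have lim: "(SUP n. (indicator {inverse (real (Suc n))..Suc n} a :: ennreal)) = indicator {0<..} a" for a :: real
  proof (cases "a > 0")
    case True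
    obtain n where n: "max a (inverse a) \<le> real n" using real_arch_simple by blast
    have "inverse (real (Suc n)) \<le> a"
      using n True by (intro inverse_le_imp_le[OF _ True]) (auto simp: )
    then have "a \<in> {inverse (real (Suc n))..Suc n}" using n by auto
    then show ?thesis using True
      by (intro antisym SUP_least SUP_upper2[of n]) (auto simp: indicator_def)
  next
    case False
    have "a \<notin> {inverse (real (Suc n))..Suc n}" for n
    proof -
      have "0 < inverse (real (Suc n))" by simp
      then show ?thesis using False less_le_trans[of 0 "inverse (real (Suc n))" a] by auto
    qed
    then show ?thesis using False by (auto simp: indicator_def)
  qed
  have "emeasure mulhaar A = (\<integral>\<^sup>+a. indicator A a * (indicator {0<..} a * ennreal (1 / a)) \<partial>lborel)"
    using nn_integral_mulhaar[of "indicator A"] by (simp add: mulhaar_def)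
  also have "\<dots> = (\<integral>\<^sup>+a. (SUP n. f n a) \<partial>lborel)"
    unfolding f_def lim[symmetric] by (simp add: SUP_mult_left_ennreal SUP_mult_right_ennreal)
  also have "\<dots> = (SUP n. \<integral>\<^sup>+a. f n a \<partial>lborel)"
    by (rule nn_integral_monotone_convergence_SUP) (use inc in auto)
  also have "\<dots> = (SUP n. \<integral>\<^sup>+a. h n a \<partial>lborel)" by (simp add: fh)
  also have "\<dots> = (\<integral>\<^sup>+a. (SUP n. h n a) \<partial>lborel)"
    by (rule nn_integral_monotone_convergence_SUP[symmetric]) (use inc in auto)
  also have "\<dots> = (\<integral>\<^sup>+a. indicator A (inverse a) * (indicator {0<..} a * ennreal (1 / a)) \<partial>lborel)"
    unfolding h_def lim[symmetric] by (simp add: SUP_mult_left_ennreal SUP_mult_right_ennreal)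
  also have "\<dots> = (\<integral>\<^sup>+a. indicator A (inverse a) \<partial>mulhaar)"
    by (rule nn_integral_mulhaar[symmetric]) measurable
  also have "\<dots> = emeasure (distr mulhaar borel inverse) A"
    apply (subst nn_integral_indicator[symmetric], simp)
    by (subst nn_integral_distr) (auto simp: mulhaar_def)
  finally show "emeasure (distr mulhaar borel inverse) A = emeasure mulhaar A" by simp
qed

lemma nn_integral_mulhaar_inverse:
  assumes [measurable]: "f \<in> borel_measurable borel"
  shows "(\<integral>\<^sup>+a. f (inverse a) \<partial>mulhaar) = (\<integral>\<^sup>+a. f a \<partial>mulhaar)"
proof -
  have "(\<integral>\<^sup>+a. f a \<partial>mulhaar) = (\<integral>\<^sup>+a. f a \<partial>distr mulhaar borel inverse)"
    by (simp add: mulhaar_inverse)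
  also have "\<dots> = (\<integral>\<^sup>+a. f (inverse a) \<partial>mulhaar)"
    by (rule nn_integral_distr) (auto simp: mulhaar_def)
  finally show ?thesis by simp
qed

section \<open>Invariance under the inversion of the half-plane\<close>

text \<open>
  Transport of \<open>z \<mapsto> - 1 / z\<close> from the upper half-plane, on which the group acts simply transitively.
  This map is not a group translation; together with the left translations it generates all of \<open>SL(2, \<real>)\<close>.
\<close>

definition invol :: "real \<times> real \<Rightarrow> real \<times> real" where
  "invol x = (1 / sqrt ((fst x)\<^sup>2 + (snd x)\<^sup>2), - (snd x / fst x) / sqrt ((fst x)\<^sup>2 + (snd x)\<^sup>2))"

lemma invol_in_G [simp]: "x \<in> carrier G \<Longrightarrow> invol x \<in> carrier G"
  by (auto simp: carrier_G invol_def intro!: add_pos_nonneg)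

lemma measurable_invol [measurable]: "invol \<in> measurable haar haar"
proof (rule measurable_to_haar)
  show "invol \<in> borel_measurable haar" unfolding invol_def by measurable
qed simp

lemma nn_integral_haar_slope:
  assumes F: "F \<in> borel_measurable haar"
  shows "(\<integral>\<^sup>+x. F x \<partial>haar) =
    (\<integral>\<^sup>+u. \<integral>\<^sup>+a. F (a, u * a) * indicator {0<..} a \<partial>mulhaar \<partial>lborel)"
proof -
  define H where "H = (\<lambda>x. F x * indicator {0<..} (fst x))"
  have H[measurable]: "H \<in> borel_measurable (borel \<Otimes>\<^sub>M borel)"
    using measurable_haar_plane[OF F] unfolding H_def by (simp add: lborel_prod borel_prod)
  define w where "w a = indicator {0<..} a * ennreal (1 / a)" for a :: real
  have [measurable]: "w \<in> borel_measurable borel" unfolding w_def by measurable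
  have inner: "(\<integral>\<^sup>+b. H (a, b) * ennreal (1 / a\<^sup>2) \<partial>lborel) = (\<integral>\<^sup>+u. H (a, u * a) * w a \<partial>lborel)" for a
  proof (cases "a > 0")
    case True
    have "(\<integral>\<^sup>+b. H (a, b) * ennreal (1 / a\<^sup>2) \<partial>lborel) =
      ennreal a * (\<integral>\<^sup>+u. H (a, u * a) * ennreal (1 / a\<^sup>2) \<partial>lborel)"
      using True by (subst nn_integral_real_affine[where c=a and t=0]) (auto simp: mult.commute[of a])
    also have "\<dots> = (\<integral>\<^sup>+u. ennreal a * (H (a, u * a) * ennreal (1 / a\<^sup>2)) \<partial>lborel)"
      by (rule nn_integral_cmult[symmetric]) measurable
    also have "\<dots> = (\<integral>\<^sup>+u. H (a, u * a) * w a \<partial>lborel)"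
    proof (rule nn_integral_cong)
      fix u
      have "ennreal a * ennreal (1 / a\<^sup>2) = w a"
        using True by (simp add: w_def ennreal_mult[symmetric] power2_eq_square)
      then show "ennreal a * (H (a, u * a) * ennreal (1 / a\<^sup>2)) = H (a, u * a) * w a"
        by (metis mult.left_commute)
    qed
    finally show ?thesis .
  qed (simp add: H_def)
  have "(\<integral>\<^sup>+x. F x \<partial>haar) = (\<integral>\<^sup>+a. \<integral>\<^sup>+b. H (a, b) * ennreal (1 / a\<^sup>2) \<partial>lborel \<partial>lborel)"
    unfolding nn_integral_haar[OF F] H_def by simp
  also have "\<dots> = (\<integral>\<^sup>+a. \<integral>\<^sup>+u. H (a, u * a) * w a \<partial>lborel \<partial>lborel)"
    unfolding inner ..
  also have "\<dots> = (\<integral>\<^sup>+u. \<integral>\<^sup>+a. H (a, u * a) * w a \<partial>lborel \<partial>lborel)"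
    by (rule lborel_pair.Fubini'[symmetric]) measurable
  also have "\<dots> = (\<integral>\<^sup>+u. \<integral>\<^sup>+a. H (a, u * a) \<partial>mulhaar \<partial>lborel)"
    by (subst nn_integral_mulhaar) (auto simp: w_def)
  finally show ?thesis unfolding H_def by simp
qed

text \<open>
  With \<open>b = u a\<close> the map sends \<open>u\<close> to \<open>- u\<close> and \<open>a\<close> to \<open>1 / (a sqrt (1 + u\<^sup>2))\<close>. For fixed \<open>u\<close> the
  second map is a dilation followed by an inversion, both of which preserve \<open>da / a\<close>.
\<close>

lemma haar_invol: "distr haar haar invol = haar"
proof (rule haar_eq_distrI)
  fix F :: "real \<times> real \<Rightarrow> ennreal" assume F [measurable]: "F \<in> borel_measurable haar"
  define H where "H = (\<lambda>x. F x * indicator {0<..} (fst x))"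
  have H[measurable]: "H \<in> borel_measurable (borel \<Otimes>\<^sub>M borel)"
    using measurable_haar_plane[OF F] unfolding H_def by (simp add: lborel_prod borel_prod)
  have eq: "F (invol (a, u * a)) * indicator {0<..} a =
      H (inverse (sqrt (1 + u\<^sup>2) * a), - u * inverse (sqrt (1 + u\<^sup>2) * a))" for u a
  proof (cases "a > 0")
    case True
    have "sqrt (a\<^sup>2 + (u * a)\<^sup>2) = sqrt (1 + u\<^sup>2) * a"
      using True by (intro real_sqrt_unique) (simp_all add: power_mult_distrib distrib_right)
    moreover have "sqrt (1 + u\<^sup>2) > 0" by (simp add: add_pos_nonneg)
    ultimately show ?thesis using True by (simp add: invol_def H_def field_simps)
  next
    case False
    have "sqrt (1 + u\<^sup>2) > 0" by (simp add: add_pos_nonneg)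
    then have "\<not> 0 < inverse (sqrt (1 + u\<^sup>2) * a)" using False
      by (simp only: inverse_positive_iff_positive zero_less_mult_iff) auto
    then show ?thesis using False by (simp add: H_def)
  qed
  have "(\<integral>\<^sup>+x. F (invol x) \<partial>haar) =
      (\<integral>\<^sup>+u. \<integral>\<^sup>+a. F (invol (a, u * a)) * indicator {0<..} a \<partial>mulhaar \<partial>lborel)"
    by (rule nn_integral_haar_slope) measurable
  also have "\<dots> = (\<integral>\<^sup>+u. \<integral>\<^sup>+a. H (a, - u * a) \<partial>mulhaar \<partial>lborel)"
  proof (rule nn_integral_cong)
    fix u :: real
    have "sqrt (1 + u\<^sup>2) > 0" by (simp add: add_pos_nonneg)
    then have "(\<integral>\<^sup>+a. H (inverse (sqrt (1 + u\<^sup>2) * a), - u * inverse (sqrt (1 + u\<^sup>2) * a)) \<partial>mulhaar)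
      = (\<integral>\<^sup>+a. H (inverse a, - u * inverse a) \<partial>mulhaar)"
      by (intro nn_integral_mulhaar_scale[where f="\<lambda>a. H (inverse a, - u * inverse a)"]) measurable
    also have "\<dots> = (\<integral>\<^sup>+a. H (a, - u * a) \<partial>mulhaar)"
      by (intro nn_integral_mulhaar_inverse[where f="\<lambda>a. H (a, - u * a)"]) measurable
    finally show "(\<integral>\<^sup>+a. F (invol (a, u * a)) * indicator {0<..} a \<partial>mulhaar) = (\<integral>\<^sup>+a. H (a, - u * a) \<partial>mulhaar)"
      unfolding eq .
  qed
  also have "\<dots> = (\<integral>\<^sup>+u. \<integral>\<^sup>+a. H (a, u * a) \<partial>mulhaar \<partial>lborel)"
  proof -
    define R where "R u = (\<integral>\<^sup>+a. H (a, u * a) \<partial>mulhaar)" for u :: real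
    have "R = (\<lambda>u. \<integral>\<^sup>+a. H (a, u * a) * (indicator {0<..} a * ennreal (1 / a)) \<partial>lborel)"
      by (simp add: R_def nn_integral_mulhaar fun_eq_iff)
    then have "R \<in> borel_measurable borel" by simp
    then have "(\<integral>\<^sup>+u. R u \<partial>lborel) = (\<integral>\<^sup>+u. R (- u) \<partial>lborel)"
      by (subst nn_integral_real_affine[where c="-1" and t=0]) auto
    then show ?thesis by (simp add: R_def)
  qed
  also have "\<dots> = (\<integral>\<^sup>+x. F x \<partial>haar)"
    unfolding nn_integral_haar_slope[OF F] H_def by simp
  finally show "(\<integral>\<^sup>+x. F (invol x) \<partial>haar) = (\<integral>\<^sup>+x. F x \<partial>haar)" .
qed measurable

section \<open>The kernel in half-plane coordinates\<close>

text \<open>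
  Up to constants the base of the power \<open>W s\<close>. It is twice the complex conjugate of the entry \<open>\<alpha>\<close> of the matrix
  of \<open>x\<close> in \<open>SU(1, 1)\<close>.
\<close>

definition Zc :: "real \<times> real \<Rightarrow> complex" where
  "Zc x = Complex (fst x + inverse (fst x)) (- snd x)"

text \<open>
  The point of the upper half-plane to which the matrix \<open>x\<close> moves \<open>\<i>\<close>.
\<close>

definition hp :: "real \<times> real \<Rightarrow> complex" where
  "hp x = Complex (fst x * snd x) ((fst x)\<^sup>2)"

lemma W_eq_Zc: "W s x = 2 powr complex_of_real s * Zc x powr complex_of_real (- s)"
  by (simp add: W_def Zc_def case_prod_beta)

lemma Re_Zc_pos: "x \<in> carrier G \<Longrightarrow> Re (Zc x) > 0"
  by (auto simp: carrier_G Zc_def intro: add_pos_pos)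

lemma Zc_nonzero: "x \<in> carrier G \<Longrightarrow> Zc x \<noteq> 0"
  using Re_Zc_pos[of x] by auto

lemma Zc_eq_hp: "x \<in> carrier G \<Longrightarrow> Zc x = - \<i> * (hp x + \<i>) / of_real (fst x)"
  by (auto simp: carrier_G Zc_def hp_def complex_eq_iff Re_divide Im_divide power2_eq_square field_simps)

text \<open>
  In half-plane coordinates the kernel becomes a Bergman kernel, a power of \<open>w - cnj z\<close>; its symmetries
  under Moebius maps can then be read off.
\<close>

lemma Zc_gquot:
  assumes "x \<in> carrier G" "y \<in> carrier G"
  shows "Zc (ginv x \<cdot> y) = - \<i> * (hp y - cnj (hp x)) / (of_real (fst x) * of_real (fst y))"
  using assms
  by (auto simp: gquot_eq carrier_G Zc_def hp_def complex_eq_iff Re_divide Im_divide power2_eq_square field_simps)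

lemma hp_gmult: "g \<in> carrier G \<Longrightarrow> x \<in> carrier G \<Longrightarrow>
    hp (g \<cdot> x) = of_real ((fst g)\<^sup>2) * hp x + of_real (fst g * snd g)"
  by (auto simp: gmult_eq carrier_G hp_def complex_eq_iff power2_eq_square field_simps)

lemma Im_hp_pos: "x \<in> carrier G \<Longrightarrow> Im (hp x) > 0"
  by (simp add: hp_def carrier_G)

lemma cmod_hp: "fst x > 0 \<Longrightarrow> cmod (hp x) = fst x * sqrt ((fst x)\<^sup>2 + (snd x)\<^sup>2)"
proof -
  assume "fst x > 0"
  then have "(fst x * snd x)\<^sup>2 + ((fst x)\<^sup>2)\<^sup>2 = (fst x)\<^sup>2 * ((fst x)\<^sup>2 + (snd x)\<^sup>2)"
    by (simp add: power2_eq_square algebra_simps)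
  then show ?thesis using \<open>fst x > 0\<close> by (simp add: hp_def complex_norm real_sqrt_mult)
qed

lemma fst_invol: "x \<in> carrier G \<Longrightarrow> fst (invol x) = fst x / cmod (hp x)"
  by (simp add: cmod_hp carrier_G invol_def)

lemma hp_invol: "x \<in> carrier G \<Longrightarrow> hp (invol x) = - 1 / hp x"
proof -
  assume x: "x \<in> carrier G"
  obtain a b where [simp]: "x = (a, b)" by (cases x)
  have a: "a > 0" using x by (simp add: carrier_G)
  define q where "q = a\<^sup>2 + b\<^sup>2"
  have q: "q > 0" using a by (auto simp: q_def intro: add_pos_nonneg)
  have eq: "hp (invol x) = Complex (- (b / a) / q) (1 / q)"
    using q a by (simp add: hp_def invol_def q_def[symmetric] power_divide field_simps)
  have m: "hp (invol x) * hp x = - 1"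
  proof -
    have "- (b / a) / q * (a * b) - 1 / q * a\<^sup>2 = - ((a\<^sup>2 + b\<^sup>2) / q)"
      using a q by (simp add: divide_simps) (simp add: power2_eq_square algebra_simps)
    also have "\<dots> = - 1" unfolding q_def[symmetric] using q by simp
    moreover have "- (b / a) / q * a\<^sup>2 + 1 / q * (a * b) = 0"
      using a q by (simp add: divide_simps power2_eq_square)
    ultimately have eqs: "- (b / a) / q * (a * b) - 1 / q * a\<^sup>2 = - 1" "- (b / a) / q * a\<^sup>2 + 1 / q * (a * b) = 0"
      by auto
    have "hp x = Complex (a * b) (a\<^sup>2)" by (simp add: hp_def)
    then show ?thesis unfolding eq
      by (simp only: complex_mult eqs) (simp add: complex_eq_iff)
  qed
  have "hp x \<noteq> 0" using Im_hp_pos[OF x] by auto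
  then show ?thesis using m by (metis nonzero_eq_divide_eq)
qed

text \<open>
  The modulus of \<open>W s\<close> and the weight are both powers of this function, which is comparable to the
  operator norm of the matrix \<open>x\<close>.
\<close>

definition N :: "real \<times> real \<Rightarrow> real" where "N x = cmod (Zc x)"

lemma N_pos: "x \<in> carrier G \<Longrightarrow> N x > 0"
  by (simp add: N_def Zc_nonzero)

lemma norm_powr_of_real: "cmod (z powr complex_of_real t) = cmod z powr t"
  by (simp add: norm_powr_complex)

lemma cmod_W: "cmod (W s x) = 2 powr s * N x powr (- s)"
  by (simp add: W_eq_Zc N_def norm_mult norm_powr_of_real flip: of_real_minus)

text \<open>
  The imaginary part of the half-plane point of \<open>x\<close> is \<open>(fst x)\<^sup>2\<close>, and that of its image under
  \<open>z \<mapsto> - 1 / z\<close> is \<open>(fst (invol x))\<^sup>2\<close>. These two functions thus control \<open>N\<close>.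
\<close>

lemma N_squared: "x \<in> carrier G \<Longrightarrow> (N x)\<^sup>2 = 1 / (fst x)\<^sup>2 + 1 / (fst (invol x))\<^sup>2 + 2"
proof -
  assume "x \<in> carrier G"
  then have "fst x > 0" by (simp add: carrier_G)
  then show ?thesis
  proof -
    have "(N x)\<^sup>2 = (fst x + inverse (fst x))\<^sup>2 + (snd x)\<^sup>2"
      unfolding N_def Zc_def cmod_power2 by simp
    moreover have "1 / (fst (invol x))\<^sup>2 = (fst x)\<^sup>2 + (snd x)\<^sup>2"
      by (simp add: invol_def power_divide)
    ultimately show ?thesis using \<open>fst x > 0\<close> by (simp add: power2_sum power_one_over inverse_eq_divide)
  qed
qed

lemma weight_eq_N: "weight r x = 2 powr r * N x powr r"
proof -
  have "((fst x + inverse (fst x))\<^sup>2 + (snd x)\<^sup>2) powr (r / 2) = (N x)\<^sup>2 powr (r / 2)"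
    by (simp add: N_def Zc_def cmod_power2)
  also have "\<dots> = N x powr r"
  proof -
    have "(N x)\<^sup>2 = N x powr 2" by (simp add: N_def)
    then show ?thesis by (simp only: powr_powr) simp
  qed
  finally show ?thesis by (simp add: weight_def case_prod_beta)
qed

lemma N_ge_2: "x \<in> carrier G \<Longrightarrow> N x \<ge> 2"
proof -
  assume "x \<in> carrier G"
  then have a: "fst x > 0" by (simp add: carrier_G)
  have "0 \<le> (fst x - 1)\<^sup>2 / fst x" using a by simp
  also have "\<dots> = fst x + inverse (fst x) - 2" using a by (simp add: power2_eq_square field_simps)
  finally have "2 \<le> Re (Zc x)" by (simp add: Zc_def)
  also have "\<dots> \<le> N x" unfolding N_def by (rule complex_Re_le_cmod)
  finally show ?thesis .
qed

lemma N_gquot: "x \<in> carrier G \<Longrightarrow> y \<in> carrier G \<Longrightarrow>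
    N (ginv x \<cdot> y) = cmod (hp y - cnj (hp x)) / (fst x * fst y)"
  by (simp add: N_def Zc_gquot norm_divide norm_mult carrier_G)

lemma N_eq_hp: "x \<in> carrier G \<Longrightarrow> N x = cmod (hp x + \<i>) / fst x"
  by (simp add: N_def Zc_eq_hp norm_divide norm_mult carrier_G)

lemma N_gquot_commute: "x \<in> carrier G \<Longrightarrow> y \<in> carrier G \<Longrightarrow> N (ginv x \<cdot> y) = N (ginv y \<cdot> x)"
proof -
  assume "x \<in> carrier G" "y \<in> carrier G"
  moreover have "cmod (hp y - cnj (hp x)) = cmod (hp x - cnj (hp y))"
    by (metis complex_cnj_cnj complex_cnj_diff complex_mod_cnj norm_minus_commute)
  ultimately show ?thesis by (simp add: N_gquot mult.commute)
qed

text \<open>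
  The modulus of the kernel depends only on the hyperbolic distance of the two points, which the inversion
  preserves.
\<close>

lemma N_gquot_invol:
  assumes "x \<in> carrier G" "y \<in> carrier G"
  shows "N (ginv (invol x) \<cdot> invol y) = N (ginv x \<cdot> y)"
proof -
  have nz: "hp x \<noteq> 0" "hp y \<noteq> 0" using Im_hp_pos[OF assms(1)] Im_hp_pos[OF assms(2)] by auto
  have "- 1 / hp y - cnj (- 1 / hp x) = (hp y - cnj (hp x)) / (hp y * cnj (hp x))"
    using nz by (simp add: field_simps)
  then have "cmod (hp (invol y) - cnj (hp (invol x))) = cmod (hp y - cnj (hp x)) / (cmod (hp y) * cmod (hp x))"
    using assms by (simp only: hp_invol norm_divide norm_mult complex_mod_cnj)
  then show ?thesis using assms nz by (simp add: N_gquot fst_invol field_simps)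
qed

lemma W_continuous: "continuous_on (carrier G) (W s)"
proof -
  have c: "continuous_on (carrier G) Zc"
    unfolding Zc_def Complex_eq using carrier_G by (intro continuous_intros) auto
  have "continuous_on (carrier G) (\<lambda>x. Zc x powr complex_of_real (- s))"
  proof (rule continuous_on_powr_complex[OF _ _ c])
    show "carrier G \<subseteq> {z. 0 \<le> Re (Zc z) \<or> Im (Zc z) \<noteq> 0}" using Re_Zc_pos by force
    show "Zc z = 0 \<Longrightarrow> 0 < Re (complex_of_real (- s))" if "z \<in> carrier G" for z
      using that Zc_nonzero by auto
  qed (intro continuous_intros)
  then show ?thesis unfolding W_eq_Zc by (rule continuous_on_mult[OF continuous_on_const])
qed

lemma measurable_W [measurable]: "W s \<in> borel_measurable haar"
  by (rule measurable_haar_continuous[OF W_continuous])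

lemma measurable_N [measurable]: "N \<in> borel_measurable haar"
proof -
  have "continuous_on (carrier G) N"
    unfolding N_def Zc_def Complex_eq using carrier_G by (intro continuous_intros) auto
  then show ?thesis by (rule measurable_haar_continuous)
qed

text \<open>
  The arguments of \<open>u\<close> and \<open>v\<close> are less than \<open>\<pi>/2\<close> in modulus, so their sum does not leave the range of the
  principal branch.
\<close>

lemma powr_mult_right_half_plane:
  assumes "Re u > 0" "Re v > 0"
  shows "(u * v) powr c = u powr c * v powr (c::complex)"
proof -
  have "u \<noteq> 0" "v \<noteq> 0" using assms by auto
  moreover have "\<bar>Im (Ln u)\<bar> < pi / 2" "\<bar>Im (Ln v)\<bar> < pi / 2"
    using assms by (simp_all only: Re_Ln_pos_lt_imp)
  ultimately have "Ln (u * v) = Ln u + Ln v" by (intro Ln_times_simple) auto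
  then show ?thesis using \<open>u \<noteq> 0\<close> \<open>v \<noteq> 0\<close> by (simp add: powr_def exp_add algebra_simps)
qed

section \<open>Eigenfunctions of the convolution kernel\<close>

lemma nn_integral_powr_from_0:
  fixes e :: real assumes "e > -1"
  shows "(\<integral>\<^sup>+x. indicator {0..1} x * ennreal (x powr e) \<partial>lborel) < \<infinity>"
proof -
  have "(\<integral>\<^sup>+x. ennreal (indicator {0..1} x * x powr e) \<partial>lborel) = ennreal (1 powr (e + 1) / (e + 1))"
    by (rule nn_integral_has_integral_lebesgue[OF _ has_integral_powr_from_0]) (use assms in simp_all)
  moreover have "ennreal (indicator A x * x powr e) = indicator A x * ennreal (x powr e)" for A and x :: real
    by (simp add: indicator_def)
  ultimately show ?thesis by simp
qed

lemma nn_integral_powr_to_inf: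
  fixes e :: real assumes "e < -1"
  shows "(\<integral>\<^sup>+x. indicator {1..} x * ennreal (x powr e) \<partial>lborel) < \<infinity>"
proof -
  have "(\<integral>\<^sup>+x. ennreal (indicator {1..} x * x powr e) \<partial>lborel) = ennreal (- (1 powr (e + 1)) / (e + 1))"
    by (rule nn_integral_has_integral_lebesgue[OF _ has_integral_powr_to_inf]) (use assms in auto)
  moreover have "ennreal (indicator A x * x powr e) = indicator A x * ennreal (x powr e)" for A and x :: real
    by (simp add: indicator_def)
  ultimately show ?thesis by simp
qed

text \<open>
  Majorised by the indicator of \<open>[-1, 1]\<close> and the tails \<open>\<bar>t\<bar> powr (- s)\<close>.
\<close>

lemma nn_integral_japanese_bracket:
  fixes s :: real assumes "s > 1"
  shows "(\<integral>\<^sup>+(t::real). ennreal ((1 + t\<^sup>2) powr (- s / 2)) \<partial>lborel) < \<infinity>"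
proof -
  define f where "f t = indicator {1..} t * ennreal (t powr (- s))" for t :: real
  have [measurable]: "f \<in> borel_measurable borel" unfolding f_def by measurable
  have bd: "(1 + t\<^sup>2) powr (- s / 2) \<le> \<bar>t\<bar> powr (- s)" if "\<bar>t\<bar> \<ge> 1" for t :: real
  proof -
    have "(1 + t\<^sup>2) powr (- s / 2) \<le> (\<bar>t\<bar> powr 2) powr (- s / 2)"
      using that assms by (intro powr_mono2') auto
    then show ?thesis unfolding powr_powr by simp
  qed
  have one: "(1 + t\<^sup>2) powr (- s / 2) \<le> 1" for t :: real
    using powr_mono2'[of "-s/2" 1 "1 + t\<^sup>2"] assms by simp
  have "ennreal ((1 + t\<^sup>2) powr (- s / 2)) \<le> indicator {-1..1} t + (f t + f (- t))" for t
  proof (cases "\<bar>t\<bar> \<ge> 1")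
    case True
    then have "ennreal ((1 + t\<^sup>2) powr (- s / 2)) \<le> f t + f (- t)"
      using bd[OF True] by (auto simp: f_def indicator_def abs_if ennreal_leI split: if_splits)
    then show ?thesis by (rule add_increasing[OF zero_le])
  next
    case False
    have "ennreal ((1 + t\<^sup>2) powr (- s / 2)) \<le> 1" using one[of t] by (simp add: ennreal_le_1)
    also have "1 = indicator {-1..1} t" using False by (auto simp: indicator_def)
    finally show ?thesis by (rule add_increasing2[OF zero_le])
  qed
  then have "(\<integral>\<^sup>+t. ennreal ((1 + t\<^sup>2) powr (- s / 2)) \<partial>lborel) \<le>
      (\<integral>\<^sup>+t. indicator {-1..1} t + (f t + f (- t)) \<partial>lborel)"
    by (rule nn_integral_mono)
  also have "\<dots> = 2 + ((\<integral>\<^sup>+t. f t \<partial>lborel) + (\<integral>\<^sup>+t. f (- t) \<partial>lborel))"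
    by (simp add: nn_integral_add)
  also have "(\<integral>\<^sup>+t. f (- t) \<partial>lborel) = (\<integral>\<^sup>+t. f t \<partial>lborel)"
    by (subst (2) nn_integral_real_affine[where c="-1" and t=0]) auto
  also have "2 + ((\<integral>\<^sup>+t. f t \<partial>lborel) + (\<integral>\<^sup>+t. f t \<partial>lborel)) < \<infinity>"
    using nn_integral_powr_to_inf[of "- s"] assms by (simp add: f_def)
  finally show ?thesis .
qed

text \<open>
  Integration over \<open>b\<close> leaves a multiple of \<open>(a + 1/a) powr (1 - s)\<close>, which converges because \<open>s > 1\<close>. The
  remaining integral over \<open>a\<close> converges at \<open>0\<close> because \<open>2 - s < c\<close>, and at infinity because \<open>c < s\<close>.
\<close>

lemma nn_integral_N_fst_finite:
  fixes s c :: real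
  assumes s: "s > 1" and c: "2 - s < c" "c < s"
  shows "(\<integral>\<^sup>+x. ennreal (fst x powr c * N x powr (- s)) \<partial>haar) < \<infinity>"
proof -
  define J where "J = (\<integral>\<^sup>+(t::real). ennreal ((1 + t\<^sup>2) powr (- s / 2)) \<partial>lborel)"
  have J: "J < \<infinity>" unfolding J_def by (rule nn_integral_japanese_bracket[OF s])
  have inner: "(\<integral>\<^sup>+b. ennreal (fst (a, b) powr c * N (a, b) powr (- s)) * indicator {0<..} a * ennreal (1 / a\<^sup>2) \<partial>lborel)
     \<le> J * (indicator {0..1} a * ennreal (a powr (s + c - 3)) + indicator {1..} a * ennreal (a powr (c - s - 1)))" for a
  proof (cases "a > 0")
    case a: True
    have [measurable]: "(\<lambda>b. N (a, b)) \<in> borel_measurable borel"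
      unfolding N_def Zc_def complex_norm by simp
    define P where "P = a + inverse a"
    have P: "P > 0" using a by (auto simp: P_def intro: add_pos_pos)
    have Nb: "N (a, P * t) powr (- s) = P powr (- s) * (1 + t\<^sup>2) powr (- s / 2)" for t
    proof -
      have "(N (a, P * t))\<^sup>2 = P\<^sup>2 * (1 + t\<^sup>2)"
        unfolding N_def Zc_def cmod_power2 by (simp flip: P_def add: power_mult_distrib distrib_left)
      also have "\<dots> = (P * sqrt (1 + t\<^sup>2))\<^sup>2" by (simp add: power_mult_distrib)
      finally have "N (a, P * t) = P * sqrt (1 + t\<^sup>2)"
        by (rule power2_eq_imp_eq) (use P in \<open>simp_all add: N_def\<close>)
      moreover have "sqrt (1 + t\<^sup>2) powr (- s) = ((1 + t\<^sup>2) powr (1 / 2)) powr (- s)"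
        by (subst powr_half_sqrt) auto
      then have "sqrt (1 + t\<^sup>2) powr (- s) = (1 + t\<^sup>2) powr (- s / 2)"
        by (simp only: powr_powr) simp
      ultimately show ?thesis using P by (simp only: powr_mult)
    qed
    have P1: "P powr (1 - s) = P * P powr (- s)"
      using P by (simp add: powr_diff powr_minus divide_inverse)
    have a2: "1 / a\<^sup>2 = a powr (- 2)"
      using a by (simp add: powr_minus divide_inverse)
    define k where "k = a powr c * (1 / a\<^sup>2) * P powr (1 - s)"
    have k0: "k \<ge> 0" by (simp add: k_def)
    have "(\<integral>\<^sup>+b. ennreal (fst (a, b) powr c * N (a, b) powr (- s)) * indicator {0<..} a * ennreal (1 / a\<^sup>2) \<partial>lborel)
      = (\<integral>\<^sup>+b. ennreal (a powr c * N (a, b) powr (- s) * (1 / a\<^sup>2)) \<partial>lborel)"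
    proof (rule nn_integral_cong)
      fix b
      have "a powr c * N (a, b) powr (- s) \<ge> 0" "1 / a\<^sup>2 \<ge> 0" by auto
      then show "ennreal (fst (a, b) powr c * N (a, b) powr (- s)) * indicator {0<..} a * ennreal (1 / a\<^sup>2)
        = ennreal (a powr c * N (a, b) powr (- s) * (1 / a\<^sup>2))"
        using a by (subst (2) ennreal_mult) auto
    qed
    also have "\<dots> = ennreal P * (\<integral>\<^sup>+t. ennreal (a powr c * N (a, P * t) powr (- s) * (1 / a\<^sup>2)) \<partial>lborel)"
      using P by (subst nn_integral_real_affine[where c=P and t=0 and f="\<lambda>b. ennreal (a powr c * N (a, b) powr (- s) * (1 / a\<^sup>2))"]) simp_all
    also have "\<dots> = (\<integral>\<^sup>+t. ennreal k * ennreal ((1 + t\<^sup>2) powr (- s / 2)) \<partial>lborel)"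
    proof -
      have "ennreal P * ennreal (a powr c * N (a, P * t) powr (- s) * (1 / a\<^sup>2)) = ennreal k * ennreal ((1 + t\<^sup>2) powr (- s / 2))" for t
      proof -
        have "P * (a powr c * N (a, P * t) powr (- s) * (1 / a\<^sup>2)) = k * (1 + t\<^sup>2) powr (- s / 2)"
          unfolding Nb k_def P1 by (simp only: mult_ac)
        moreover have "a powr c * N (a, P * t) powr (- s) * (1 / a\<^sup>2) \<ge> 0" "(1 + t\<^sup>2) powr (- s / 2) \<ge> 0" by auto
        ultimately show ?thesis
          by (simp only: ennreal_mult[OF less_imp_le[OF P], symmetric] ennreal_mult[OF k0, symmetric])
      qed
      then show ?thesis by (subst nn_integral_cmult[symmetric]) simp_all
    qed
    also have "\<dots> = ennreal k * J"
      unfolding J_def by (rule nn_integral_cmult) measurable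
    also have "ennreal k * J \<le> (indicator {0..1} a * ennreal (a powr (s + c - 3)) + indicator {1..} a * ennreal (a powr (c - s - 1))) * J"
    proof (intro mult_right_mono zero_le)
      show "ennreal k \<le> indicator {0..1} a * ennreal (a powr (s + c - 3)) + indicator {1..} a * ennreal (a powr (c - s - 1))"
      proof (cases "a \<le> 1")
        case True
        have "P powr (1 - s) \<le> inverse a powr (1 - s)"
          using a s by (intro powr_mono2') (auto simp: P_def)
        also have "inverse a = a powr (- 1)" using a by (simp add: powr_minus)
        also have "(a powr (- 1)) powr (1 - s) = a powr (s - 1)" by (simp only: powr_powr) simp
        finally have "k \<le> a powr c * (1 / a\<^sup>2) * a powr (s - 1)" unfolding k_def by (intro mult_left_mono) auto
        also have "\<dots> = a powr (s + c - 3)"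
          unfolding a2 powr_add[symmetric] by (simp add: algebra_simps)
        finally have "ennreal k \<le> indicator {0..1} a * ennreal (a powr (s + c - 3))"
          using True a by (simp add: ennreal_leI)
        then show ?thesis by (rule add_increasing2[OF zero_le])
      next
        case False
        have "P powr (1 - s) \<le> a powr (1 - s)"
          using a s by (intro powr_mono2') (auto simp: P_def)
        then have "k \<le> a powr c * (1 / a\<^sup>2) * a powr (1 - s)" unfolding k_def by (intro mult_left_mono) auto
        also have "\<dots> = a powr (c - s - 1)"
          unfolding a2 powr_add[symmetric] by (simp add: algebra_simps)
        finally have "ennreal k \<le> indicator {1..} a * ennreal (a powr (c - s - 1))"
          using False a by (simp add: ennreal_leI)
        then show ?thesis by (rule add_increasing[OF zero_le])
      qed
    qed
    finally show ?thesis by (simp only: mult.commute[of J])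
  qed simp
  have "(\<integral>\<^sup>+x. ennreal (fst x powr c * N x powr (- s)) \<partial>haar) \<le>
     (\<integral>\<^sup>+a. J * (indicator {0..1} a * ennreal (a powr (s + c - 3)) + indicator {1..} a * ennreal (a powr (c - s - 1))) \<partial>lborel)"
    by (subst nn_integral_haar) (measurable, rule nn_integral_mono, rule inner)
  also have "\<dots> = J * ((\<integral>\<^sup>+a. indicator {0..1} a * ennreal (a powr (s + c - 3)) \<partial>lborel) +
      (\<integral>\<^sup>+a. indicator {1..} a * ennreal (a powr (c - s - 1)) \<partial>lborel))"
    by (subst nn_integral_cmult) (auto simp: nn_integral_add)
  also have "\<dots> < \<infinity>"
    using nn_integral_powr_from_0[of "s + c - 3"] nn_integral_powr_to_inf[of "c - s - 1"] s c J
    by (auto simp: ennreal_mult_less_top)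
  finally show ?thesis .
qed

lemma nn_integral_haar_gmult:
  assumes g: "g \<in> carrier G" and F[measurable]: "F \<in> borel_measurable haar"
  shows "(\<integral>\<^sup>+x. F (g \<cdot> x) \<partial>haar) = (\<integral>\<^sup>+x. F x \<partial>haar)"
proof -
  have [measurable]: "(\<lambda>_. g) \<in> measurable haar haar" using g by (intro measurable_const) simp
  have "(\<integral>\<^sup>+x. F x \<partial>haar) = (\<integral>\<^sup>+x. F x \<partial>distr haar haar (\<lambda>x. g \<cdot> x))"
    using haar_left_invariant[OF g] by simp
  also have "\<dots> = (\<integral>\<^sup>+x. F (g \<cdot> x) \<partial>haar)" by (rule nn_integral_distr) measurable
  finally show ?thesis by simp
qed

lemma nn_integral_haar_invol:
  assumes F[measurable]: "F \<in> borel_measurable haar"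
  shows "(\<integral>\<^sup>+x. F (invol x) \<partial>haar) = (\<integral>\<^sup>+x. F x \<partial>haar)"
proof -
  have "(\<integral>\<^sup>+x. F x \<partial>haar) = (\<integral>\<^sup>+x. F x \<partial>distr haar haar invol)"
    using haar_invol by simp
  also have "\<dots> = (\<integral>\<^sup>+x. F (invol x) \<partial>haar)" by (rule nn_integral_distr) measurable
  finally show ?thesis by simp
qed

lemma measurable_N_gquot [measurable]:
  "y \<in> carrier G \<Longrightarrow> (\<lambda>x. N (ginv x \<cdot> y)) \<in> borel_measurable haar"
proof -
  assume y: "y \<in> carrier G"
  have [measurable]: "(\<lambda>_. y) \<in> measurable haar haar" using y by (intro measurable_const) simp
  show ?thesis by measurable
qed

text \<open>
  With \<open>Y\<close> and \<open>B\<close> the reciprocals of the two squares, \<open>N\<^sup>2 = Y + B + 2\<close>, and \<open>Y B \<ge> 1\<close> gives \<open>Y + B \<ge> 2\<close>.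
\<close>

lemma N_comparison:
  assumes x: "x \<in> carrier G"
  shows "(N x)\<^sup>2 \<le> 4 * max (1 / (fst x)\<^sup>2) (1 / (fst (invol x))\<^sup>2)"
    and "1 / (fst x)\<^sup>2 \<le> (N x)\<^sup>2" and "1 / (fst (invol x))\<^sup>2 \<le> (N x)\<^sup>2"
proof -
  define Y B where "Y = 1 / (fst x)\<^sup>2" and "B = 1 / (fst (invol x))\<^sup>2"
  have a: "fst x > 0" using x by (simp add: carrier_G)
  have nonneg: "Y > 0" "B > 0" using a invol_in_G[OF x] by (simp_all add: Y_def B_def carrier_G)
  have "B = (fst x)\<^sup>2 + (snd x)\<^sup>2" by (simp add: B_def invol_def power_divide)
  then have "Y * B \<ge> 1" using a by (simp add: Y_def field_simps)
  moreover have "(Y + B)\<^sup>2 = (Y - B)\<^sup>2 + 4 * (Y * B)" by (simp add: power2_eq_square algebra_simps)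
  ultimately have "(Y + B)\<^sup>2 \<ge> 4" using zero_le_power2[of "Y - B"] by linarith
  then have "(Y + B)\<^sup>2 \<ge> 2\<^sup>2" by simp
  then have YB: "Y + B \<ge> 2" using nonneg by (meson add_nonneg_nonneg less_imp_le power2_le_imp_le)
  have N: "(N x)\<^sup>2 = Y + B + 2" unfolding N_squared[OF x] Y_def B_def ..
  show "(N x)\<^sup>2 \<le> 4 * max (1 / (fst x)\<^sup>2) (1 / (fst (invol x))\<^sup>2)"
    using YB unfolding N Y_def[symmetric] B_def[symmetric] by (auto simp: max_def)
  show "1 / (fst x)\<^sup>2 \<le> (N x)\<^sup>2" "1 / (fst (invol x))\<^sup>2 \<le> (N x)\<^sup>2"
    using nonneg unfolding N Y_def[symmetric] B_def[symmetric] by auto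
qed

text \<open>
  The first coordinate is multiplicative, so the left invariance of the measure makes its powers
  eigenfunctions of every left-invariant kernel.
\<close>

lemma kernel_eigenfunction:
  assumes y: "y \<in> carrier G"
  shows "(\<integral>\<^sup>+x. ennreal (fst x powr c * N (ginv x \<cdot> y) powr (- s)) \<partial>haar) =
    ennreal (fst y powr c) * (\<integral>\<^sup>+x. ennreal (fst x powr c * N x powr (- s)) \<partial>haar)"
proof -
  note [measurable] = measurable_N_gquot[OF y]
  have "(\<integral>\<^sup>+x. ennreal (fst x powr c * N (ginv x \<cdot> y) powr (- s)) \<partial>haar) =
     (\<integral>\<^sup>+x. ennreal (fst (y \<cdot> x) powr c * N (ginv (y \<cdot> x) \<cdot> y) powr (- s)) \<partial>haar)"
    by (rule nn_integral_haar_gmult[OF y, symmetric]) measurable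
  also have "\<dots> = (\<integral>\<^sup>+x. ennreal (fst y powr c) * ennreal (fst x powr c * N x powr (- s)) \<partial>haar)"
  proof (rule nn_integral_cong)
    fix x assume "x \<in> space haar"
    then have x: "x \<in> carrier G" by simp
    interpret group G by (rule group_G)
    have "N (ginv (y \<cdot> x) \<cdot> y) = N (ginv y \<cdot> (y \<cdot> x))"
      using x y by (intro N_gquot_commute) auto
    also have "\<dots> = N x" using x y by (simp add: m_assoc[symmetric])
    finally show "ennreal (fst (y \<cdot> x) powr c * N (ginv (y \<cdot> x) \<cdot> y) powr (- s)) =
        ennreal (fst y powr c) * ennreal (fst x powr c * N x powr (- s))"
      using x y by (simp add: gmult_eq carrier_G powr_mult ennreal_mult[symmetric] mult_ac)
  qed
  also have "\<dots> = ennreal (fst y powr c) * (\<integral>\<^sup>+x. ennreal (fst x powr c * N x powr (- s)) \<partial>haar)"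
    by (rule nn_integral_cmult) measurable
  finally show ?thesis .
qed

text \<open>
  Transport of the previous eigenfunction by the inversion, which preserves both the measure and the kernel.
\<close>

lemma kernel_eigenfunction_invol:
  assumes y: "y \<in> carrier G"
  shows "(\<integral>\<^sup>+x. ennreal (fst (invol x) powr c * N (ginv x \<cdot> y) powr (- s)) \<partial>haar) =
    ennreal (fst (invol y) powr c) * (\<integral>\<^sup>+x. ennreal (fst x powr c * N x powr (- s)) \<partial>haar)"
proof -
  have iy: "invol y \<in> carrier G" using y by simp
  note [measurable] = measurable_N_gquot[OF iy]
  have "(\<integral>\<^sup>+x. ennreal (fst (invol x) powr c * N (ginv x \<cdot> y) powr (- s)) \<partial>haar) =
    (\<integral>\<^sup>+x. ennreal (fst (invol x) powr c * N (ginv (invol x) \<cdot> invol y) powr (- s)) \<partial>haar)"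
    using y by (intro nn_integral_cong) (simp add: N_gquot_invol)
  also have "\<dots> = (\<integral>\<^sup>+x. ennreal (fst x powr c * N (ginv x \<cdot> invol y) powr (- s)) \<partial>haar)"
    by (rule nn_integral_haar_invol) measurable
  also have "\<dots> = ennreal (fst (invol y) powr c) * (\<integral>\<^sup>+x. ennreal (fst x powr c * N x powr (- s)) \<partial>haar)"
    by (rule kernel_eigenfunction[OF iy])
  finally show ?thesis .
qed

text \<open>
  A Forelli--Rudin estimate. Let \<open>f1\<close> and \<open>f2\<close> be the two eigenfunctions with exponent \<open>c\<close>. By
  \<open>N_comparison\<close>, the power \<open>N powr (- c)\<close> is comparable to \<open>min f1 f2\<close> if \<open>c \<ge> 0\<close>, and to \<open>f1 + f2\<close> if
  \<open>c < 0\<close>. A positive operator maps a minimum of eigenfunctions with the same eigenvalue below a multiple of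
  that minimum, and it is linear on their sum.
\<close>

lemma kernel_preserves_N_power:
  fixes s c :: real
  assumes s: "s > 1" and c: "2 - s < c" "c < s"
  obtains A :: real where "A \<ge> 0" and
    "\<And>y. y \<in> carrier G \<Longrightarrow>
      (\<integral>\<^sup>+x. ennreal (N x powr (- c) * N (ginv x \<cdot> y) powr (- s)) \<partial>haar) \<le> ennreal (A * N y powr (- c))"
proof -
  obtain A0 where A0: "A0 \<ge> 0" and A0_eq: "(\<integral>\<^sup>+x. ennreal (fst x powr c * N x powr (- s)) \<partial>haar) = ennreal A0"
  proof (cases "\<integral>\<^sup>+x. ennreal (fst x powr c * N x powr (- s)) \<partial>haar" rule: ennreal_cases)
    case top
    then show ?thesis using nn_integral_N_fst_finite[OF s c] by simp
  qed (use that in auto)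
  define T where "T f y = (\<integral>\<^sup>+x. ennreal (f x * N (ginv x \<cdot> y) powr (- s)) \<partial>haar)" for f :: "real \<times> real \<Rightarrow> real" and y
  define f1 f2 where "f1 x = fst x powr c" and "f2 x = fst (invol x) powr c" for x :: "real \<times> real"
  have [measurable]: "f1 \<in> borel_measurable haar" "f2 \<in> borel_measurable haar" unfolding f1_def f2_def by measurable
  have pow: "t powr c = (1 / t\<^sup>2) powr (- c / 2)" if "t > 0" for t :: real
  proof -
    have "1 / t\<^sup>2 = t powr (- 2)" using that by (simp add: powr_minus divide_inverse)
    then show ?thesis by (simp only: powr_powr) simp
  qed
  have Npow: "N x powr (- c) = (N x)\<^sup>2 powr (- c / 2)" if "x \<in> carrier G" for x
  proof -
    have "(N x)\<^sup>2 = N x powr 2" using N_pos[OF that] by simp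
    then show ?thesis by (simp only: powr_powr) simp
  qed
  have f1: "T f1 y = ennreal (A0 * f1 y)" and f2: "T f2 y = ennreal (A0 * f2 y)" if "y \<in> carrier G" for y
  proof -
    show "T f1 y = ennreal (A0 * f1 y)"
      unfolding T_def f1_def kernel_eigenfunction[OF that] A0_eq using A0 by (simp add: ennreal_mult mult.commute)
    show "T f2 y = ennreal (A0 * f2 y)"
      unfolding T_def f2_def kernel_eigenfunction_invol[OF that] A0_eq using A0 by (simp add: ennreal_mult mult.commute)
  qed
  have mono: "T f y \<le> T g y" if "\<And>x. x \<in> carrier G \<Longrightarrow> f x \<le> g x" for f g y
    unfolding T_def by (intro nn_integral_mono ennreal_leI mult_right_mono that) auto
  define D where "D = (4::real) powr (\<bar>c\<bar> / 2)"
  have D: "D > 0" by (simp add: D_def)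
  show ?thesis
  proof (cases "c \<ge> 0")
    case True
    have up: "N x powr (- c) \<le> f1 x" "N x powr (- c) \<le> f2 x" and low: "min (f1 x) (f2 x) \<le> D * N x powr (- c)"
      if x: "x \<in> carrier G" for x
    proof -
      have pos: "fst x > 0" "fst (invol x) > 0" using x invol_in_G[OF x] by (simp_all add: carrier_G)
      define Y B where "Y = 1 / (fst x)\<^sup>2" and "B = 1 / (fst (invol x))\<^sup>2"
      have YB: "Y > 0" "B > 0" using pos by (simp_all add: Y_def B_def)
      have f: "f1 x = Y powr (- c / 2)" "f2 x = B powr (- c / 2)"
        unfolding f1_def f2_def Y_def B_def using pos by (simp_all only: pow)
      note comp = N_comparison[OF x, folded Y_def B_def]
      show "N x powr (- c) \<le> f1 x" "N x powr (- c) \<le> f2 x"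
        unfolding Npow[OF x] f 
        by (rule powr_mono2'; use True YB comp in simp)+
      have "min (f1 x) (f2 x) = (max Y B) powr (- c / 2)"
      proof (cases "Y \<le> B")
        case le: True
        then have "B powr (- c / 2) \<le> Y powr (- c / 2)" by (intro powr_mono2') (use True YB in simp_all)
        then show ?thesis using le by (simp add: f)
      next
        case le: False
        then have "Y powr (- c / 2) \<le> B powr (- c / 2)" by (intro powr_mono2') (use True YB in simp_all)
        then show ?thesis using le by (simp add: f max_def)
      qed
      also have "\<dots> \<le> ((N x)\<^sup>2 / 4) powr (- c / 2)"
        by (rule powr_mono2') (use comp(1) True N_pos[OF x] in simp_all)
      also have "\<dots> = D * N x powr (- c)"
      proof -
        have "(4::real) powr (- c / 2) = inverse D" 
          by (simp only: D_def abs_of_nonneg[OF True] powr_minus[symmetric] minus_divide_left)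
        moreover have "((N x)\<^sup>2 / 4) powr (- c / 2) = (N x)\<^sup>2 powr (- c / 2) / 4 powr (- c / 2)"
          by (rule powr_divide)
        ultimately show ?thesis
          by (simp only: Npow[OF x] divide_inverse[of _ "inverse D"] inverse_inverse_eq mult.commute)
      qed
      finally show "min (f1 x) (f2 x) \<le> D * N x powr (- c)" .
    qed
    show ?thesis
    proof (rule that[of "A0 * D"])
      show "A0 * D \<ge> 0" using A0 D by simp
      fix y assume y: "y \<in> carrier G"
      have "T (\<lambda>x. N x powr (- c)) y \<le> min (ennreal (A0 * f1 y)) (ennreal (A0 * f2 y))"
      proof (rule min.boundedI)
        show "T (\<lambda>x. N x powr (- c)) y \<le> ennreal (A0 * f1 y)" unfolding f1[OF y, symmetric] by (rule mono) (rule up)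
        show "T (\<lambda>x. N x powr (- c)) y \<le> ennreal (A0 * f2 y)" unfolding f2[OF y, symmetric] by (rule mono) (rule up)
      qed
      also have "\<dots> \<le> ennreal (A0 * min (f1 y) (f2 y))"
        by (cases "f1 y \<le> f2 y") (simp_all add: min.absorb1 min.absorb2)
      also have "\<dots> \<le> ennreal (A0 * (D * N y powr (- c)))"
        by (rule ennreal_leI, rule mult_left_mono[OF low[OF y] A0])
      finally show "(\<integral>\<^sup>+x. ennreal (N x powr (- c) * N (ginv x \<cdot> y) powr (- s)) \<partial>haar) \<le> ennreal (A0 * D * N y powr (- c))"
        unfolding T_def mult.assoc .
    qed
  next
    case False
    have up: "N x powr (- c) \<le> D * f1 x + D * f2 x" and low: "f1 x \<le> N x powr (- c)" "f2 x \<le> N x powr (- c)"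
      if x: "x \<in> carrier G" for x
    proof -
      have pos: "fst x > 0" "fst (invol x) > 0" using x invol_in_G[OF x] by (simp_all add: carrier_G)
      define Y B where "Y = 1 / (fst x)\<^sup>2" and "B = 1 / (fst (invol x))\<^sup>2"
      have YB: "Y > 0" "B > 0" using pos by (simp_all add: Y_def B_def)
      have f: "f1 x = Y powr (- c / 2)" "f2 x = B powr (- c / 2)"
        unfolding f1_def f2_def Y_def B_def using pos by (simp_all only: pow)
      note comp = N_comparison[OF x, folded Y_def B_def]
      show "f1 x \<le> N x powr (- c)" "f2 x \<le> N x powr (- c)"
        unfolding Npow[OF x] f 
        by (rule powr_mono2; use False YB comp in simp)+
      have "N x powr (- c) \<le> (4 * max Y B) powr (- c / 2)"
        unfolding Npow[OF x] by (rule powr_mono2) (use comp(1) False in simp_all)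
      also have "\<dots> = D * (max Y B) powr (- c / 2)" 
        using False YB by (simp only: powr_mult D_def abs_of_neg not_le)
      also have "\<dots> \<le> D * (f1 x + f2 x)" using D unfolding f by (intro mult_left_mono) (auto simp: max_def)
      finally show "N x powr (- c) \<le> D * f1 x + D * f2 x" by (simp add: distrib_left)
    qed
    show ?thesis
    proof (rule that[of "2 * D * A0"])
      show "2 * D * A0 \<ge> 0" using A0 D by simp
      fix y assume y: "y \<in> carrier G"
      note [measurable] = measurable_N_gquot[OF y]
      have "T (\<lambda>x. N x powr (- c)) y \<le> T (\<lambda>x. D * f1 x + D * f2 x) y"
        by (rule mono) (rule up)
      also have "\<dots> = (\<integral>\<^sup>+x. ennreal D * ennreal (f1 x * N (ginv x \<cdot> y) powr (- s)) + ennreal D * ennreal (f2 x * N (ginv x \<cdot> y) powr (- s)) \<partial>haar)"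
        unfolding T_def using D
      proof (intro nn_integral_cong)
        fix x
        let ?k = "N (ginv x \<cdot> y) powr (- s)"
        have "(D * f1 x + D * f2 x) * ?k = D * (f1 x * ?k) + D * (f2 x * ?k)" by (simp only: distrib_right mult.assoc)
        moreover have "f1 x * ?k \<ge> 0" "f2 x * ?k \<ge> 0" by (simp_all add: f1_def f2_def)
        ultimately show "ennreal ((D * f1 x + D * f2 x) * ?k) = ennreal D * ennreal (f1 x * ?k) + ennreal D * ennreal (f2 x * ?k)"
          using D by (simp only: ennreal_mult[OF less_imp_le[OF D]] ennreal_plus mult_nonneg_nonneg less_imp_le)
      qed
      also have "\<dots> = ennreal D * T f1 y + ennreal D * T f2 y"
        unfolding T_def by (subst nn_integral_add) (simp_all add: nn_integral_cmult)
      also have "\<dots> = ennreal (D * (A0 * f1 y) + D * (A0 * f2 y))"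
      proof -
        have "A0 * f1 y \<ge> 0" "A0 * f2 y \<ge> 0" using A0 by (simp_all add: f1_def f2_def)
        then show ?thesis unfolding f1[OF y] f2[OF y]
          using D by (simp only: ennreal_mult[OF less_imp_le[OF D]] ennreal_plus mult_nonneg_nonneg less_imp_le)
      qed
      also have "\<dots> \<le> ennreal (2 * D * A0 * N y powr (- c))"
      proof (rule ennreal_leI)
        have "D * (A0 * f1 y) + D * (A0 * f2 y) \<le> D * (A0 * N y powr (- c)) + D * (A0 * N y powr (- c))"
          using A0 D low[OF y] by (intro add_mono mult_left_mono) auto
        then show "D * (A0 * f1 y) + D * (A0 * f2 y) \<le> 2 * D * A0 * N y powr (- c)" by (simp add: algebra_simps)
      qed
      finally show "(\<integral>\<^sup>+x. ennreal (N x powr (- c) * N (ginv x \<cdot> y) powr (- s)) \<partial>haar) \<le> ennreal (2 * D * A0 * N y powr (- c))"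
        unfolding T_def .
    qed
  qed
qed

section \<open>Rotations of the disc and the reproducing formula\<close>

text \<open>
  The coordinate of the Poincare disc, up to the factor \<open>\<i>\<close>; the identity of the group sits at the origin.
\<close>

definition disc :: "real \<times> real \<Rightarrow> complex" where
  "disc x = (hp x - \<i>) / (hp x + \<i>)"

lemma hp_plus_i_nonzero: "x \<in> carrier G \<Longrightarrow> hp x + \<i> \<noteq> 0"
  using Im_hp_pos[of x] by (auto simp: complex_eq_iff)

lemma N_eq_disc:
  assumes x: "x \<in> carrier G"
  shows "(cmod (disc x))\<^sup>2 = 1 - 4 / (N x)\<^sup>2"
proof -
  have a: "fst x > 0" using x by (simp add: carrier_G)
  have p: "cmod (hp x + \<i>) > 0" using hp_plus_i_nonzero[OF x] by simp
  have "(cmod (hp x + \<i>))\<^sup>2 - (cmod (hp x - \<i>))\<^sup>2 = 4 * (fst x)\<^sup>2"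
    unfolding cmod_power2 by (simp add: hp_def power2_eq_square algebra_simps)
  then have "(cmod (hp x - \<i>))\<^sup>2 = (cmod (hp x + \<i>))\<^sup>2 - 4 * (fst x)\<^sup>2" by simp
  then have "(cmod (disc x))\<^sup>2 = 1 - 4 * (fst x)\<^sup>2 / (cmod (hp x + \<i>))\<^sup>2"
    unfolding disc_def norm_divide power_divide using p by (simp add: diff_divide_distrib)
  then show ?thesis using a p by (simp add: N_eq_hp[OF x] power_divide)
qed

lemma cmod_disc_less_1: "x \<in> carrier G \<Longrightarrow> cmod (disc x) < 1"
proof -
  assume x: "x \<in> carrier G"
  have "(cmod (disc x))\<^sup>2 < 1\<^sup>2" unfolding N_eq_disc[OF x] using N_pos[OF x] by simp
  then show ?thesis by (rule power2_less_imp_less) simp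
qed

lemma measurable_disc [measurable]: "disc \<in> borel_measurable haar"
proof (rule measurable_haar_continuous)
  show "continuous_on (carrier G) disc"
    unfolding disc_def hp_def Complex_eq using hp_plus_i_nonzero
    by (intro continuous_intros) (auto simp: hp_def Complex_eq)
qed

lemma measurable_cnj [measurable (raw)]:
  "f \<in> borel_measurable M \<Longrightarrow> (\<lambda>x. cnj (f x)) \<in> borel_measurable M"
  by (rule borel_measurable_continuous_on[where f=cnj]) (intro continuous_intros)

text \<open>
  A rotation of the disc is a Moebius map of the half-plane with nonzero lower left entry. Its Bruhat decomposition
  writes it as a left translation, the inversion and another left translation, and each of them preserves the
  measure.
\<close>

lemma haar_rotation:
  assumes \<theta>: "sin \<theta> > 0"
  obtains \<phi> where "\<phi> \<in> measurable haar haar" "distr haar haar \<phi> = haar"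
    "\<And>x. x \<in> carrier G \<Longrightarrow> disc (\<phi> x) = cis (2 * \<theta>) * disc x"
proof -
  define c s where "c = cos \<theta>" and "s = sin \<theta>"
  have s: "s > 0" using \<theta> by (simp add: s_def)
  \<comment> \<open>\<open>z \<mapsto> - c/s - 1 / (s\<^sup>2 z - s c)\<close> is the Bruhat form of the rotation matrix with cosine \<open>c\<close> and sine \<open>s\<close>.\<close>
  define g1 g2 where "g1 = (1::real, - c / s)" and "g2 = (s, - c)"
  have g: "g1 \<in> carrier G" "g2 \<in> carrier G" using s by (simp_all add: g1_def g2_def carrier_G)
  define \<phi> where "\<phi> x = g1 \<cdot> invol (g2 \<cdot> x)" for x
  have [measurable]: "(\<lambda>_. g1) \<in> measurable haar haar" "(\<lambda>_. g2) \<in> measurable haar haar"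
    using g by (auto intro!: measurable_const)
  have inv[measurable]: "(\<lambda>x. invol (g2 \<cdot> x)) \<in> measurable haar haar" by measurable
  have m: "\<phi> \<in> measurable haar haar" unfolding \<phi>_def by measurable
  have d: "distr haar haar \<phi> = haar"
  proof (rule haar_eq_distrI[OF m])
    fix F :: "real \<times> real \<Rightarrow> ennreal" assume F[measurable]: "F \<in> borel_measurable haar"
    have "(\<integral>\<^sup>+x. F (\<phi> x) \<partial>haar) = (\<integral>\<^sup>+x. F (g1 \<cdot> invol x) \<partial>haar)"
      unfolding \<phi>_def by (rule nn_integral_haar_gmult[OF g(2), of "\<lambda>x. F (g1 \<cdot> invol x)"]) measurable
    also have "\<dots> = (\<integral>\<^sup>+x. F (g1 \<cdot> x) \<partial>haar)"
      by (rule nn_integral_haar_invol[of "\<lambda>x. F (g1 \<cdot> x)"]) measurable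
    also have "\<dots> = (\<integral>\<^sup>+x. F x \<partial>haar)" by (rule nn_integral_haar_gmult[OF g(1)]) measurable
    finally show "(\<integral>\<^sup>+x. F (\<phi> x) \<partial>haar) = (\<integral>\<^sup>+x. F x \<partial>haar)" .
  qed
  have "disc (\<phi> x) = cis (2 * \<theta>) * disc x" if x: "x \<in> carrier G" for x
  proof -
    define z where "z = hp x"
    define C S where "C = complex_of_real c" and "S = complex_of_real s"
    have S0: "S \<noteq> 0" using s by (simp add: S_def)
    have CS: "C * C + S * S = 1"
      unfolding C_def S_def c_def s_def of_real_mult[symmetric] of_real_add[symmetric]
      by (simp add: power2_eq_square[symmetric])
    have w0: "S * z - C \<noteq> 0"
    proof
      assume "S * z - C = 0"
      then have "Im (S * z - C) = 0" by simp
      then show False using Im_hp_pos[OF x] s by (simp add: S_def C_def z_def)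
    qed
    have "hp (\<phi> x) = - 1 / (S * S * z - S * C) - C / S"
      using g x s unfolding \<phi>_def
      by (subst hp_gmult; simp add: hp_invol hp_gmult g1_def g2_def z_def S_def C_def power2_eq_square)
    also have "\<dots> = - (S + C * z) / (S * z - C)"
    proof -
      have "- 1 / (S * S * z - S * C) - C / S = (- 1 - C * (S * z - C)) / (S * (S * z - C))"
        using S0 w0 by (simp add: divide_simps) (simp add: algebra_simps)
      also have "- 1 - C * (S * z - C) = S * (- (S + C * z))" unfolding CS[symmetric] by (simp add: algebra_simps)
      finally show ?thesis unfolding nonzero_mult_divide_mult_cancel_left[OF S0] .
    qed
    finally have h: "hp (\<phi> x) = - (S + C * z) / (S * z - C)" .
    have n: "hp (\<phi> x) - \<i> = - ((C + \<i> * S) * (z - \<i>)) / (S * z - C)"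
      unfolding h using w0 by (simp add: divide_simps) (simp add: algebra_simps)
    have p: "hp (\<phi> x) + \<i> = - ((C - \<i> * S) * (z + \<i>)) / (S * z - C)"
      unfolding h using w0 by (simp add: divide_simps) (simp add: algebra_simps)
    have "disc (\<phi> x) = ((C + \<i> * S) / (C - \<i> * S)) * disc x"
      unfolding disc_def n p z_def[symmetric] using w0 by simp
    also have "C + \<i> * S = cis \<theta>" by (simp add: C_def S_def c_def s_def complex_eq_iff)
    also have "C - \<i> * S = inverse (cis \<theta>)" by (simp add: C_def S_def c_def s_def complex_eq_iff)
    also have "cis \<theta> / inverse (cis \<theta>) = cis (2 * \<theta>)" by (simp add: cis_divide)
    finally show ?thesis .
  qed
  then show ?thesis using that m d by blast
qed

lemma integrable_N_powr:
  assumes "s > 1" shows "integrable haar (\<lambda>x. N x powr (- 2 * s))"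
proof (rule integrableI_nonneg)
  have "(\<integral>\<^sup>+x. ennreal (N x powr (- 2 * s)) \<partial>haar) = (\<integral>\<^sup>+x. ennreal (fst x powr 0 * N x powr (- (2 * s))) \<partial>haar)"
    by (intro nn_integral_cong) (auto simp: carrier_G)
  also have "\<dots> < \<infinity>" using assms by (intro nn_integral_N_fst_finite) auto
  finally show "(\<integral>\<^sup>+x. ennreal (N x powr (- 2 * s)) \<partial>haar) < \<infinity>" .
qed auto

text \<open>
  The integrand is multiplied by \<open>- 1\<close> under the rotation of the disc by the angle \<open>\<pi> / n\<close>, while the measure
  does not change.
\<close>

lemma integral_disc_power_eq_0:
  assumes n: "n > 0"
  shows "(LINT x|haar. complex_of_real (N x powr t) * cnj (disc x) ^ n) = 0" (is "?I = 0")
proof -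
  \<comment> \<open>The half-plane rotation by \<open>\<theta>\<close> turns the disc by \<open>2 \<theta>\<close>, and \<open>cis (2 n \<theta>) = - 1\<close>.\<close>
  define \<theta> where "\<theta> = pi / (2 * real n)"
  have "0 < \<theta>" "\<theta> < pi" using n by (auto simp: \<theta>_def field_simps)
  then have "sin \<theta> > 0" by (rule sin_gt_zero)
  then obtain \<phi> where m[measurable]: "\<phi> \<in> measurable haar haar" and d: "distr haar haar \<phi> = haar"
    and r: "\<And>x. x \<in> carrier G \<Longrightarrow> disc (\<phi> x) = cis (2 * \<theta>) * disc x" by (rule haar_rotation) blast
  have meas: "(\<lambda>x. complex_of_real (N x powr t) * cnj (disc x) ^ n) \<in> borel_measurable haar"
    by measurable
  have "?I = (LINT x|distr haar haar \<phi>. complex_of_real (N x powr t) * cnj (disc x) ^ n)" by (simp add: d)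
  also have "\<dots> = (LINT x|haar. complex_of_real (N (\<phi> x) powr t) * cnj (disc (\<phi> x)) ^ n)"
    by (rule integral_distr[OF m meas])
  also have "\<dots> = (LINT x|haar. - (complex_of_real (N x powr t) * cnj (disc x) ^ n))"
  proof (rule Bochner_Integration.integral_cong[OF refl])
    fix x assume "x \<in> space haar"
    then have x: "x \<in> carrier G" and fx: "\<phi> x \<in> carrier G" using measurable_space[OF m] by auto
    have "(cmod (disc (\<phi> x)))\<^sup>2 = (cmod (disc x))\<^sup>2" by (simp add: r[OF x] norm_mult)
    then have "4 / (N (\<phi> x))\<^sup>2 = 4 / (N x)\<^sup>2" unfolding N_eq_disc[OF x] N_eq_disc[OF fx] by linarith
    then have "(N (\<phi> x))\<^sup>2 = (N x)\<^sup>2" by (simp only: divide_cancel_left) simp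
    then have N: "N (\<phi> x) = N x" using N_pos[OF x] N_pos[OF fx] by (metis less_imp_le power2_eq_iff_nonneg)
    have "cnj (cis (2 * \<theta>)) ^ n = cis (- pi)"
      using n unfolding cis_cnj Complex.DeMoivre by (simp add: \<theta>_def)
    also have "\<dots> = - 1" by (simp add: complex_eq_iff)
    finally show "complex_of_real (N (\<phi> x) powr t) * cnj (disc (\<phi> x)) ^ n = - (complex_of_real (N x powr t) * cnj (disc x) ^ n)"
      by (simp add: r[OF x] N power_mult_distrib)
  qed
  also have "\<dots> = - ?I" by simp
  finally show ?thesis by simp
qed

text \<open>
  The kernel is a sesquiholomorphic function of the two disc points up to a factor for each point, as
  reproducing kernels of Bergman spaces are. Both sides are powers of products of numbers in the right half-plane,
  hence no branch problem arises.
\<close>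

lemma W_product_expansion:
  assumes x: "x \<in> carrier G" and y: "y \<in> carrier G"
  shows "W s x * W s (ginv x \<cdot> y) =
    W s y * complex_of_real (4 powr s * N x powr (- 2 * s)) * (1 - cnj (disc x) * disc y) powr complex_of_real (- s)"
proof -
  define q where "q = cnj (disc x) * disc y"
  have q: "cmod q < 1"
    using mult_strict_mono'[OF cmod_disc_less_1[OF x] cmod_disc_less_1[OF y]] by (simp add: q_def norm_mult)
  then have Re_q: "Re (1 - q) > 0" using complex_Re_le_cmod[of q] by simp
  define t where "t = complex_of_real (- s)"
  define X where "X = Zc x" define Y where "Y = Zc y" define V where "V = Zc (ginv x \<cdot> y)"
  have pos: "Re X > 0" "Re Y > 0" "Re V > 0" 
    unfolding X_def Y_def V_def by (intro Re_Zc_pos G_closed x y)+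
  have "cnj (hp x) - \<i> = cnj (hp x + \<i>)" by simp
  then have "cnj (hp x) - \<i> \<noteq> 0" using hp_plus_i_nonzero[OF x] by (simp only: complex_cnj_zero_iff not_False_eq_True)
  moreover have "fst x \<noteq> 0" "fst y \<noteq> 0" using x y by (simp_all add: carrier_G)
  ultimately have nz: "hp x + \<i> \<noteq> 0" "cnj (hp x) - \<i> \<noteq> 0" "hp y + \<i> \<noteq> 0" "fst x \<noteq> 0" "fst y \<noteq> 0"
    using hp_plus_i_nonzero[OF x] hp_plus_i_nonzero[OF y] by blast+
  have cX: "cnj X = \<i> * (cnj (hp x) - \<i>) / of_real (fst x)" using x by (simp add: X_def Zc_eq_hp)
  have Y: "Y = - \<i> * (hp y + \<i>) / of_real (fst y)" using y by (simp add: Y_def Zc_eq_hp)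
  have V: "V = - \<i> * (hp y - cnj (hp x)) / (of_real (fst x) * of_real (fst y))"
    using x y by (simp add: V_def Zc_gquot)
  have q1: "1 - q = - 2 * \<i> * (hp y - cnj (hp x)) / ((cnj (hp x) - \<i>) * (hp y + \<i>))"
    using nz unfolding q_def disc_def by (simp add: divide_simps) (simp add: algebra_simps)
  have key: "2 * V = cnj X * Y * (1 - q)"
    unfolding cX Y V q1 using nz by (simp add: divide_simps)
  have nq: "1 - q \<noteq> 0" using Re_q by auto
  have Re_iq: "Re (inverse (1 - q)) > 0"
    unfolding inverse_complex.sel using Re_q by (intro divide_pos_pos add_pos_nonneg) auto
  have "2 * V * inverse (1 - q) = cnj X * Y"
    by (simp only: key mult.assoc right_inverse[OF nq] mult_1_right)
  moreover have "Re (2 * V) > 0" "Re (cnj X) > 0" using pos by simp_all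
  ultimately have p1: "(2 * V) powr t * inverse (1 - q) powr t = cnj X powr t * Y powr t"
    using pos Re_iq by (metis powr_mult_right_half_plane)
  have "inverse (1 - q) powr t * (1 - q) powr t = (inverse (1 - q) * (1 - q)) powr t"
    by (rule powr_mult_right_half_plane[OF Re_iq Re_q, symmetric])
  then have p2: "inverse (1 - q) powr t * (1 - q) powr t = 1" using nq by simp
  have p3: "(2 * V) powr t = 2 powr t * V powr t"
    by (rule powr_mult_right_half_plane) (use pos in simp_all)
  have "2 powr t * V powr t = (2 * V) powr t * (inverse (1 - q) powr t * (1 - q) powr t)"
    unfolding p2 p3 by simp
  also have "\<dots> = cnj X powr t * Y powr t * (1 - q) powr t"
    unfolding mult.assoc[symmetric] p1 ..
  finally have main: "2 powr t * V powr t = cnj X powr t * Y powr t * (1 - q) powr t" .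
  have "X powr t * cnj X powr t = (X * cnj X) powr t"
    by (rule powr_mult_right_half_plane[symmetric]) (use pos in simp_all)
  also have "X * cnj X = complex_of_real ((N x)\<^sup>2)"
    unfolding N_def X_def by (rule complex_norm_square[symmetric])
  also have "complex_of_real ((N x)\<^sup>2) powr t = complex_of_real ((N x)\<^sup>2 powr (- s))"
    unfolding t_def by (rule powr_of_real) simp
  also have "(N x)\<^sup>2 powr (- s) = N x powr (- 2 * s)"
  proof -
    have "(N x)\<^sup>2 = N x powr 2" using N_pos[OF x] by simp
    then show ?thesis by (simp only: powr_powr) simp
  qed
  finally have XX: "X powr t * cnj X powr t = complex_of_real (N x powr (- 2 * s))" .
  have two: "2 powr complex_of_real s = complex_of_real (2 powr s)" "2 powr t = complex_of_real (2 powr (- s))"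
    unfolding t_def using powr_of_real[of 2 s] powr_of_real[of 2 "- s"] by simp_all
  have "V powr t = complex_of_real (2 powr s) * (cnj X powr t * Y powr t * (1 - q) powr t)"
    unfolding main[symmetric] two mult.assoc[symmetric] of_real_mult[symmetric] by (simp flip: powr_add)
  then have "W s x * W s (ginv x \<cdot> y) = complex_of_real (2 powr s) * Y powr t *
      (complex_of_real (2 powr s * 2 powr s) * (X powr t * cnj X powr t)) * (1 - q) powr t"
    unfolding W_eq_Zc X_def[symmetric] V_def[symmetric] t_def[symmetric] two by (simp add: mult_ac)
  also have "2 powr s * 2 powr s = 4 powr s" by (simp flip: powr_mult)
  finally have "W s x * W s (ginv x \<cdot> y) = complex_of_real (2 powr s) * Y powr t *
      (complex_of_real (4 powr s) * complex_of_real (N x powr (- 2 * s))) * (1 - q) powr t"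
    unfolding XX .
  then show ?thesis
    unfolding W_eq_Zc[of s y] two Y_def[symmetric] t_def[symmetric] q_def[symmetric]
    by (simp only: of_real_mult mult_ac)
qed

text \<open>
  This is the mean value property. By \<open>W_product_expansion\<close> and the binomial series the integrand is a power series
  in the conjugate disc coordinate of \<open>x\<close> times a rotation invariant function. By \<open>integral_disc_power_eq_0\<close>
  only the constant term survives the integration.
\<close>

theorem W_reproducing:
  assumes s: "s > 1" and y: "y \<in> carrier G"
  shows "(LINT x|haar. W s x * W s (ginv x \<cdot> y)) = complex_of_real (LINT x|haar. 4 powr s * N x powr (- 2 * s)) * W s y"
proof -
  define m where "m x = complex_of_real (4 powr s * N x powr (- 2 * s))" for x
  define a where "a n = (complex_of_real (- s) gchoose n) * (- disc y) ^ n" for n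
  define f where "f n x = W s y * m x * a n * cnj (disc x) ^ n" for n x
  have [measurable]: "m \<in> borel_measurable haar" "f n \<in> borel_measurable haar" for n
    unfolding m_def f_def by measurable
  have int_m: "integrable haar (\<lambda>x. cmod (W s y) * cmod (a n) * (4 powr s * N x powr (- 2 * s)))" for n
    using integrable_N_powr[OF s] by simp
  have bound: "cmod (f n x) \<le> cmod (W s y) * cmod (a n) * (4 powr s * N x powr (- 2 * s))" if "x \<in> carrier G" for n x
  proof -
    have "cmod (f n x) = cmod (W s y) * cmod (a n) * (4 powr s * N x powr (- 2 * s)) * cmod (disc x) ^ n"
      by (simp add: f_def m_def norm_mult norm_power)
    also have "\<dots> \<le> cmod (W s y) * cmod (a n) * (4 powr s * N x powr (- 2 * s)) * 1"
      using cmod_disc_less_1[OF that] by (intro mult_left_mono power_le_one) auto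
    finally show ?thesis by simp
  qed
  have int_f: "integrable haar (f n)" for n
    using bound by (intro Bochner_Integration.integrable_bound[OF int_m[of n]]) auto
  have rad: "1 \<le> conv_radius (\<lambda>n. complex_of_real (- s) gchoose n)"
    by (simp add: conv_radius_gchoose one_ereal_def)
  have abs_a: "summable (\<lambda>n. cmod (a n))"
    unfolding a_def
    by (rule abs_summable_in_conv_radius, rule less_le_trans[OF _ rad]) (use cmod_disc_less_1[OF y] in simp)
  have sum_norm: "summable (\<lambda>n. LINT x|haar. cmod (f n x))"
  proof (rule summable_comparison_test')
    define K where "K = (LINT x|haar. 4 powr s * N x powr (- 2 * s))"
    show "summable (\<lambda>n. cmod (W s y) * cmod (a n) * K)"
      using abs_a by (intro summable_mult2 summable_mult)
    fix n
    have "(LINT x|haar. cmod (f n x)) \<le> (LINT x|haar. cmod (W s y) * cmod (a n) * (4 powr s * N x powr (- 2 * s)))"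
      using bound by (intro integral_mono integrable_norm int_f int_m) auto
    also have "\<dots> = cmod (W s y) * cmod (a n) * K" unfolding K_def by (rule integral_mult_right_zero)
    finally show "norm (LINT x|haar. cmod (f n x)) \<le> cmod (W s y) * cmod (a n) * K" by simp
  qed
  have sum_ptw: "AE x in haar. summable (\<lambda>n. norm (f n x))"
  proof (rule AE_I2)
    fix x assume "x \<in> space haar"
    then have x: "x \<in> carrier G" by simp
    show "summable (\<lambda>n. norm (f n x))"
      by (rule summable_comparison_test'[where g="\<lambda>n. cmod (W s y) * cmod (a n) * (4 powr s * N x powr (- 2 * s))"])
        (use abs_a bound[OF x] in \<open>auto intro!: summable_mult2 summable_mult\<close>)
  qed
  have eq: "W s x * W s (ginv x \<cdot> y) = (\<Sum>n. f n x)" if x: "x \<in> carrier G" for x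
  proof -
    define q where "q = - (cnj (disc x) * disc y)"
    have q: "cmod q < 1"
      using mult_strict_mono'[OF cmod_disc_less_1[OF x] cmod_disc_less_1[OF y]] by (simp add: q_def norm_mult)
    have "(\<lambda>n. W s y * m x * ((complex_of_real (- s) gchoose n) * q ^ n)) sums
        (W s y * m x * (1 + q) powr complex_of_real (- s))"
      by (intro sums_mult gen_binomial_complex q)
    moreover have "W s y * m x * ((complex_of_real (- s) gchoose n) * q ^ n) = f n x" for n
      unfolding f_def a_def q_def by (simp add: power_mult_distrib[symmetric] mult_ac)
    ultimately have "(\<lambda>n. f n x) sums (W s x * W s (ginv x \<cdot> y))"
      unfolding W_product_expansion[OF x y] by (simp add: q_def m_def)
    then show ?thesis by (simp add: sums_iff)
  qed
  have "(LINT x|haar. W s x * W s (ginv x \<cdot> y)) = (LINT x|haar. (\<Sum>n. f n x))"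
    by (rule Bochner_Integration.integral_cong) (simp_all add: eq)
  also have "\<dots> = (\<Sum>n. LINT x|haar. f n x)"
    by (rule integral_suminf[OF int_f sum_ptw sum_norm])
  also have "\<dots> = (LINT x|haar. f 0 x)"
  proof (rule sums_unique[symmetric])
    have "(LINT x|haar. f n x) = 0" if "n \<noteq> 0" for n
    proof -
      have "(LINT x|haar. f n x) = (LINT x|haar. (W s y * a n * complex_of_real (4 powr s)) * (complex_of_real (N x powr (- 2 * s)) * cnj (disc x) ^ n))"
        by (intro Bochner_Integration.integral_cong) (simp_all add: f_def m_def mult_ac)
      also have "\<dots> = 0" using integral_disc_power_eq_0[of n "- 2 * s"] that by simp
      finally show ?thesis .
    qed
    then have "(\<lambda>n. LINT x|haar. f n x) = (\<lambda>n. if n = 0 then LINT x|haar. f 0 x else 0)" by auto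
    then show "(\<lambda>n. LINT x|haar. f n x) sums (LINT x|haar. f 0 x)"
      using sums_single[of 0 "\<lambda>n. LINT x|haar. f 0 x"] by simp
  qed
  also have "\<dots> = (LINT x|haar. W s y * m x)" by (simp add: f_def a_def)
  also have "\<dots> = W s y * (LINT x|haar. m x)" by (rule integral_mult_right_zero)
  also have "(LINT x|haar. m x) = complex_of_real (LINT x|haar. 4 powr s * N x powr (- 2 * s))"
    unfolding m_def by (rule integral_complex_of_real)
  finally show ?thesis by (simp add: mult.commute)
qed

text \<open>
  By left invariance it is enough to look at \<open>U\<close> itself, which contains a nonempty open set.
\<close>

lemma haar_ball_pos:
  assumes U: "compact_nhd_one U" and x: "x \<in> carrier G"
  shows "0 < emeasure haar {v \<in> carrier G. ginv x \<cdot> v \<in> U}"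
proof -
  have UG: "U \<subseteq> carrier G" and one: "(1, 0) \<in> interior U" and cU: "compact U"
    using U by (auto simp: compact_nhd_one_def G_def)
  have Um[measurable]: "U \<in> sets haar"
    using cU UG by (auto simp: sets_haar sets_restrict_space image_iff intro!: bexI[of _ U] borel_closed compact_imp_closed)
  have ix: "ginv x \<in> carrier G" using x by simp
  have [measurable]: "(\<lambda>_. ginv x) \<in> measurable haar haar" using ix by (intro measurable_const) simp
  have "emeasure haar {v \<in> carrier G. ginv x \<cdot> v \<in> U} = emeasure (distr haar haar (\<lambda>v. ginv x \<cdot> v)) U"
    by (subst emeasure_distr) (auto intro!: arg_cong2[where f=emeasure])
  also have "\<dots> = emeasure haar U" using haar_left_invariant[OF ix] by simp
  finally have eq: "emeasure haar {v \<in> carrier G. ginv x \<cdot> v \<in> U} = emeasure haar U" .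
  have "emeasure haar U \<noteq> 0"
  proof
    assume "emeasure haar U = 0"
    then have "AE x in haar. x \<notin> U" by (intro AE_not_in) auto
    moreover have "(\<lambda>x::real \<times> real. 1 / (fst x)\<^sup>2) \<in> borel_measurable borel"
      unfolding borel_prod[symmetric] by measurable
    then have "(\<lambda>(a, b). ennreal (1 / a\<^sup>2)) \<in> borel_measurable (restrict_space lborel (carrier G))"
      unfolding case_prod_beta' by (intro measurable_restrict_space1) simp
    ultimately have "AE x in restrict_space lborel (carrier G). x \<in> carrier G \<longrightarrow> x \<notin> U"
      unfolding haar_def by (subst (asm) AE_density) (auto simp: carrier_G elim!: AE_mp)
    then have "AE x in lborel. x \<in> carrier G \<longrightarrow> x \<notin> U" by (subst (asm) AE_restrict_space_iff) auto
    then have "AE x in lborel. x \<notin> U" using UG by auto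
    then have "emeasure lborel U = 0"
      using cU by (subst (asm) AE_iff_measurable[OF _ refl]) (auto intro!: borel_closed compact_imp_closed)
    then have "U \<in> null_sets lebesgue"
      using cU by (intro null_sets_completionI null_setsI) (auto intro!: borel_closed compact_imp_closed)
    then have "negligible (interior U)"
      using negligible_subset[OF _ interior_subset] by (simp add: negligible_iff_null_sets)
    moreover have "\<not> negligible (interior U)"
      using one by (intro open_not_negligible) auto
    ultimately show False by simp
  qed
  then show ?thesis unfolding eq by (simp add: zero_less_iff_neq_zero)
qed

section \<open>Oscillation of the kernel under small translations\<close>

text \<open>
  The power is multiplicative on the right half-plane, so the relative change depends on \<open>Z' / Z\<close> alone, and
  continuity at \<open>1\<close> suffices.
\<close>

lemma powr_relative_continuity:
  fixes t :: complex and \<epsilon> :: real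
  assumes "\<epsilon> > 0"
  obtains \<delta> where "\<delta> > 0"
    "\<And>Z Z'. Re Z > 0 \<Longrightarrow> cmod (Z' - Z) \<le> \<delta> * cmod Z \<Longrightarrow> cmod (Z' powr t - Z powr t) \<le> \<epsilon> * cmod (Z powr t)"
proof -
  have "isCont (\<lambda>w. w powr t) 1"
    by (intro continuous_intros) auto
  then obtain d where d: "d > 0" "\<And>w. dist w 1 < d \<Longrightarrow> dist (w powr t) (1 powr t) < \<epsilon>"
    unfolding continuous_at_eps_delta using assms by meson
  define \<delta> where "\<delta> = min (d / 2) (1 / 2)"
  have \<delta>: "\<delta> > 0" "\<delta> < d" "\<delta> < 1" using d(1) by (auto simp: \<delta>_def)
  show ?thesis
  proof (rule that[OF \<delta>(1)])
    fix Z Z' assume Z: "Re Z > 0" and le: "cmod (Z' - Z) \<le> \<delta> * cmod Z"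
    have Z0: "Z \<noteq> 0" using Z by auto
    define w where "w = Z' / Z"
    have Z': "Z' = Z * w" using Z0 by (simp add: w_def)
    have "w - 1 = (Z' - Z) / Z" using Z0 by (simp add: w_def diff_divide_distrib)
    then have "cmod (w - 1) = cmod (Z' - Z) / cmod Z" by (simp only: norm_divide)
    also have "\<dots> \<le> \<delta>" using le Z0 by (simp add: divide_le_eq)
    finally have w: "cmod (w - 1) \<le> \<delta>" .
    then have "\<bar>Re (w - 1)\<bar> \<le> \<delta>" using abs_Re_le_cmod[of "w - 1"] by linarith
    then have "Re w > 0" using \<delta>(3) by simp
    then have "Z' powr t = Z powr t * w powr t"
      unfolding Z' by (rule powr_mult_right_half_plane[OF Z])
    then have "Z' powr t - Z powr t = Z powr t * (w powr t - 1)" by (simp only: right_diff_distrib mult_1_right)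
    then have "cmod (Z' powr t - Z powr t) = cmod (Z powr t) * cmod (w powr t - 1)" by (simp only: norm_mult)
    also have "\<dots> \<le> cmod (Z powr t) * \<epsilon>"
    proof (rule mult_left_mono)
      show "cmod (w powr t - 1) \<le> \<epsilon>" using d(2)[of w] w \<delta>(2) by (simp add: dist_norm)
    qed simp
    finally show "cmod (Z' powr t - Z powr t) \<le> \<epsilon> * cmod (Z powr t)"
      by (simp only: mult.commute)
  qed
qed

lemma coordinates_le_N:
  assumes "z \<in> carrier G"
  shows "fst z \<le> N z" "inverse (fst z) \<le> N z" "\<bar>snd z\<bar> \<le> N z"
proof -
  have a: "fst z > 0" using assms by (simp add: carrier_G)
  have "Re (Zc z) \<le> N z" unfolding N_def by (rule complex_Re_le_cmod)
  then have "fst z + inverse (fst z) \<le> N z" by (simp add: Zc_def)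
  moreover have "inverse (fst z) > 0" using a by simp
  ultimately show "fst z \<le> N z" "inverse (fst z) \<le> N z" using a by linarith+
  have "\<bar>Im (Zc z)\<bar> \<le> N z" unfolding N_def by (rule abs_Im_le_cmod)
  then show "\<bar>snd z\<bar> \<le> N z" by (simp add: Zc_def)
qed

text \<open>
  Both differences are linear in \<open>a\<close>, \<open>1/a\<close> and \<open>b\<close>, with coefficients of size \<open>d\<close>, and each of the three
  quantities is at most \<open>N z\<close>.
\<close>

lemma Zc_translate_bounds:
  assumes z: "z \<in> carrier G" and d: "0 < d" "d \<le> 1 / 2" and u: "\<bar>fst u - 1\<bar> \<le> d" "\<bar>snd u\<bar> \<le> d"
  shows "cmod (Zc (z \<cdot> u) - Zc z) \<le> 6 * d * N z" "cmod (Zc (u \<cdot> z) - Zc z) \<le> 6 * d * N z"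
proof -
  obtain a b where z_eq: "z = (a, b)" by (cases z)
  obtain c e where u_eq: "u = (c, e)" by (cases u)
  have a: "a > 0" using z by (simp add: carrier_G z_eq)
  have c: "\<bar>c - 1\<bar> \<le> d" and e: "\<bar>e\<bar> \<le> d" using u by (simp_all add: u_eq)
  have c_half: "c \<ge> 1 / 2" using c d by linarith
  have c': "\<bar>inverse c - 1\<bar> \<le> 2 * d"
  proof -
    have "inverse c - 1 = (1 - c) * inverse c" using c_half by (simp add: left_diff_distrib)
    then have "\<bar>inverse c - 1\<bar> = \<bar>1 - c\<bar> * inverse c" using c_half by (simp only: abs_mult) simp
    also have "\<dots> \<le> d * 2"
    proof (rule mult_mono)
      show "\<bar>1 - c\<bar> \<le> d" using c by linarith
      have "inverse c \<le> inverse (1 / 2)" using c_half by (rule le_imp_inverse_le) simp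
      then show "inverse c \<le> 2" by simp
    qed (use c_half d in simp_all)
    finally show ?thesis by simp
  qed
  have N: "a \<le> N z" "inverse a \<le> N z" "\<bar>b\<bar> \<le> N z"
    using coordinates_le_N[OF z] by (simp_all add: z_eq)
  have Nz: "N z \<ge> 0" by (simp add: N_def)
  have prod: "\<bar>x * y\<bar> \<le> k * d * N z" if "\<bar>x\<bar> \<le> k * d" "\<bar>y\<bar> \<le> N z" for x y k
    unfolding abs_mult by (rule mult_mono) (use that in auto)
  have prod1: "\<bar>x * y\<bar> \<le> d * N z" if "\<bar>x\<bar> \<le> d" "\<bar>y\<bar> \<le> N z" for x y
    using prod[of x 1 y] that by simp
  have a_abs: "\<bar>a\<bar> \<le> N z" "\<bar>inverse a\<bar> \<le> N z" using N a by simp_all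
  have tri: "cmod (Complex (p1 + p2) (p3 + p4)) \<le> \<bar>p1\<bar> + \<bar>p2\<bar> + \<bar>p3\<bar> + \<bar>p4\<bar>" for p1 p2 p3 p4
    using cmod_le[of "Complex (p1 + p2) (p3 + p4)"] abs_triangle_ineq[of p1 p2] abs_triangle_ineq[of p3 p4]
    by (simp only: complex.sel)
  have "Zc (z \<cdot> u) - Zc z = Complex ((c - 1) * a + (inverse c - 1) * inverse a) (- e * a + - ((inverse c - 1) * b))"
    by (simp add: gmult_eq z_eq u_eq Zc_def complex_eq_iff algebra_simps)
  also have "cmod \<dots> \<le> d * N z + 2 * d * N z + d * N z + 2 * d * N z"
    by (rule order_trans[OF tri], intro add_mono) (use prod prod1 a_abs N c c' e in \<open>simp_all only: abs_minus_cancel mult_1 mult_minus_left\<close>)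
  also have "\<dots> = 6 * d * N z" by simp
  finally show "cmod (Zc (z \<cdot> u) - Zc z) \<le> 6 * d * N z" .
  have "Zc (u \<cdot> z) - Zc z = Complex ((c - 1) * a + (inverse c - 1) * inverse a) (- ((c - 1) * b) + - e * inverse a)"
    by (simp add: gmult_eq z_eq u_eq Zc_def complex_eq_iff algebra_simps)
  also have "cmod \<dots> \<le> d * N z + 2 * d * N z + d * N z + d * N z"
    by (rule order_trans[OF tri], intro add_mono) (use prod prod1 a_abs N c c' e in \<open>simp_all only: abs_minus_cancel mult_1 mult_minus_left\<close>)
  also have "\<dots> = 5 * (d * N z)" by simp
  also have "\<dots> \<le> 6 * (d * N z)" using d(1) Nz by (intro mult_right_mono) simp_all
  finally show "cmod (Zc (u \<cdot> z) - Zc z) \<le> 6 * d * N z" by simp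
qed

text \<open>
  The relative oscillation of the kernel is small uniformly over the whole group, and under translations from
  either side. This is what allows sampling at the nodes to be compared with integration.
\<close>

lemma W_oscillation:
  assumes \<epsilon>: "\<epsilon> > 0"
  obtains U where "compact_nhd_one U"
    "\<And>u z. u \<in> U \<Longrightarrow> z \<in> carrier G \<Longrightarrow> cmod (W s (z \<cdot> u) - W s z) \<le> \<epsilon> * cmod (W s z)"
    "\<And>u z. u \<in> U \<Longrightarrow> z \<in> carrier G \<Longrightarrow> cmod (W s (u \<cdot> z) - W s z) \<le> \<epsilon> * cmod (W s z)"
proof -
  define t where "t = complex_of_real (- s)"
  obtain \<delta> where \<delta>: "\<delta> > 0"
    "\<And>Z Z'. Re Z > 0 \<Longrightarrow> cmod (Z' - Z) \<le> \<delta> * cmod Z \<Longrightarrow> cmod (Z' powr t - Z powr t) \<le> \<epsilon> * cmod (Z powr t)"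
    using powr_relative_continuity[OF \<epsilon>] by metis
  define d where "d = min (\<delta> / 6) (1 / 2)"
  have d: "0 < d" "d \<le> 1 / 2" "6 * d \<le> \<delta>" using \<delta>(1) by (auto simp: d_def)
  define U where "U = cbox (1 - d, - d) (1 + d, d)"
  have inU: "\<bar>fst u - 1\<bar> \<le> d" "\<bar>snd u\<bar> \<le> d" if "u \<in> U" for u
    using that by (cases u; auto simp: U_def cbox_Pair_eq abs_le_iff)+
  have osc: "cmod (W s z' - W s z) \<le> \<epsilon> * cmod (W s z)" if z: "z \<in> carrier G" and le: "cmod (Zc z' - Zc z) \<le> 6 * d * N z" for z z'
  proof -
    have "6 * d * N z \<le> \<delta> * N z" using d(3) by (intro mult_right_mono) (auto simp: N_def)
    then have "cmod (Zc z' powr t - Zc z powr t) \<le> \<epsilon> * cmod (Zc z powr t)"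
      using le by (intro \<delta>(2) Re_Zc_pos z) (simp add: N_def)
    then have "cmod (2 powr complex_of_real s) * cmod (Zc z' powr t - Zc z powr t) \<le> cmod (2 powr complex_of_real s) * (\<epsilon> * cmod (Zc z powr t))"
      by (rule mult_left_mono) simp
    then show ?thesis unfolding W_eq_Zc t_def[symmetric] right_diff_distrib[symmetric] norm_mult
      by (simp only: mult.left_commute)
  qed
  show ?thesis
  proof (rule that[of U])
    have "U \<subseteq> carrier G"
    proof
      fix u assume "u \<in> U"
      then have "fst u > 0" using inU[of u] d by linarith
      then show "u \<in> carrier G" by (simp add: carrier_G)
    qed
    moreover have "(1, 0) \<in> interior U"
      using d by (auto simp: U_def interior_cbox box_def Basis_prod_def)
    ultimately show "compact_nhd_one U"
      by (simp add: compact_nhd_one_def U_def G_def)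
    fix u z assume u: "u \<in> U" and z: "z \<in> carrier G"
    show "cmod (W s (z \<cdot> u) - W s z) \<le> \<epsilon> * cmod (W s z)"
      by (intro osc z Zc_translate_bounds d inU u)
    show "cmod (W s (u \<cdot> z) - W s z) \<le> \<epsilon> * cmod (W s z)"
      by (intro osc z Zc_translate_bounds d inU u)
  qed
qed

lemma sigma_finite_haar: "sigma_finite_measure haar"
proof -
  interpret R: sigma_finite_measure "restrict_space lborel (carrier G)"
    by (rule sigma_finite_measure_restrict_space[OF lborel.sigma_finite_measure_axioms]) simp
  have "(\<lambda>x::real \<times> real. 1 / (fst x)\<^sup>2) \<in> borel_measurable borel"
    unfolding borel_prod[symmetric] by measurable
  then have "(\<lambda>(a, b). ennreal (1 / a\<^sup>2)) \<in> borel_measurable (restrict_space lborel (carrier G))"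
    unfolding case_prod_beta' by (intro measurable_restrict_space1) simp
  then show ?thesis unfolding haar_def
    by (intro R.sigma_finite_iff_density_finite[THEN iffD2]) auto
qed

interpretation haar: sigma_finite_measure haar by (rule sigma_finite_haar)
interpretation haar2: pair_sigma_finite haar haar ..

text \<open>
  The elementary core of Hoelder's inequality: the sum on the right-hand side of the hypothesis is balanced at
  \<open>l = (e / h) powr (1 / p)\<close>.
\<close>

lemma powr_optimize:
  fixes K A h e p :: real
  assumes K: "K \<ge> 0" and A: "A \<ge> 0" and h: "h > 0" and e: "e \<ge> 0" and p: "p \<ge> 1"
    and le: "\<And>l. l > 0 \<Longrightarrow> K \<le> l * (A * h) + l powr (1 - p) * e"
  shows "K powr p \<le> (A + 1) powr p * h powr (p - 1) * e"
proof (cases "e = 0")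
  case True
  have "K \<le> 0 + \<eta>" if "\<eta> > 0" for \<eta>
  proof -
    define l where "l = \<eta> / (A * h + 1)"
    have Ah: "A * h + 1 > 0" using A h by (simp add: add_nonneg_pos)
    have l: "l > 0" using that Ah by (simp add: l_def)
    have "K \<le> l * (A * h)" using le[OF l] True by simp
    also have "\<dots> \<le> l * (A * h + 1)" using l by (intro mult_left_mono) simp_all
    also have "\<dots> = \<eta>" using Ah by (simp add: l_def)
    finally show ?thesis by simp
  qed
  then have "K \<le> 0" by (rule field_le_epsilon)
  then have "K = 0" using K by simp
  then show ?thesis using True by simp
next
  case False
  then have e: "e > 0" using e by simp
  define l where "l = (e / h) powr (1 / p)"
  have l: "l > 0" using e h by (simp add: l_def)
  have lp: "l powr p = e / h" using e h p by (simp add: l_def powr_powr)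
  have "l powr (1 - p) * e = l / l powr p * e" using l by (simp add: powr_diff)
  also have "\<dots> = l * h" unfolding lp using e h by simp
  finally have "K \<le> l * (A * h) + l * h" using le[OF l] by simp
  also have "\<dots> = (A + 1) * (l * h)" by (simp add: distrib_right)
  finally have "K powr p \<le> ((A + 1) * (l * h)) powr p" using K p by (intro powr_mono2) auto
  also have "\<dots> = (A + 1) powr p * (e / h * h powr p)"
    using A l h by (simp only: powr_mult lp)
  also have "e / h * h powr p = h powr (p - 1) * e" using h by (simp add: powr_diff)
  finally show ?thesis by (simp only: mult.assoc)
qed

section \<open>Schur's test\<close>

abbreviation kern :: "real \<Rightarrow> real \<times> real \<Rightarrow> real \<times> real \<Rightarrow> real" where
  "kern s x y \<equiv> cmod (W s (ginv x \<cdot> y))"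

lemma kern_eq: "kern s x y = 2 powr s * N (ginv x \<cdot> y) powr (- s)"
  by (rule cmod_W)

lemma kern_commute: "x \<in> carrier G \<Longrightarrow> y \<in> carrier G \<Longrightarrow> kern s x y = kern s y x"
  by (simp add: kern_eq N_gquot_commute)

lemma measurable_W_gquot:
  assumes "f \<in> measurable M haar" "g \<in> measurable M haar"
  shows "(\<lambda>x. W s (ginv (f x) \<cdot> g x)) \<in> borel_measurable M"
  by (rule measurable_compose[OF measurable_gmult[OF measurable_ginv[OF assms(1)] assms(2)] measurable_W])

lemma measurable_kern [measurable (raw)]:
  assumes "f \<in> measurable M haar" "g \<in> measurable M haar"
  shows "(\<lambda>x. kern s (f x) (g x)) \<in> borel_measurable M"
  using measurable_W_gquot[OF assms] by simp

lemma measurable_const_haar: "y \<in> carrier G \<Longrightarrow> (\<lambda>_. y) \<in> measurable M haar"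
  by (intro measurable_const) simp

text \<open>
  Convolution of \<open>F\<close> with the modulus of the kernel, with values in the extended reals, so that finiteness is a
  statement to be proved.
\<close>

definition KF :: "real \<Rightarrow> (real \<times> real \<Rightarrow> real) \<Rightarrow> real \<times> real \<Rightarrow> ennreal" where
  "KF s F y = (\<integral>\<^sup>+x. ennreal (F x) * ennreal (kern s x y) \<partial>haar)"

lemma measurable_KF [measurable]:
  assumes [measurable]: "F \<in> borel_measurable haar"
  shows "KF s F \<in> borel_measurable haar"
  unfolding KF_def by measurable

text \<open>
  A Harnack inequality: moving the second argument inside the small neighbourhood changes the kernel by at most a
  factor of two.
\<close>

lemma kern_harnack:
  assumes osc: "\<And>u z. u \<in> U \<Longrightarrow> z \<in> carrier G \<Longrightarrow> cmod (W s (z \<cdot> u) - W s z) \<le> 1 / 2 * cmod (W s z)"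
    and x: "x \<in> carrier G" and y: "y \<in> carrier G" and v: "v \<in> carrier G" "ginv y \<cdot> v \<in> U"
  shows "kern s x y \<le> 2 * kern s x v"
proof -
  interpret group G by (rule group_G)
  have "ginv x \<cdot> y \<cdot> (ginv y \<cdot> v) = ginv x \<cdot> v"
    using x y v by (metis G_closed(1) G_closed(2) inv_closed m_assoc r_inv r_one l_one)
  then have "cmod (W s (ginv x \<cdot> v) - W s (ginv x \<cdot> y)) \<le> 1 / 2 * kern s x y"
    using osc[OF v(2), of "ginv x \<cdot> y"] x y by simp
  then show ?thesis
    using norm_triangle_ineq2[of "W s (ginv x \<cdot> y)" "W s (ginv x \<cdot> v)"]
    by (simp add: norm_minus_commute)
qed

lemma KF_harnack:
  assumes U: "compact_nhd_one U"
    and osc: "\<And>u z. u \<in> U \<Longrightarrow> z \<in> carrier G \<Longrightarrow> cmod (W s (z \<cdot> u) - W s z) \<le> 1 / 2 * cmod (W s z)"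
    and F: "F \<in> borel_measurable haar"
    and y: "y \<in> carrier G" and v: "v \<in> carrier G" "ginv y \<cdot> v \<in> U"
  shows "KF s F y \<le> 2 * KF s F v"
proof -
  note [measurable] = F measurable_const_haar[OF v(1)]
  have "KF s F y \<le> (\<integral>\<^sup>+x. 2 * (ennreal (F x) * ennreal (kern s x v)) \<partial>haar)"
    unfolding KF_def
  proof (rule nn_integral_mono)
    fix x assume "x \<in> space haar"
    then have "ennreal (kern s x y) \<le> ennreal (2 * kern s x v)"
      using kern_harnack[OF osc _ y v] by (intro ennreal_leI) simp
    also have "\<dots> = 2 * ennreal (kern s x v)" by (simp add: ennreal_mult)
    finally have "ennreal (F x) * ennreal (kern s x y) \<le> ennreal (F x) * (2 * ennreal (kern s x v))"
      by (rule mult_left_mono) simp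
    then show "ennreal (F x) * ennreal (kern s x y) \<le> 2 * (ennreal (F x) * ennreal (kern s x v))"
      by (simp only: mult.left_commute)
  qed
  also have "\<dots> = 2 * KF s F v" unfolding KF_def by (rule nn_integral_cmult) measurable
  finally show ?thesis .
qed

text \<open>
  By the Harnack inequality an infinite value at \<open>y\<close> would spread to the translate \<open>y U\<close>, which has positive
  measure.
\<close>

lemma KF_finite:
  assumes F: "F \<in> borel_measurable haar" and ae: "AE v in haar. KF s F v < \<infinity>" and y: "y \<in> carrier G"
  shows "KF s F y < \<infinity>"
proof -
  obtain U where U: "compact_nhd_one U"
    and osc: "\<And>u z. u \<in> U \<Longrightarrow> z \<in> carrier G \<Longrightarrow> cmod (W s (z \<cdot> u) - W s z) \<le> 1 / 2 * cmod (W s z)"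
    by (rule W_oscillation[of "1 / 2" s]) auto
  have "\<exists>v. v \<in> carrier G \<and> ginv y \<cdot> v \<in> U \<and> KF s F v < \<infinity>"
  proof (rule ccontr)
    assume none: "\<not> ?thesis"
    obtain Z where Z: "{v \<in> space haar. \<not> KF s F v < \<infinity>} \<subseteq> Z" "emeasure haar Z = 0" "Z \<in> sets haar"
      by (rule AE_E[OF ae])
    have "emeasure haar {v \<in> carrier G. ginv y \<cdot> v \<in> U} \<le> emeasure haar Z"
      using none Z(1) by (intro emeasure_mono Z(3)) auto
    then show False using haar_ball_pos[OF U y] Z(2) by simp
  qed
  then obtain v where v: "v \<in> carrier G" "ginv y \<cdot> v \<in> U" "KF s F v < \<infinity>" by blast
  have "KF s F y \<le> 2 * KF s F v" by (rule KF_harnack[OF U osc F y v(1,2)])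
  also have "\<dots> < \<infinity>" using v(3) by (simp add: ennreal_mult_less_top)
  finally show ?thesis .
qed

text \<open>
  Schur's test with the test function \<open>h = N powr (- c)\<close>. For a positive kernel \<open>K\<close> with \<open>K h \<le> A h\<close>, Hoelder's
  inequality yields \<open>(K F)\<^sup>p \<le> const h\<^sup>p\<^sup>-\<^sup>1 K (F\<^sup>p h\<^sup>1\<^sup>-\<^sup>p)\<close> pointwise, and the integral of the right-hand side against
  the \<open>p\<close>-th power of the weight is controlled if the kernel also preserves \<open>h\<^sup>p\<^sup>-\<^sup>1\<close> times that power.
\<close>

lemma KF_Schur:
  fixes s r p :: real
  assumes s: "s > 1" and p: "1 \<le> p" and rp: "2 - s < r + 2 / p" "r + 2 / p < s"
  obtains M where "M \<ge> 0"
    "\<And>F. F \<in> borel_measurable haar \<Longrightarrow> (\<And>x. F x \<ge> 0) \<Longrightarrow>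
      (\<integral>\<^sup>+x. ennreal (F x powr p * N x powr (r * p)) \<partial>haar) < \<infinity> \<Longrightarrow>
      (\<forall>y\<in>carrier G. KF s F y < \<infinity>) \<and>
      (\<integral>\<^sup>+y. ennreal (enn2real (KF s F y) powr p * N y powr (r * p)) \<partial>haar) \<le>
        ennreal M * (\<integral>\<^sup>+x. ennreal (F x powr p * N x powr (r * p)) \<partial>haar)"
proof -
  \<comment> \<open>The two exponents of the test are then \<open>c\<close> and \<open>2 - c\<close>, and both lie between \<open>2 - s\<close> and \<open>s\<close> by the hypotheses.\<close>
  define c where "c = r + 2 / p"
  have cp: "c * p = r * p + 2" using p by (simp add: c_def distrib_right)
  have c1: "2 - s < c" "c < s" and c2: "2 - s < 2 - c" "2 - c < s" using rp by (simp_all add: c_def)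
  obtain A0 where A0: "A0 \<ge> 0" "\<And>y. y \<in> carrier G \<Longrightarrow>
      (\<integral>\<^sup>+x. ennreal (N x powr (- c) * N (ginv x \<cdot> y) powr (- s)) \<partial>haar) \<le> ennreal (A0 * N y powr (- c))"
    by (rule kernel_preserves_N_power[OF s c1]) blast
  obtain B0 where B0: "B0 \<ge> 0" "\<And>y. y \<in> carrier G \<Longrightarrow>
      (\<integral>\<^sup>+x. ennreal (N x powr (- (2 - c)) * N (ginv x \<cdot> y) powr (- s)) \<partial>haar) \<le> ennreal (B0 * N y powr (- (2 - c)))"
    by (rule kernel_preserves_N_power[OF s c2]) blast
  have scale: "KF s (\<lambda>x. N x powr e) y \<le> ennreal (2 powr s * D * N y powr e)"
    if y: "y \<in> carrier G" and D: "D \<ge> 0"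
      and le: "(\<integral>\<^sup>+x. ennreal (N x powr e * N (ginv x \<cdot> y) powr (- s)) \<partial>haar) \<le> ennreal (D * N y powr e)" for e D y
  proof -
    note [measurable] = measurable_N_gquot[OF y]
    have "KF s (\<lambda>x. N x powr e) y = (\<integral>\<^sup>+x. ennreal (2 powr s) * ennreal (N x powr e * N (ginv x \<cdot> y) powr (- s)) \<partial>haar)"
      unfolding KF_def kern_eq by (intro nn_integral_cong) (simp add: ennreal_mult mult_ac)
    also have "\<dots> = ennreal (2 powr s) * (\<integral>\<^sup>+x. ennreal (N x powr e * N (ginv x \<cdot> y) powr (- s)) \<partial>haar)"
      by (rule nn_integral_cmult) measurable
    also have "\<dots> \<le> ennreal (2 powr s) * ennreal (D * N y powr e)" using le by (rule mult_left_mono) simp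
    also have "\<dots> = ennreal (2 powr s * D * N y powr e)" using D by (simp add: ennreal_mult mult.assoc)
    finally show ?thesis .
  qed
  define A B where "A = 2 powr s * A0" and "B = 2 powr s * B0"
  have AB: "A \<ge> 0" "B \<ge> 0" using A0(1) B0(1) by (simp_all add: A_def B_def)
  have KA: "KF s (\<lambda>x. N x powr (- c)) y \<le> ennreal (A * N y powr (- c))" if "y \<in> carrier G" for y
    unfolding A_def by (rule scale[OF that A0(1) A0(2)[OF that]])
  have KB: "KF s (\<lambda>x. N x powr (c - 2)) y \<le> ennreal (B * N y powr (c - 2))" if "y \<in> carrier G" for y
    using scale[OF that B0(1) B0(2)[OF that]] unfolding B_def by simp
  show ?thesis
  proof (rule that[of "(A + 1) powr p * B"])
    show "(A + 1) powr p * B \<ge> 0" using AB by simp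
    fix F :: "real \<times> real \<Rightarrow> real"
    let ?J = "\<integral>\<^sup>+x. ennreal (F x powr p * N x powr (r * p)) \<partial>haar"
    assume F[measurable]: "F \<in> borel_measurable haar" and F0: "\<And>x. F x \<ge> 0"
      and fin: "?J < \<infinity>"
    \<comment> \<open>This is \<open>F\<^sup>p h\<^sup>1\<^sup>-\<^sup>p\<close> for the test function \<open>h = N powr (- c)\<close>.\<close>
    define E where "E x = F x powr p * N x powr (c * (p - 1))" for x
    have E[measurable]: "E \<in> borel_measurable haar" unfolding E_def by measurable
    have E0: "E x \<ge> 0" for x by (simp add: E_def)
    have mKE[measurable]: "KF s E \<in> borel_measurable haar" and mKF[measurable]: "KF s F \<in> borel_measurable haar"
      by measurable
    have exp1: "E x * N x powr (c - 2) = F x powr p * N x powr (r * p)" for x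
    proof -
      have "c * (p - 1) + (c - 2) = r * p" using cp by (simp add: right_diff_distrib)
      then show ?thesis unfolding E_def mult.assoc powr_add[symmetric] by simp
    qed
    have weak: "(\<integral>\<^sup>+y. KF s E y * ennreal (N y powr (c - 2)) \<partial>haar) \<le>
        ennreal B * ?J"
    proof -
      have "(\<integral>\<^sup>+y. KF s E y * ennreal (N y powr (c - 2)) \<partial>haar) =
          (\<integral>\<^sup>+y. \<integral>\<^sup>+x. ennreal (E x) * ennreal (kern s x y) * ennreal (N y powr (c - 2)) \<partial>haar \<partial>haar)"
      proof (rule nn_integral_cong)
        fix y assume "y \<in> space haar"
        then have [measurable]: "(\<lambda>_. y) \<in> measurable haar haar" by (intro measurable_const_haar) simp
        show "KF s E y * ennreal (N y powr (c - 2)) = (\<integral>\<^sup>+x. ennreal (E x) * ennreal (kern s x y) * ennreal (N y powr (c - 2)) \<partial>haar)"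
          unfolding KF_def by (rule nn_integral_multc[symmetric]) measurable
      qed
      also have "\<dots> = (\<integral>\<^sup>+x. \<integral>\<^sup>+y. ennreal (E x) * ennreal (kern s x y) * ennreal (N y powr (c - 2)) \<partial>haar \<partial>haar)"
        by (rule haar2.Fubini'[of "\<lambda>x y. ennreal (E x) * ennreal (kern s x y) * ennreal (N y powr (c - 2))"]) measurable
      also have "\<dots> = (\<integral>\<^sup>+x. ennreal (E x) * KF s (\<lambda>y. N y powr (c - 2)) x \<partial>haar)"
      proof (rule nn_integral_cong)
        fix x assume "x \<in> space haar"
        then have x: "x \<in> carrier G" by simp
        then have [measurable]: "(\<lambda>_. x) \<in> measurable haar haar" by (intro measurable_const_haar) simp
        have "(\<integral>\<^sup>+y. ennreal (E x) * ennreal (kern s x y) * ennreal (N y powr (c - 2)) \<partial>haar) =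
          (\<integral>\<^sup>+y. ennreal (E x) * (ennreal (N y powr (c - 2)) * ennreal (kern s y x)) \<partial>haar)"
          using kern_commute[OF x] by (intro nn_integral_cong) (simp add: mult_ac)
        also have "\<dots> = ennreal (E x) * KF s (\<lambda>y. N y powr (c - 2)) x"
          unfolding KF_def by (rule nn_integral_cmult) measurable
        finally show "(\<integral>\<^sup>+y. ennreal (E x) * ennreal (kern s x y) * ennreal (N y powr (c - 2)) \<partial>haar) =
          ennreal (E x) * KF s (\<lambda>y. N y powr (c - 2)) x" .
      qed
      also have "\<dots> \<le> (\<integral>\<^sup>+x. ennreal (E x) * ennreal (B * N x powr (c - 2)) \<partial>haar)"
        by (intro nn_integral_mono mult_left_mono KB) auto
      also have "\<dots> = (\<integral>\<^sup>+x. ennreal B * ennreal (F x powr p * N x powr (r * p)) \<partial>haar)"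
        unfolding exp1[symmetric] using AB E0 by (intro nn_integral_cong) (simp add: ennreal_mult[symmetric] mult_ac)
      also have "\<dots> = ennreal B * ?J"
        by (rule nn_integral_cmult) measurable
      finally show ?thesis .
    qed
    have KE_fin: "KF s E y < \<infinity>" if "y \<in> carrier G" for y
    proof (rule KF_finite[OF E _ that])
      have "ennreal B * ?J < \<infinity>"
        using fin by (simp add: ennreal_mult_less_top)
      then have "(\<integral>\<^sup>+y. KF s E y * ennreal (N y powr (c - 2)) \<partial>haar) \<noteq> \<infinity>"
        using le_less_trans[OF weak] by (metis less_irrefl)
      then have "AE y in haar. KF s E y * ennreal (N y powr (c - 2)) \<noteq> \<infinity>"
        by (intro nn_integral_PInf_AE) measurable
      then show "AE v in haar. KF s E v < \<infinity>"
      proof (rule AE_mp, intro AE_I2 impI)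
        fix v assume "v \<in> space haar" and ne: "KF s E v * ennreal (N v powr (c - 2)) \<noteq> \<infinity>"
        then have "N v powr (c - 2) > 0" using N_pos[of v] by simp
        then show "KF s E v < \<infinity>" using ne by (auto simp: ennreal_mult_eq_top_iff less_top[symmetric])
      qed
    qed
    have KF_le: "KF s F y \<le> ennreal (l * (A * N y powr (- c)) + l powr (1 - p) * enn2real (KF s E y))"
      if y: "y \<in> carrier G" and l: "l > 0" for y l
    proof -
      note [measurable] = measurable_const_haar[OF y, of haar]
      have ptw: "F x \<le> l * N x powr (- c) + l powr (1 - p) * E x" if x: "x \<in> carrier G" for x
      proof (cases "F x \<le> l * N x powr (- c)")
        case True then show ?thesis using E0[of x] by (simp add: add_increasing2)
      next
        case False
        define h where "h = N x powr (- c)"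
        have h: "h > 0" using N_pos[OF x] by (simp add: h_def)
        have lh: "l * h > 0" using l h by simp
        have Fh: "F x > l * h" using False by (simp add: h_def)
        define q where "q = F x / (l * h)"
        have q: "q \<ge> 1" using Fh lh by (simp add: q_def)
        have Fq: "F x = q * (l * h)" using l h by (simp add: q_def)
        have "q powr 1 \<le> q powr p" using q p by (intro powr_mono)
        then have "F x \<le> q powr p * (l * h)" unfolding Fq using q lh by (simp add: mult_right_mono)
        also have "q powr p * (l * h) = l powr (1 - p) * (F x powr p * h powr (1 - p))"
        proof -
          have "F x powr p = q powr p * (l powr p * h powr p)" unfolding Fq by (simp only: powr_mult)
          moreover have "l powr (1 - p) * l powr p = l" "h powr (1 - p) * h powr p = h"
            using l h by (simp_all flip: powr_add)
          moreover have "l powr (1 - p) * (q powr p * (l powr p * h powr p) * h powr (1 - p)) =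
              q powr p * ((l powr (1 - p) * l powr p) * (h powr (1 - p) * h powr p))" by (simp only: mult_ac)
          ultimately show ?thesis by (simp only:)
        qed
        also have "F x powr p * h powr (1 - p) = E x"
          unfolding E_def h_def powr_powr by (simp add: right_diff_distrib)
        finally show ?thesis using l h by (simp add: h_def add_increasing)
      qed
      have "KF s F y \<le> (\<integral>\<^sup>+x. ennreal l * (ennreal (N x powr (- c)) * ennreal (kern s x y)) +
          ennreal (l powr (1 - p)) * (ennreal (E x) * ennreal (kern s x y)) \<partial>haar)"
        unfolding KF_def
      proof (rule nn_integral_mono)
        fix x assume "x \<in> space haar"
        then have "ennreal (F x) \<le> ennreal (l * N x powr (- c) + l powr (1 - p) * E x)"
          by (intro ennreal_leI ptw) simp
        also have "\<dots> = ennreal l * ennreal (N x powr (- c)) + ennreal (l powr (1 - p)) * ennreal (E x)"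
          using l E0[of x] by (simp add: ennreal_mult)
        finally have "ennreal (F x) * ennreal (kern s x y) \<le> (ennreal l * ennreal (N x powr (- c)) + ennreal (l powr (1 - p)) * ennreal (E x)) * ennreal (kern s x y)"
          by (rule mult_right_mono) simp
        then show "ennreal (F x) * ennreal (kern s x y) \<le> ennreal l * (ennreal (N x powr (- c)) * ennreal (kern s x y)) +
          ennreal (l powr (1 - p)) * (ennreal (E x) * ennreal (kern s x y))"
          by (simp only: distrib_right mult.assoc)
      qed
      also have "\<dots> = (\<integral>\<^sup>+x. ennreal l * (ennreal (N x powr (- c)) * ennreal (kern s x y)) \<partial>haar) +
          (\<integral>\<^sup>+x. ennreal (l powr (1 - p)) * (ennreal (E x) * ennreal (kern s x y)) \<partial>haar)"
        by (rule nn_integral_add) measurable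
      also have "\<dots> = ennreal l * KF s (\<lambda>x. N x powr (- c)) y + ennreal (l powr (1 - p)) * KF s E y"
        unfolding KF_def by (intro arg_cong2[where f="(+)"] nn_integral_cmult) measurable
      also have "\<dots> \<le> ennreal l * ennreal (A * N y powr (- c)) + ennreal (l powr (1 - p)) * KF s E y"
        by (intro add_mono mult_left_mono KA y) auto
      also have "KF s E y = ennreal (enn2real (KF s E y))" using KE_fin[OF y] by simp
      also have "ennreal l * ennreal (A * N y powr (- c)) + ennreal (l powr (1 - p)) * ennreal (enn2real (KF s E y)) =
         ennreal (l * (A * N y powr (- c)) + l powr (1 - p) * enn2real (KF s E y))"
      proof -
        have "A * N y powr (- c) \<ge> 0" using AB by simp
        then show ?thesis using l by (simp add: ennreal_mult[symmetric] ennreal_plus[symmetric] del: ennreal_plus)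
      qed
      finally show ?thesis .
    qed
    have KF_fin: "KF s F y < \<infinity>" if "y \<in> carrier G" for y
      using KF_le[OF that, of 1] by (simp add: le_less_trans[OF _ ennreal_less_top])
    have pt: "enn2real (KF s F y) powr p \<le> (A + 1) powr p * N y powr (- c * (p - 1)) * enn2real (KF s E y)"
      if y: "y \<in> carrier G" for y
    proof -
      have "enn2real (KF s F y) powr p \<le> (A + 1) powr p * (N y powr (- c)) powr (p - 1) * enn2real (KF s E y)"
      proof (rule powr_optimize[OF enn2real_nonneg AB(1) _ enn2real_nonneg p])
        show "N y powr (- c) > 0" using N_pos[OF y] by simp
        fix l :: real assume l: "l > 0"
        show "enn2real (KF s F y) \<le> l * (A * N y powr (- c)) + l powr (1 - p) * enn2real (KF s E y)"
          by (rule enn2real_leI[OF _ KF_le[OF y l]]) (use l AB in simp)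
      qed
      then show ?thesis unfolding powr_powr .
    qed
    have "(\<integral>\<^sup>+y. ennreal (enn2real (KF s F y) powr p * N y powr (r * p)) \<partial>haar) \<le>
      (\<integral>\<^sup>+y. ennreal ((A + 1) powr p) * (KF s E y * ennreal (N y powr (c - 2))) \<partial>haar)"
    proof (rule nn_integral_mono)
      fix y assume "y \<in> space haar"
      then have y: "y \<in> carrier G" by simp
      have "enn2real (KF s F y) powr p * N y powr (r * p) \<le>
          (A + 1) powr p * N y powr (- c * (p - 1)) * enn2real (KF s E y) * N y powr (r * p)"
        by (rule mult_right_mono[OF pt[OF y]]) simp
      also have "\<dots> = (A + 1) powr p * (enn2real (KF s E y) * (N y powr (- c * (p - 1)) * N y powr (r * p)))"
        by (simp only: mult_ac)
      also have "N y powr (- c * (p - 1)) * N y powr (r * p) = N y powr (c - 2)"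
      proof -
        have "- c * (p - 1) + r * p = c - 2" using cp by (simp add: right_diff_distrib)
        then show ?thesis unfolding powr_add[symmetric] by simp
      qed
      finally have "ennreal (enn2real (KF s F y) powr p * N y powr (r * p)) \<le>
          ennreal ((A + 1) powr p * (enn2real (KF s E y) * N y powr (c - 2)))" by (rule ennreal_leI)
      also have "\<dots> = ennreal ((A + 1) powr p) * (ennreal (enn2real (KF s E y)) * ennreal (N y powr (c - 2)))"
        by (simp add: ennreal_mult)
      also have "ennreal (enn2real (KF s E y)) = KF s E y" using KE_fin[OF y] by simp
      finally show "ennreal (enn2real (KF s F y) powr p * N y powr (r * p)) \<le>
        ennreal ((A + 1) powr p) * (KF s E y * ennreal (N y powr (c - 2)))" .
    qed
    also have "\<dots> = ennreal ((A + 1) powr p) * (\<integral>\<^sup>+y. KF s E y * ennreal (N y powr (c - 2)) \<partial>haar)"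
      by (rule nn_integral_cmult) measurable
    also have "\<dots> \<le> ennreal ((A + 1) powr p) * (ennreal B * ?J)"
      by (rule mult_left_mono[OF weak]) simp
    also have "\<dots> = ennreal ((A + 1) powr p * B) * ?J"
      using AB by (simp add: ennreal_mult mult.assoc)
    finally show "(\<forall>y\<in>carrier G. KF s F y < \<infinity>) \<and>
      (\<integral>\<^sup>+y. ennreal (enn2real (KF s F y) powr p * N y powr (r * p)) \<partial>haar) \<le>
        ennreal ((A + 1) powr p * B) * ?J"
      using KF_fin by blast
  qed
qed

section \<open>Weighted Lebesgue spaces\<close>

lemma weight_ge_1: "r \<ge> 0 \<Longrightarrow> x \<in> carrier G \<Longrightarrow> weight r x \<ge> 1"
proof -
  assume r: "r \<ge> 0" and x: "x \<in> carrier G"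
  have "1 * 1 \<le> 2 powr r * N x powr r"
    using r N_ge_2[OF x] by (intro mult_mono ge_one_powr_ge_zero) auto
  then show ?thesis by (simp add: weight_eq_N)
qed

lemma weight_nonneg: "weight r x \<ge> 0"
  by (simp add: weight_eq_N)

lemma measurable_weight [measurable]: "weight r \<in> borel_measurable haar"
  unfolding weight_eq_N[abs_def] by measurable

text \<open>
  The \<open>p\<close>-th power of the norm as an extended real number; it is meaningful for every measurable function.
\<close>

definition Phi :: "real \<Rightarrow> real \<Rightarrow> (real \<times> real \<Rightarrow> complex) \<Rightarrow> ennreal" where
  "Phi p r f = (\<integral>\<^sup>+x. ennreal (cmod (f x * weight r x) powr p) \<partial>haar)"

lemma measurable_Lp_integrand:
  fixes f :: "real \<times> real \<Rightarrow> complex"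
  assumes [measurable]: "f \<in> borel_measurable haar"
  shows "(\<lambda>x. cmod (f x * weight r x) powr p) \<in> borel_measurable haar"
  by measurable

lemma Lp_space_iff: "f \<in> Lp_space p r \<longleftrightarrow> f \<in> borel_measurable haar \<and> Phi p r f < \<infinity>"
proof (cases "f \<in> borel_measurable haar")
  case True
  have "integrable haar (\<lambda>x. cmod (f x * weight r x) powr p) \<longleftrightarrow> Phi p r f < \<infinity>"
    unfolding integrable_iff_bounded Phi_def using measurable_Lp_integrand[OF True] by simp
  then show ?thesis using True by (simp add: Lp_space_def)
qed (simp add: Lp_space_def)

lemma Lp_norm_nonneg: "Lp_norm p r f \<ge> 0"
  by (simp add: Lp_norm_def)

lemma Phi_eq_norm:
  assumes f: "f \<in> Lp_space p r" and p: "p \<ge> 1"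
  shows "Phi p r f = ennreal (Lp_norm p r f powr p)"
proof -
  define I where "I = (LINT x|haar. cmod (f x * weight r x) powr p)"
  have "Phi p r f = ennreal I"
    unfolding Phi_def I_def by (rule nn_integral_eq_integral) (use f in \<open>auto simp: Lp_space_def\<close>)
  moreover have "I \<ge> 0" unfolding I_def by (rule integral_nonneg_AE) simp
  then have "(I powr (1 / p)) powr p = I" using p by (simp add: powr_powr)
  ultimately show ?thesis unfolding Lp_norm_def I_def[symmetric] by simp
qed

lemma Lp_spaceI_bound:
  assumes "f \<in> borel_measurable haar" "Phi p r f \<le> ennreal B"
  shows "f \<in> Lp_space p r"
  using assms le_less_trans[OF assms(2) ennreal_less_top] by (simp add: Lp_space_iff)

lemma Lp_norm_leI:
  assumes f: "f \<in> borel_measurable haar" and p: "p \<ge> 1" and B: "B \<ge> 0" and le: "Phi p r f \<le> ennreal (B powr p)"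
  shows "f \<in> Lp_space p r" "Lp_norm p r f \<le> B"
proof -
  show m: "f \<in> Lp_space p r" by (rule Lp_spaceI_bound[OF f le])
  have "Lp_norm p r f powr p \<le> B powr p"
    using le unfolding Phi_eq_norm[OF m p] by (simp add: ennreal_le_iff)
  then show "Lp_norm p r f \<le> B"
    using p B Lp_norm_nonneg[of p r f] powr_less_mono2[of p B "Lp_norm p r f"] by (meson less_le_trans not_le zero_less_one)
qed

lemma Lp_mono:
  assumes f: "f \<in> Lp_space p r" and p: "p \<ge> 1" and g: "g \<in> borel_measurable haar"
    and le: "\<And>x. x \<in> carrier G \<Longrightarrow> cmod (g x) \<le> cmod (f x)"
  shows "g \<in> Lp_space p r" "Lp_norm p r g \<le> Lp_norm p r f"
proof -
  have "Phi p r g \<le> Phi p r f" unfolding Phi_def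
  proof (rule nn_integral_mono, rule ennreal_leI)
    fix x assume "x \<in> space haar"
    then have "cmod (g x * weight r x) \<le> cmod (f x * weight r x)"
      unfolding norm_mult by (intro mult_right_mono le) auto
    then show "cmod (g x * weight r x) powr p \<le> cmod (f x * weight r x) powr p"
      using p by (intro powr_mono2) auto
  qed
  then have "Phi p r g \<le> ennreal (Lp_norm p r f powr p)" using Phi_eq_norm[OF f p] by simp
  then show "g \<in> Lp_space p r" "Lp_norm p r g \<le> Lp_norm p r f"
    using Lp_norm_leI[OF g p Lp_norm_nonneg] by auto
qed

lemma Lp_cong:
  assumes "\<And>x. x \<in> carrier G \<Longrightarrow> f x = g x"
  shows "Lp_norm p r f = Lp_norm p r g" "f \<in> Lp_space p r \<longleftrightarrow> g \<in> Lp_space p r"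
proof -
  show "Lp_norm p r f = Lp_norm p r g"
    unfolding Lp_norm_def by (intro arg_cong[where f="\<lambda>t. t powr (1 / p)"] Bochner_Integration.integral_cong) (auto simp: assms)
  have "f \<in> borel_measurable haar \<longleftrightarrow> g \<in> borel_measurable haar"
    by (rule measurable_cong) (simp add: assms)
  moreover have "Phi p r f = Phi p r g" unfolding Phi_def by (rule nn_integral_cong) (simp add: assms)
  ultimately show "f \<in> Lp_space p r \<longleftrightarrow> g \<in> Lp_space p r" by (simp add: Lp_space_iff)
qed

text \<open>
  The convexity of the power on the open half-line, extended to the boundary point \<open>0\<close>.
\<close>

lemma powr_convex_combination:
  fixes u v t p :: real
  assumes p: "p \<ge> 1" and t: "0 < t" "t < 1" and uv: "u \<ge> 0" "v \<ge> 0"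
  shows "(t * u + (1 - t) * v) powr p \<le> t * u powr p + (1 - t) * v powr p"
proof -
  have small: "q powr p \<le> q" if "0 < q" "q < 1" for q :: real
  proof -
    have "q powr p \<le> q powr 1" by (rule powr_mono') (use that p in auto)
    then show ?thesis using that by simp
  qed
  consider "u = 0" | "v = 0" | "u > 0" "v > 0" using uv by linarith
  then show ?thesis
  proof cases
    case 1
    have "(1 - t) powr p * v powr p \<le> (1 - t) * v powr p"
      using small[of "1 - t"] t by (intro mult_right_mono) auto
    then show ?thesis using 1 t uv by (simp add: powr_mult)
  next
    case 2
    have "t powr p * u powr p \<le> t * u powr p"
      using small[of t] t by (intro mult_right_mono) auto
    then show ?thesis using 2 t uv by (simp add: powr_mult)
  next
    case 3
    then show ?thesis
      using convex_onD[OF powr_convex[OF p], of "1 - t" u v] t by simp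
  qed
qed

text \<open>
  Minkowski's inequality. The sum \<open>f + g\<close> is written as \<open>(a + b)\<close> times a convex combination of \<open>f / a\<close> and
  \<open>g / b\<close>, where \<open>a\<close> and \<open>b\<close> slightly exceed the two norms, so that they do not vanish.
\<close>

lemma Lp_add:
  assumes f: "f \<in> Lp_space p r" and g: "g \<in> Lp_space p r" and p: "p \<ge> 1"
  shows "(\<lambda>x. f x + g x) \<in> Lp_space p r" "Lp_norm p r (\<lambda>x. f x + g x) \<le> Lp_norm p r f + Lp_norm p r g"
proof -
  have [measurable]: "f \<in> borel_measurable haar" "g \<in> borel_measurable haar"
    using f g by (simp_all add: Lp_space_iff)
  have m: "(\<lambda>x. f x + g x) \<in> borel_measurable haar" by measurable
  have key: "Phi p r (\<lambda>x. f x + g x) \<le> ennreal ((a + b) powr p)"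
    if a: "a > Lp_norm p r f" and b: "b > Lp_norm p r g" for a b
  proof -
    have ab: "a > 0" "b > 0" using a b Lp_norm_nonneg[of p r f] Lp_norm_nonneg[of p r g] by linarith+
    define t where "t = a / (a + b)"
    have t: "0 < t" "t < 1" "1 - t = b / (a + b)" using ab by (simp_all add: t_def field_simps)
    define k1 k2 where "k1 = (a + b) powr p * t * a powr (- p)" and "k2 = (a + b) powr p * (1 - t) * b powr (- p)"
    have k: "k1 \<ge> 0" "k2 \<ge> 0" using t(1,2) by (simp_all add: k1_def k2_def)
    have ptw: "cmod ((f x + g x) * weight r x) powr p \<le>
        k1 * cmod (f x * weight r x) powr p + k2 * cmod (g x * weight r x) powr p" for x
    proof -
      define u v where "u = cmod (f x * weight r x)" and "v = cmod (g x * weight r x)"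
      have uv: "u \<ge> 0" "v \<ge> 0" by (simp_all add: u_def v_def)
      have "cmod ((f x + g x) * weight r x) \<le> u + v"
        unfolding u_def v_def distrib_right by (rule norm_triangle_ineq)
      also have "u + v = (a + b) * (t * (u / a) + (1 - t) * (v / b))"
        unfolding t(3) unfolding t_def using ab by (simp add: divide_simps)
      finally have "cmod ((f x + g x) * weight r x) powr p \<le> ((a + b) * (t * (u / a) + (1 - t) * (v / b))) powr p"
        using p by (intro powr_mono2) auto
      also have "\<dots> = (a + b) powr p * (t * (u / a) + (1 - t) * (v / b)) powr p"
        using ab t uv by (intro powr_mult)
      also have "\<dots> \<le> (a + b) powr p * (t * (u / a) powr p + (1 - t) * (v / b) powr p)"
        using ab t uv p by (intro mult_left_mono powr_convex_combination) auto
      finally have le: "cmod ((f x + g x) * weight r x) powr p \<le>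
          (a + b) powr p * (t * (u / a) powr p + (1 - t) * (v / b) powr p)" .
      have "(u / a) powr p = a powr (- p) * u powr p" "(v / b) powr p = b powr (- p) * v powr p"
        using ab uv by (simp_all add: powr_divide powr_minus field_simps)
      then have "(a + b) powr p * (t * (u / a) powr p + (1 - t) * (v / b) powr p) = k1 * u powr p + k2 * v powr p"
        unfolding k1_def k2_def by (simp only: distrib_left mult.assoc)
      then show ?thesis using le unfolding u_def v_def by (simp only:)
    qed
    have "Phi p r (\<lambda>x. f x + g x) \<le> (\<integral>\<^sup>+x. ennreal k1 * ennreal (cmod (f x * weight r x) powr p) +
        ennreal k2 * ennreal (cmod (g x * weight r x) powr p) \<partial>haar)"
      unfolding Phi_def
    proof (rule nn_integral_mono)
      fix x
      have "ennreal (cmod ((f x + g x) * weight r x) powr p) \<le>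
        ennreal (k1 * cmod (f x * weight r x) powr p + k2 * cmod (g x * weight r x) powr p)"
        by (rule ennreal_leI[OF ptw])
      then show "ennreal (cmod ((f x + g x) * weight r x) powr p) \<le>
        ennreal k1 * ennreal (cmod (f x * weight r x) powr p) + ennreal k2 * ennreal (cmod (g x * weight r x) powr p)"
        using k by (simp add: ennreal_mult)
    qed
    also have "\<dots> = ennreal k1 * Phi p r f + ennreal k2 * Phi p r g"
      unfolding Phi_def by (subst nn_integral_add) (simp_all add: nn_integral_cmult)
    also have "\<dots> = ennreal (k1 * Lp_norm p r f powr p + k2 * Lp_norm p r g powr p)"
      unfolding Phi_eq_norm[OF f p] Phi_eq_norm[OF g p] using k by (simp add: ennreal_mult)
    also have "\<dots> \<le> ennreal (k1 * a powr p + k2 * b powr p)"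
      using a b k p by (intro ennreal_leI add_mono mult_left_mono powr_mono2 Lp_norm_nonneg) auto
    also have "k1 * a powr p + k2 * b powr p = (a + b) powr p"
    proof -
      have "a powr (- p) * a powr p = 1" "b powr (- p) * b powr p = 1" using ab by (simp_all flip: powr_add)
      then have "k1 * a powr p = (a + b) powr p * t" "k2 * b powr p = (a + b) powr p * (1 - t)"
        unfolding k1_def k2_def mult.assoc by simp_all
      then show ?thesis by (simp add: right_diff_distrib)
    qed
    finally show ?thesis .
  qed
  define A B where "A = Lp_norm p r f" and "B = Lp_norm p r g"
  have AB: "A \<ge> 0" "B \<ge> 0" by (simp_all add: A_def B_def Lp_norm_nonneg)
  show "(\<lambda>x. f x + g x) \<in> Lp_space p r"
    by (rule Lp_spaceI_bound[OF m key[of "A + 1" "B + 1"]]) (simp_all add: A_def B_def)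
  show "Lp_norm p r (\<lambda>x. f x + g x) \<le> Lp_norm p r f + Lp_norm p r g"
  proof (rule field_le_epsilon)
    fix e :: real assume e: "e > 0"
    have "Lp_norm p r (\<lambda>x. f x + g x) \<le> (A + e / 2) + (B + e / 2)"
      by (rule Lp_norm_leI(2)[OF m p _ key]) (use e AB in \<open>simp_all add: A_def B_def\<close>)
    then show "Lp_norm p r (\<lambda>x. f x + g x) \<le> Lp_norm p r f + Lp_norm p r g + e"
      by (simp add: A_def B_def)
  qed
qed

lemma Lp_scale:
  assumes f: "f \<in> Lp_space p r" and p: "p \<ge> 1"
  shows "(\<lambda>x. c * f x) \<in> Lp_space p r" "Lp_norm p r (\<lambda>x. c * f x) \<le> cmod c * Lp_norm p r f"
proof -
  have [measurable]: "f \<in> borel_measurable haar" using f by (simp add: Lp_space_iff)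
  have m: "(\<lambda>x. c * f x) \<in> borel_measurable haar" by measurable
  have "cmod (c * f x * weight r x) powr p = cmod c powr p * cmod (f x * weight r x) powr p" for x
    by (simp add: norm_mult powr_mult mult.assoc)
  then have "Phi p r (\<lambda>x. c * f x) = ennreal (cmod c powr p) * Phi p r f"
    unfolding Phi_def by (simp add: ennreal_mult nn_integral_cmult)
  also have "\<dots> = ennreal ((cmod c * Lp_norm p r f) powr p)"
    unfolding Phi_eq_norm[OF f p] by (simp add: ennreal_mult powr_mult Lp_norm_nonneg)
  finally have le: "Phi p r (\<lambda>x. c * f x) \<le> ennreal ((cmod c * Lp_norm p r f) powr p)" by simp
  have nonneg: "cmod c * Lp_norm p r f \<ge> 0" by (simp add: Lp_norm_nonneg)
  show "(\<lambda>x. c * f x) \<in> Lp_space p r" "Lp_norm p r (\<lambda>x. c * f x) \<le> cmod c * Lp_norm p r f"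
    by (rule Lp_norm_leI[OF m p nonneg le])+
qed

lemma Lp_diff:
  assumes f: "f \<in> Lp_space p r" and g: "g \<in> Lp_space p r" and p: "p \<ge> 1"
  shows "(\<lambda>x. f x - g x) \<in> Lp_space p r" "Lp_norm p r (\<lambda>x. f x - g x) \<le> Lp_norm p r f + Lp_norm p r g"
proof -
  note g' = Lp_scale[OF g p, of "- 1"]
  show "(\<lambda>x. f x - g x) \<in> Lp_space p r" "Lp_norm p r (\<lambda>x. f x - g x) \<le> Lp_norm p r f + Lp_norm p r g"
    using Lp_add[OF f g'(1) p] g'(2) by simp_all
qed

lemma Lp_norm_minus_commute: "Lp_norm p r (\<lambda>x. f x - g x) = Lp_norm p r (\<lambda>x. g x - f x)"
  by (simp add: Lp_norm_def norm_mult norm_minus_commute)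

lemma Lp_cmod:
  assumes "f \<in> Lp_space p r" "p \<ge> 1"
  shows "(\<lambda>x. complex_of_real (cmod (f x))) \<in> Lp_space p r"
    "Lp_norm p r (\<lambda>x. complex_of_real (cmod (f x))) = Lp_norm p r f"
proof -
  have [measurable]: "f \<in> borel_measurable haar" using assms by (simp add: Lp_space_iff)
  show "(\<lambda>x. complex_of_real (cmod (f x))) \<in> Lp_space p r"
    by (rule Lp_mono(1)[OF assms]) simp_all
  show "Lp_norm p r (\<lambda>x. complex_of_real (cmod (f x))) = Lp_norm p r f"
    by (simp add: Lp_norm_def norm_mult)
qed

text \<open>
  The real-valued version of \<open>KF\<close>. The two agree on the group whenever \<open>KF\<close> is finite there, which holds for \<open>f\<close>
  in the weighted space.
\<close>

definition absK :: "real \<Rightarrow> (real \<times> real \<Rightarrow> complex) \<Rightarrow> real \<times> real \<Rightarrow> real" where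
  "absK s f y = enn2real (KF s (\<lambda>x. cmod (f x)) y)"

lemma absK_nonneg: "absK s f y \<ge> 0"
  by (simp add: absK_def)

lemma Lp_absK:
  fixes s r p :: real
  assumes s: "s > 1" and p: "1 \<le> p" and rp: "2 - s < r + 2 / p" "r + 2 / p < s"
  obtains M where "M > 0"
    "\<And>f y. f \<in> Lp_space p r \<Longrightarrow> y \<in> carrier G \<Longrightarrow> KF s (\<lambda>x. cmod (f x)) y < \<infinity>"
    "\<And>f. f \<in> Lp_space p r \<Longrightarrow> (\<lambda>y. complex_of_real (absK s f y)) \<in> Lp_space p r"
    "\<And>f. f \<in> Lp_space p r \<Longrightarrow> Lp_norm p r (\<lambda>y. complex_of_real (absK s f y)) \<le> M * Lp_norm p r f"
proof -
  obtain M0 where M0: "M0 \<ge> 0" and bd: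
    "\<And>F. F \<in> borel_measurable haar \<Longrightarrow> (\<And>x. F x \<ge> 0) \<Longrightarrow>
      (\<integral>\<^sup>+x. ennreal (F x powr p * N x powr (r * p)) \<partial>haar) < \<infinity> \<Longrightarrow>
      (\<forall>y\<in>carrier G. KF s F y < \<infinity>) \<and>
      (\<integral>\<^sup>+y. ennreal (enn2real (KF s F y) powr p * N y powr (r * p)) \<partial>haar) \<le>
        ennreal M0 * (\<integral>\<^sup>+x. ennreal (F x powr p * N x powr (r * p)) \<partial>haar)"
    by (rule KF_Schur[OF s p rp]) blast
  define q where "q = 2 powr (r * p)"
  have q: "q > 0" by (simp add: q_def)
  have Phi_N: "Phi p r f = ennreal q * (\<integral>\<^sup>+x. ennreal (cmod (f x) powr p * N x powr (r * p)) \<partial>haar)"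
    if [measurable]: "f \<in> borel_measurable haar" for f
  proof -
    have "cmod (f x * weight r x) powr p = q * (cmod (f x) powr p * N x powr (r * p))" for x
      by (simp add: q_def weight_eq_N norm_mult powr_mult powr_powr)
    then have "Phi p r f = (\<integral>\<^sup>+x. ennreal q * ennreal (cmod (f x) powr p * N x powr (r * p)) \<partial>haar)"
      unfolding Phi_def using q by (simp add: ennreal_mult)
    then show ?thesis by (simp add: nn_integral_cmult)
  qed
  define M where "M = (M0 + 1) powr (1 / p)"
  have M: "M > 0" "M powr p = M0 + 1" using M0 p by (simp_all add: M_def powr_powr)
  have main: "(\<forall>y\<in>carrier G. KF s (\<lambda>x. cmod (f x)) y < \<infinity>) \<and>
      (\<lambda>y. complex_of_real (absK s f y)) \<in> Lp_space p r \<and>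
      Lp_norm p r (\<lambda>y. complex_of_real (absK s f y)) \<le> M * Lp_norm p r f" if f: "f \<in> Lp_space p r" for f
  proof -
    have fm[measurable]: "f \<in> borel_measurable haar" and fin: "Phi p r f < \<infinity>" using f by (simp_all add: Lp_space_iff)
    have KFm[measurable]: "KF s (\<lambda>x. cmod (f x)) \<in> borel_measurable haar" by (rule measurable_KF) measurable
    have aKm: "(\<lambda>y. complex_of_real (absK s f y)) \<in> borel_measurable haar" unfolding absK_def by measurable
    define J where "J = (\<integral>\<^sup>+x. ennreal (cmod (f x) powr p * N x powr (r * p)) \<partial>haar)"
    have "J < \<infinity>"
      using fin q unfolding Phi_N[OF fm] J_def[symmetric] by (auto simp: ennreal_mult_less_top)
    then have b: "\<forall>y\<in>carrier G. KF s (\<lambda>x. cmod (f x)) y < \<infinity>"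
      "(\<integral>\<^sup>+y. ennreal (absK s f y powr p * N y powr (r * p)) \<partial>haar) \<le> ennreal M0 * J"
      unfolding absK_def J_def using bd[of "\<lambda>x. cmod (f x)"] by simp_all
    have "Phi p r (\<lambda>y. complex_of_real (absK s f y)) = ennreal q * (\<integral>\<^sup>+y. ennreal (absK s f y powr p * N y powr (r * p)) \<partial>haar)"
      unfolding Phi_N[OF aKm] by (simp add: absK_nonneg)
    also have "\<dots> \<le> ennreal q * (ennreal M0 * J)" by (rule mult_left_mono[OF b(2)]) simp
    also have "\<dots> = ennreal M0 * Phi p r f" unfolding Phi_N[OF fm] J_def by (simp only: mult.left_commute)
    also have "\<dots> \<le> ennreal (M powr p) * Phi p r f"
      unfolding M(2) by (intro mult_right_mono ennreal_leI) simp_all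
    also have "\<dots> = ennreal ((M * Lp_norm p r f) powr p)"
      unfolding Phi_eq_norm[OF f p] using M(1) by (simp add: ennreal_mult powr_mult)
    finally have le: "Phi p r (\<lambda>y. complex_of_real (absK s f y)) \<le> ennreal ((M * Lp_norm p r f) powr p)" .
    have "M * Lp_norm p r f \<ge> 0" using M(1) by (simp add: Lp_norm_nonneg)
    from Lp_norm_leI[OF aKm p this le] b(1) show ?thesis by blast
  qed
  show ?thesis by (rule that[OF M(1)]) (use main in blast)+
qed

section \<open>The reproducing space\<close>

lemma integral_haar_gmult:
  fixes F :: "real \<times> real \<Rightarrow> complex"
  assumes g: "g \<in> carrier G" and F: "F \<in> borel_measurable haar"
  shows "(LINT x|haar. F (g \<cdot> x)) = (LINT x|haar. F x)"
proof -
  have [measurable]: "(\<lambda>_. g) \<in> measurable haar haar" by (rule measurable_const_haar[OF g])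
  have m: "(\<lambda>x. g \<cdot> x) \<in> measurable haar haar" by measurable
  have "(LINT x|haar. F x) = (LINT x|distr haar haar (\<lambda>x. g \<cdot> x). F x)"
    by (simp only: haar_left_invariant[OF g])
  also have "\<dots> = (LINT x|haar. F (g \<cdot> x))" by (rule integral_distr[OF m F])
  finally show ?thesis by simp
qed

text \<open>
  Left translation of \<open>W_reproducing\<close>.
\<close>

lemma W_reproducing_translate:
  assumes s: "s > 1" and x: "x \<in> carrier G" and y: "y \<in> carrier G"
  shows "(LINT v|haar. W s (ginv x \<cdot> v) * W s (ginv v \<cdot> y)) =
    complex_of_real (LINT x|haar. 4 powr s * N x powr (- 2 * s)) * W s (ginv x \<cdot> y)"
proof -
  interpret group G by (rule group_G)
  note [measurable] = measurable_const_haar[OF x] measurable_const_haar[OF y]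
  have id: "(\<lambda>v. v) \<in> measurable haar haar" by simp
  have m: "(\<lambda>v. W s (ginv x \<cdot> v) * W s (ginv v \<cdot> y)) \<in> borel_measurable haar"
    by (intro borel_measurable_times measurable_W_gquot id measurable_const_haar x y)
  have "(LINT v|haar. W s (ginv x \<cdot> v) * W s (ginv v \<cdot> y)) =
      (LINT v|haar. W s (ginv x \<cdot> (x \<cdot> v)) * W s (ginv (x \<cdot> v) \<cdot> y))"
    by (rule integral_haar_gmult[OF x m, symmetric])
  also have "\<dots> = (LINT v|haar. W s v * W s (ginv v \<cdot> (ginv x \<cdot> y)))"
  proof (rule Bochner_Integration.integral_cong[OF refl])
    fix v assume "v \<in> space haar"
    then have v: "v \<in> carrier G" by simp
    have "ginv x \<cdot> (x \<cdot> v) = v" using x v by (simp add: m_assoc[symmetric])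
    moreover have "ginv (x \<cdot> v) \<cdot> y = ginv v \<cdot> (ginv x \<cdot> y)" using x y v by (simp add: inv_mult_group m_assoc)
    ultimately show "W s (ginv x \<cdot> (x \<cdot> v)) * W s (ginv (x \<cdot> v) \<cdot> y) = W s v * W s (ginv v \<cdot> (ginv x \<cdot> y))" by simp
  qed
  also have "\<dots> = complex_of_real (LINT x|haar. 4 powr s * N x powr (- 2 * s)) * W s (ginv x \<cdot> y)"
    using x y by (intro W_reproducing s) simp
  finally show ?thesis .
qed

text \<open>
  Convolution with the kernel, except that the mass at \<open>x\<close> is moved to the node \<open>\<tau> x\<close>. The identity as \<open>\<tau>\<close>
  gives the convolution itself, and a countably valued \<open>\<tau>\<close> gives sums of translates of the kernel.
\<close>

definition wconv :: "real \<Rightarrow> (real \<times> real \<Rightarrow> real \<times> real) \<Rightarrow> (real \<times> real \<Rightarrow> complex) \<Rightarrow> real \<times> real \<Rightarrow> complex" where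
  "wconv s \<tau> g y = (if y \<in> carrier G then LINT x|haar. g x * W s (ginv (\<tau> x) \<cdot> y) else 0)"

lemma conv_eq_wconv: "conv f (W s) = wconv s (\<lambda>x. x) f"
  by (simp add: conv_def wconv_def fun_eq_iff)

text \<open>
  The second condition is what makes estimates for the kernel at \<open>x\<close> valid for the kernel at the node of \<open>x\<close>.
\<close>

definition node_map :: "real \<Rightarrow> (real \<times> real \<Rightarrow> real \<times> real) \<Rightarrow> bool" where
  "node_map s \<tau> \<longleftrightarrow> \<tau> \<in> measurable haar haar \<and>
     (\<forall>x\<in>carrier G. \<forall>y\<in>carrier G. kern s (\<tau> x) y \<le> 2 * kern s x y)"

lemma node_map_id: "node_map s (\<lambda>x. x)"
  by (simp add: node_map_def)

lemma measurable_kern_left: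
  assumes y: "y \<in> carrier G"
  shows "(\<lambda>x. kern s x y) \<in> borel_measurable haar"
proof -
  note [measurable] = measurable_const_haar[OF y]
  show ?thesis by measurable
qed

lemma measurable_KF_integrand:
  assumes [measurable]: "F \<in> borel_measurable haar" and y: "y \<in> carrier G"
  shows "(\<lambda>x. ennreal (F x) * ennreal (kern s x y)) \<in> borel_measurable haar"
proof -
  note [measurable] = measurable_kern_left[OF y]
  show ?thesis by measurable
qed

text \<open>
  The constant \<open>M\<close> bounds the positive kernel operator on the weighted space; everything below uses only this bound.
\<close>

locale bounded_kernel =
  fixes s r p M :: real
  assumes s: "s > 1" and r: "r \<ge> 0" and p: "p \<ge> 1" and M: "M > 0"
    and KF_fin: "\<And>f y. f \<in> Lp_space p r \<Longrightarrow> y \<in> carrier G \<Longrightarrow> KF s (\<lambda>x. cmod (f x)) y < \<infinity>"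
    and absK_Lp: "\<And>f. f \<in> Lp_space p r \<Longrightarrow> (\<lambda>y. complex_of_real (absK s f y)) \<in> Lp_space p r"
    and absK_norm: "\<And>f. f \<in> Lp_space p r \<Longrightarrow> Lp_norm p r (\<lambda>y. complex_of_real (absK s f y)) \<le> M * Lp_norm p r f"
begin

abbreviation "L \<equiv> Lp_space p r"
abbreviation "nrm \<equiv> Lp_norm p r"
abbreviation "B \<equiv> conv_space p r s"

text \<open>
  The square of the \<open>L\<^sup>2\<close>-norm of the kernel, because \<open>cmod (W s x) = 2 powr s * N x powr (- s)\<close>.
\<close>

definition C :: real where "C = (LINT x|haar. 4 powr s * N x powr (- 2 * s))"

lemma C_pos: "C > 0"
proof -
  have nonneg: "AE x in haar. 0 \<le> 4 powr s * N x powr (- 2 * s)" by simp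
  have int: "integrable haar (\<lambda>x. 4 powr s * N x powr (- 2 * s))" using integrable_N_powr[OF s] by simp
  have "C \<noteq> 0"
  proof
    assume "C = 0"
    then have ae: "AE x in haar. 4 powr s * N x powr (- 2 * s) = 0"
      unfolding C_def using integral_nonneg_eq_0_iff_AE[OF int nonneg] by simp
    obtain U where U: "compact_nhd_one U" by (rule W_oscillation[of 1 s]) auto
    obtain Z where Z: "{x \<in> space haar. \<not> 4 powr s * N x powr (- 2 * s) = 0} \<subseteq> Z" "emeasure haar Z = 0" "Z \<in> sets haar"
      by (rule AE_E[OF ae])
    have one: "\<one>\<^bsub>G\<^esub> \<in> carrier G" by (simp add: G_def)
    have "emeasure haar {v \<in> carrier G. ginv \<one>\<^bsub>G\<^esub> \<cdot> v \<in> U} \<le> emeasure haar Z"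
    proof (intro emeasure_mono Z(3) subsetI)
      fix v assume "v \<in> {v \<in> carrier G. ginv \<one>\<^bsub>G\<^esub> \<cdot> v \<in> U}"
      then have "v \<in> carrier G" by simp
      then show "v \<in> Z" using Z(1) N_pos[of v] by auto
    qed
    then show False using haar_ball_pos[OF U one] Z(2) by simp
  qed
  moreover have "C \<ge> 0" unfolding C_def by (rule integral_nonneg_AE[OF nonneg])
  ultimately show ?thesis by simp
qed

lemma L_measurable: "f \<in> L \<Longrightarrow> f \<in> borel_measurable haar"
  by (simp add: Lp_space_iff)

lemma KF_eq_absK: "f \<in> L \<Longrightarrow> y \<in> carrier G \<Longrightarrow> KF s (\<lambda>x. cmod (f x)) y = ennreal (absK s f y)"
  using KF_fin[of f y] by (simp add: absK_def)

text \<open>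
  Point evaluations are bounded: the Harnack inequality bounds the value at \<open>y\<close> by twice the values on the translate
  \<open>y U\<close>, and the weight is at least \<open>1\<close> there.
\<close>

lemma absK_point_bound:
  assumes y: "y \<in> carrier G"
  obtains c where "c \<ge> 0" "\<And>f. f \<in> L \<Longrightarrow> absK s f y \<le> c * nrm f"
proof -
  obtain U where U: "compact_nhd_one U"
    and osc: "\<And>u z. u \<in> U \<Longrightarrow> z \<in> carrier G \<Longrightarrow> cmod (W s (z \<cdot> u) - W s z) \<le> 1 / 2 * cmod (W s z)"
    by (rule W_oscillation[of "1 / 2" s]) auto
  define A where "A = {v \<in> carrier G. ginv y \<cdot> v \<in> U}"
  have A0: "0 < emeasure haar A" unfolding A_def by (rule haar_ball_pos[OF U y])
  then have As: "A \<in> sets haar" using emeasure_notin_sets by fastforce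
  \<comment> \<open>The minimum with \<open>1\<close> makes the measure a positive real number.\<close>
  define m where "m = enn2real (min (emeasure haar A) 1)"
  have min_fin: "min (emeasure haar A) 1 < \<infinity>" by (simp add: min_less_iff_disj)
  have m: "m > 0" unfolding m_def using A0 min_fin by (simp add: enn2real_positive_iff)
  have m_le: "ennreal m \<le> emeasure haar A" unfolding m_def using min_fin by simp
  define c where "c = 2 * M * m powr (- 1 / p)"
  show ?thesis
  proof (rule that[of c])
    show "c \<ge> 0" using M by (simp add: c_def)
    fix f assume f: "f \<in> L"
    have fm: "(\<lambda>x. cmod (f x)) \<in> borel_measurable haar" using L_measurable[OF f] by simp
    have harnack: "absK s f y / 2 \<le> absK s f v" if "v \<in> A" for v
    proof -
      have v: "v \<in> carrier G" "ginv y \<cdot> v \<in> U" using that by (simp_all add: A_def)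
      have "ennreal (absK s f y) \<le> 2 * ennreal (absK s f v)"
        using KF_harnack[OF U osc fm y v] by (simp only: KF_eq_absK[OF f y] KF_eq_absK[OF f v(1)])
      also have "\<dots> = ennreal (2 * absK s f v)" by (simp add: ennreal_mult absK_nonneg)
      finally show ?thesis by (simp add: ennreal_le_iff absK_nonneg)
    qed
    define q where "q = (absK s f y / 2) powr p"
    have "ennreal q * ennreal m \<le> ennreal q * emeasure haar A" by (rule mult_left_mono[OF m_le]) simp
    also have "\<dots> = (\<integral>\<^sup>+v. ennreal q * indicator A v \<partial>haar)" using As by (simp add: nn_integral_cmult_indicator)
    also have "\<dots> \<le> Phi p r (\<lambda>y. complex_of_real (absK s f y))"
      unfolding Phi_def
    proof (rule nn_integral_mono)
      fix v assume "v \<in> space haar"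
      then have v: "v \<in> carrier G" by simp
      show "ennreal q * indicator A v \<le> ennreal (cmod (complex_of_real (absK s f v) * complex_of_real (weight r v)) powr p)"
      proof (cases "v \<in> A")
        case True
        have "absK s f y / 2 * 1 \<le> absK s f v * weight r v"
          using harnack[OF True] weight_ge_1[OF r v] by (intro mult_mono absK_nonneg) simp_all
        then have "q \<le> (absK s f v * weight r v) powr p"
          unfolding q_def using p absK_nonneg[of s f y] by (intro powr_mono2) simp_all
        also have "absK s f v * weight r v = cmod (complex_of_real (absK s f v) * complex_of_real (weight r v))"
          by (simp add: norm_mult absK_nonneg weight_nonneg)
        finally show ?thesis using True by (simp add: ennreal_leI)
      qed simp
    qed
    also have "\<dots> = ennreal (nrm (\<lambda>y. complex_of_real (absK s f y)) powr p)"
      by (rule Phi_eq_norm[OF absK_Lp[OF f] p])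
    also have "\<dots> \<le> ennreal ((M * nrm f) powr p)"
      using p absK_norm[OF f] Lp_norm_nonneg by (intro ennreal_leI powr_mono2) simp_all
    finally have "ennreal (q * m) \<le> ennreal ((M * nrm f) powr p)"
      using m by (simp add: ennreal_mult q_def)
    then have qm: "q * m \<le> (M * nrm f) powr p" by (simp add: ennreal_le_iff)
    have "(m powr (1 / p)) powr p = m" using m p by (simp add: powr_powr)
    then have "(absK s f y / 2 * m powr (1 / p)) powr p = q * m"
      by (simp only: q_def powr_mult)
    then have "(absK s f y / 2 * m powr (1 / p)) powr p \<le> (M * nrm f) powr p" using qm by simp
    then have "absK s f y / 2 * m powr (1 / p) \<le> M * nrm f"
      using p M Lp_norm_nonneg[of p r f]
        powr_less_mono2[of p "M * nrm f" "absK s f y / 2 * m powr (1 / p)"]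
      by (meson less_imp_le less_le_trans mult_nonneg_nonneg not_le zero_less_one)
    then have "absK s f y * (m powr (1 / p) * m powr (- 1 / p)) \<le> 2 * M * nrm f * m powr (- 1 / p)"
      using mult_right_mono[of "absK s f y / 2 * m powr (1 / p)" "M * nrm f" "2 * m powr (- 1 / p)"] by (simp add: mult_ac)
    moreover have "m powr (1 / p) * m powr (- 1 / p) = 1" using m by (simp flip: powr_add)
    ultimately show "absK s f y \<le> c * nrm f" by (simp add: c_def mult_ac)
  qed
qed

lemma wconv_integrand:
  assumes \<tau>: "node_map s \<tau>" and g: "g \<in> L" and y: "y \<in> carrier G"
  shows "integrable haar (\<lambda>x. g x * W s (ginv (\<tau> x) \<cdot> y))"
    and "cmod (wconv s \<tau> g y) \<le> 2 * absK s g y"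
proof -
  have \<tau>m: "\<tau> \<in> measurable haar haar" using \<tau> by (simp add: node_map_def)
  have gm: "g \<in> borel_measurable haar" by (rule L_measurable[OF g])
  have m: "(\<lambda>x. g x * W s (ginv (\<tau> x) \<cdot> y)) \<in> borel_measurable haar"
    by (intro borel_measurable_times gm measurable_W_gquot \<tau>m measurable_const_haar y)
  have m2: "(\<lambda>x. ennreal (cmod (g x)) * ennreal (kern s x y)) \<in> borel_measurable haar"
    by (rule measurable_KF_integrand[OF measurable_compose[OF gm borel_measurable_norm] y])
  have "(\<integral>\<^sup>+x. ennreal (cmod (g x * W s (ginv (\<tau> x) \<cdot> y))) \<partial>haar) \<le>
     (\<integral>\<^sup>+x. 2 * (ennreal (cmod (g x)) * ennreal (kern s x y)) \<partial>haar)"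
  proof (rule nn_integral_mono)
    fix x assume "x \<in> space haar"
    then have "kern s (\<tau> x) y \<le> 2 * kern s x y" using \<tau> y by (simp add: node_map_def)
    then have "cmod (g x * W s (ginv (\<tau> x) \<cdot> y)) \<le> 2 * (cmod (g x) * kern s x y)"
      unfolding norm_mult using mult_left_mono[of "kern s (\<tau> x) y" "2 * kern s x y" "cmod (g x)"] by (simp add: mult_ac)
    then have "ennreal (cmod (g x * W s (ginv (\<tau> x) \<cdot> y))) \<le> ennreal (2 * (cmod (g x) * kern s x y))"
      by (rule ennreal_leI)
    then show "ennreal (cmod (g x * W s (ginv (\<tau> x) \<cdot> y))) \<le> 2 * (ennreal (cmod (g x)) * ennreal (kern s x y))"
      by (simp add: ennreal_mult)
  qed
  also have "\<dots> = 2 * KF s (\<lambda>x. cmod (g x)) y"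
    unfolding KF_def by (rule nn_integral_cmult[OF m2])
  also have "\<dots> = ennreal (2 * absK s g y)"
    unfolding KF_eq_absK[OF g y] by (simp add: ennreal_mult absK_nonneg)
  finally have le: "(\<integral>\<^sup>+x. ennreal (cmod (g x * W s (ginv (\<tau> x) \<cdot> y))) \<partial>haar) \<le> ennreal (2 * absK s g y)" .
  show int: "integrable haar (\<lambda>x. g x * W s (ginv (\<tau> x) \<cdot> y))"
    by (rule integrableI_bounded[OF m]) (use le_less_trans[OF le ennreal_less_top] in simp)
  have "ennreal (cmod (LINT x|haar. g x * W s (ginv (\<tau> x) \<cdot> y))) \<le> ennreal (2 * absK s g y)"
    using integral_norm_bound_ennreal[OF int] le by (rule order_trans)
  then show "cmod (wconv s \<tau> g y) \<le> 2 * absK s g y"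
    using y by (simp add: wconv_def ennreal_le_iff absK_nonneg)
qed

lemma wconv_measurable:
  assumes \<tau>: "node_map s \<tau>" and g: "g \<in> L"
  shows "wconv s \<tau> g \<in> borel_measurable haar"
proof -
  have \<tau>m[measurable]: "\<tau> \<in> measurable haar haar" using \<tau> by (simp add: node_map_def)
  have gm[measurable]: "g \<in> borel_measurable haar" by (rule L_measurable[OF g])
  have "(\<lambda>z. g (snd z) * W s (ginv (\<tau> (snd z)) \<cdot> fst z)) \<in> borel_measurable (haar \<Otimes>\<^sub>M haar)"
    by (intro borel_measurable_times measurable_compose[OF measurable_snd gm] measurable_W_gquot
      measurable_compose[OF measurable_snd \<tau>m] measurable_fst)
  then have "(\<lambda>y. LINT x|haar. g x * W s (ginv (\<tau> x) \<cdot> y)) \<in> borel_measurable haar"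
    by (intro haar.borel_measurable_lebesgue_integral) (simp add: case_prod_beta')
  then show ?thesis
    by (rule measurable_cong[THEN iffD1, rotated]) (simp add: wconv_def)
qed

lemma wconv_in_L:
  assumes \<tau>: "node_map s \<tau>" and g: "g \<in> L"
  shows "wconv s \<tau> g \<in> L" "nrm (wconv s \<tau> g) \<le> 2 * M * nrm g"
proof -
  note sc = Lp_scale[OF absK_Lp[OF g] p, of 2]
  have le: "cmod (wconv s \<tau> g y) \<le> cmod (2 * complex_of_real (absK s g y))" if "y \<in> carrier G" for y
    using wconv_integrand(2)[OF \<tau> g that] by (simp add: norm_mult absK_nonneg)
  show "wconv s \<tau> g \<in> L" by (rule Lp_mono(1)[OF sc(1) p wconv_measurable[OF \<tau> g] le])
  have "nrm (wconv s \<tau> g) \<le> nrm (\<lambda>x. 2 * complex_of_real (absK s g x))"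
    by (rule Lp_mono(2)[OF sc(1) p wconv_measurable[OF \<tau> g] le])
  also have "\<dots> \<le> 2 * nrm (\<lambda>x. complex_of_real (absK s g x))" using sc(2) by simp
  also have "\<dots> \<le> 2 * (M * nrm g)" using absK_norm[OF g] by simp
  finally show "nrm (wconv s \<tau> g) \<le> 2 * M * nrm g" by simp
qed

text \<open>
  Fubini's theorem and \<open>W_reproducing_translate\<close>. Absolute convergence holds because the iterated kernel operator
  maps the weighted space to functions that are finite everywhere.
\<close>

lemma wconv_reproduced:
  assumes \<tau>: "node_map s \<tau>" and g: "g \<in> L" and y: "y \<in> carrier G"
  shows "conv (wconv s \<tau> g) (W s) y = complex_of_real C * wconv s \<tau> g y"
proof -
  have \<tau>m: "\<tau> \<in> measurable haar haar" using \<tau> by (simp add: node_map_def)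
  have \<tau>G: "\<tau> x \<in> carrier G" if "x \<in> carrier G" for x using measurable_space[OF \<tau>m, of x] that by simp
  have gm: "g \<in> borel_measurable haar" by (rule L_measurable[OF g])
  define f where "f x v = g x * W s (ginv (\<tau> x) \<cdot> v) * W s (ginv v \<cdot> y)" for x v
  have fm: "case_prod f \<in> borel_measurable (haar \<Otimes>\<^sub>M haar)"
    unfolding f_def case_prod_beta'
    by (intro borel_measurable_times measurable_compose[OF measurable_fst gm] measurable_W_gquot
      measurable_compose[OF measurable_fst \<tau>m] measurable_snd measurable_const_haar y)
  have km: "(\<lambda>v. ennreal (kern s v y)) \<in> borel_measurable haar"
    by (rule measurable_compose[OF measurable_kern_left[OF y] measurable_ennreal])
  have KFm: "KF s (\<lambda>x. cmod (g x)) \<in> borel_measurable haar" by (rule measurable_KF) (use gm in simp)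
  have "(\<integral>\<^sup>+z. ennreal (cmod (case_prod f z)) \<partial>(haar \<Otimes>\<^sub>M haar)) =
     (\<integral>\<^sup>+v. \<integral>\<^sup>+x. ennreal (cmod (f x v)) \<partial>haar \<partial>haar)"
    using fm by (subst haar2.nn_integral_snd[symmetric]) simp_all
  also have "\<dots> \<le> (\<integral>\<^sup>+v. 2 * (KF s (\<lambda>x. cmod (g x)) v * ennreal (kern s v y)) \<partial>haar)"
  proof (rule nn_integral_mono)
    fix v assume "v \<in> space haar"
    then have v: "v \<in> carrier G" by simp
    have m2: "(\<lambda>x. ennreal (cmod (g x)) * ennreal (kern s x v)) \<in> borel_measurable haar"
      by (rule measurable_KF_integrand[OF measurable_compose[OF gm borel_measurable_norm] v])
    have "(\<integral>\<^sup>+x. ennreal (cmod (f x v)) \<partial>haar) \<le> (\<integral>\<^sup>+x. 2 * ennreal (kern s v y) * (ennreal (cmod (g x)) * ennreal (kern s x v)) \<partial>haar)"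
    proof (rule nn_integral_mono)
      fix x assume "x \<in> space haar"
      then have "kern s (\<tau> x) v \<le> 2 * kern s x v" using \<tau> v by (simp add: node_map_def)
      then have "cmod (g x) * kern s (\<tau> x) v * kern s v y \<le> cmod (g x) * (2 * kern s x v) * kern s v y"
        by (intro mult_right_mono mult_left_mono) simp_all
      also have "\<dots> = 2 * kern s v y * (cmod (g x) * kern s x v)" by (simp only: mult_ac)
      finally have "ennreal (cmod (f x v)) \<le> ennreal (2 * kern s v y * (cmod (g x) * kern s x v))"
        unfolding f_def norm_mult by (rule ennreal_leI)
      then show "ennreal (cmod (f x v)) \<le> 2 * ennreal (kern s v y) * (ennreal (cmod (g x)) * ennreal (kern s x v))"
        by (simp add: ennreal_mult)
    qed
    also have "\<dots> = 2 * ennreal (kern s v y) * KF s (\<lambda>x. cmod (g x)) v"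
      unfolding KF_def by (rule nn_integral_cmult[OF m2])
    finally show "(\<integral>\<^sup>+x. ennreal (cmod (f x v)) \<partial>haar) \<le> 2 * (KF s (\<lambda>x. cmod (g x)) v * ennreal (kern s v y))"
      by (simp only: mult_ac)
  qed
  also have "\<dots> = 2 * (\<integral>\<^sup>+v. KF s (\<lambda>x. cmod (g x)) v * ennreal (kern s v y) \<partial>haar)"
    by (rule nn_integral_cmult) (intro borel_measurable_times_ennreal KFm km)
  also have "(\<integral>\<^sup>+v. KF s (\<lambda>x. cmod (g x)) v * ennreal (kern s v y) \<partial>haar) =
      KF s (\<lambda>v. cmod (complex_of_real (absK s g v))) y"
    unfolding KF_def[of s "\<lambda>v. cmod (complex_of_real (absK s g v))"]
    by (intro nn_integral_cong) (simp add: KF_eq_absK[OF g] absK_nonneg)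
  also have "2 * \<dots> < \<infinity>"
    using KF_fin[OF absK_Lp[OF g] y] by (simp add: ennreal_mult_less_top)
  finally have int: "integrable (haar \<Otimes>\<^sub>M haar) (case_prod f)"
    by (intro integrableI_bounded[OF fm])
  have "conv (wconv s \<tau> g) (W s) y = (LINT v|haar. LINT x|haar. f x v)"
  proof -
    have "(LINT x|haar. f x v) = wconv s \<tau> g v * W s (ginv v \<cdot> y)" if "v \<in> carrier G" for v
      unfolding f_def using that by (simp add: wconv_def)
    then show ?thesis unfolding conv_def using y by (auto intro!: Bochner_Integration.integral_cong)
  qed
  also have "\<dots> = (LINT x|haar. LINT v|haar. f x v)" by (rule haar2.Fubini_integral[OF int])
  also have "\<dots> = (LINT x|haar. complex_of_real C * (g x * W s (ginv (\<tau> x) \<cdot> y)))"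
  proof (rule Bochner_Integration.integral_cong[OF refl])
    fix x assume "x \<in> space haar"
    then have x: "\<tau> x \<in> carrier G" using \<tau>G by simp
    have "(LINT v|haar. f x v) = g x * (LINT v|haar. W s (ginv (\<tau> x) \<cdot> v) * W s (ginv v \<cdot> y))"
      unfolding f_def mult.assoc by (rule integral_mult_right_zero)
    also have "\<dots> = g x * (complex_of_real C * W s (ginv (\<tau> x) \<cdot> y))"
      unfolding W_reproducing_translate[OF s x y] C_def ..
    finally show "(LINT v|haar. f x v) = complex_of_real C * (g x * W s (ginv (\<tau> x) \<cdot> y))"
      by (simp only: mult.left_commute)
  qed
  also have "\<dots> = complex_of_real C * wconv s \<tau> g y"
    unfolding wconv_def using y by simp
  finally show ?thesis .
qed

text \<open>
  The image of the convolution is the eigenspace of the convolution for the eigenvalue \<open>C\<close>. In this form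
  the space is visibly closed under limits.
\<close>

lemma conv_space_iff:
  "f \<in> B \<longleftrightarrow> f \<in> L \<and> (\<forall>y. y \<notin> carrier G \<longrightarrow> f y = 0) \<and> (\<forall>y\<in>carrier G. conv f (W s) y = complex_of_real C * f y)"
proof
  assume "f \<in> B"
  then obtain g where g: "g \<in> L" and f: "f = wconv s (\<lambda>x. x) g"
    by (auto simp: conv_space_def conv_eq_wconv)
  show "f \<in> L \<and> (\<forall>y. y \<notin> carrier G \<longrightarrow> f y = 0) \<and> (\<forall>y\<in>carrier G. conv f (W s) y = complex_of_real C * f y)"
    unfolding f using wconv_in_L(1)[OF node_map_id g] wconv_reproduced[OF node_map_id g]
    by (auto simp: wconv_def[of s _ _ "_"])
next
  assume a: "f \<in> L \<and> (\<forall>y. y \<notin> carrier G \<longrightarrow> f y = 0) \<and> (\<forall>y\<in>carrier G. conv f (W s) y = complex_of_real C * f y)"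
  have "f = conv (\<lambda>x. complex_of_real (1 / C) * f x) (W s)"
  proof
    fix y
    show "f y = conv (\<lambda>x. complex_of_real (1 / C) * f x) (W s) y"
    proof (cases "y \<in> carrier G")
      case True
      then have "conv (\<lambda>x. complex_of_real (1 / C) * f x) (W s) y = complex_of_real (1 / C) * conv f (W s) y"
        unfolding conv_def mult.assoc by simp
      also have "\<dots> = f y" using a True C_pos by simp
      finally show ?thesis by simp
    next
      case False
      then have "f y = 0" using a by blast
      then show ?thesis using False by (simp add: conv_def)
    qed
  qed
  then show "f \<in> B" unfolding conv_space_def using Lp_scale(1)[of f p r "complex_of_real (1 / C)"] a p by blast
qed

lemma wconv_in_B:
  assumes "node_map s \<tau>" "g \<in> L" shows "wconv s \<tau> g \<in> B"
  unfolding conv_space_iff using wconv_in_L(1)[OF assms] wconv_reproduced[OF assms]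
  by (simp add: wconv_def[of s \<tau> g])

end

section \<open>Operators close to a multiple of the identity\<close>

context bounded_kernel
begin

lemma B_in_L: "f \<in> B \<Longrightarrow> f \<in> L"
  by (simp add: conv_space_iff)

lemma conv_linear:
  assumes "f \<in> L" "g \<in> L" "y \<in> carrier G"
  shows "conv (\<lambda>x. a * f x + b * g x) (W s) y = a * conv f (W s) y + b * conv g (W s) y"
proof -
  note i = wconv_integrand(1)[OF node_map_id assms(1,3)] wconv_integrand(1)[OF node_map_id assms(2,3)]
  have "conv (\<lambda>x. a * f x + b * g x) (W s) y =
      (LINT x|haar. a * (f x * W s (ginv x \<cdot> y)) + b * (g x * W s (ginv x \<cdot> y)))"
    using assms(3) by (simp add: conv_def distrib_right mult.assoc)
  also have "\<dots> = a * conv f (W s) y + b * conv g (W s) y"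
    using assms(3) i by (simp add: conv_def)
  finally show ?thesis .
qed

lemma B_linear:
  assumes f: "f \<in> B" and g: "g \<in> B"
  shows "(\<lambda>x. a * f x + b * g x) \<in> B"
proof -
  have fg: "f \<in> L" "g \<in> L" using f g by (simp_all add: B_in_L)
  have "(\<lambda>x. a * f x + b * g x) \<in> L"
    by (intro Lp_add(1) Lp_scale(1) fg p)
  then show ?thesis
    using f g unfolding conv_space_iff by (auto simp: conv_linear[OF fg] algebra_simps)
qed

lemma B_diff: "f \<in> B \<Longrightarrow> g \<in> B \<Longrightarrow> (\<lambda>x. f x - g x) \<in> B"
  using B_linear[of f g 1 "- 1"] by simp

lemma B_point_bound:
  assumes y: "y \<in> carrier G"
  obtains c where "c \<ge> 0" "\<And>f. f \<in> B \<Longrightarrow> cmod (f y) \<le> c * nrm f"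
proof -
  obtain c where c: "c \<ge> 0" "\<And>f. f \<in> L \<Longrightarrow> absK s f y \<le> c * nrm f"
    by (rule absK_point_bound[OF y]) blast
  show ?thesis
  proof (rule that[of "2 * c / C"])
    show "2 * c / C \<ge> 0" using c(1) C_pos by simp
    fix f assume f: "f \<in> B"
    have "C * cmod (f y) = cmod (conv f (W s) y)"
      using f y C_pos by (simp add: conv_space_iff norm_mult)
    also have "\<dots> \<le> 2 * absK s f y"
      unfolding conv_eq_wconv by (rule wconv_integrand(2)[OF node_map_id B_in_L[OF f] y])
    also have "\<dots> \<le> 2 * (c * nrm f)" using c(2)[OF B_in_L[OF f]] by simp
    finally show "cmod (f y) \<le> 2 * c / C * nrm f"
      using C_pos by (simp add: pos_le_divide_eq mult_ac)
  qed
qed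

lemma B_eqI:
  assumes f: "f \<in> B" and g: "g \<in> B" and d: "nrm (\<lambda>x. f x - g x) = 0"
  shows "f = g"
proof
  fix y
  show "f y = g y"
  proof (cases "y \<in> carrier G")
    case True
    obtain c where "\<And>f. f \<in> B \<Longrightarrow> cmod (f y) \<le> c * nrm f"
      by (rule B_point_bound[OF True]) blast
    from this[OF B_diff[OF f g]] show ?thesis using d by simp
  next
    case False
    then have "f y = 0" "g y = 0" using f g unfolding conv_space_iff by blast+
    then show ?thesis by simp
  qed
qed

definition dB :: "(real \<times> real \<Rightarrow> complex) \<Rightarrow> (real \<times> real \<Rightarrow> complex) \<Rightarrow> real" where
  "dB f g = nrm (\<lambda>x. f x - g x)"

sublocale metB: Metric_space B dB
proof
  fix f g show "0 \<le> dB f g" by (simp add: dB_def Lp_norm_nonneg)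
  show "dB f g = dB g f" unfolding dB_def by (rule Lp_norm_minus_commute)
next
  fix f g assume fg: "f \<in> B" "g \<in> B"
  show "(dB f g = 0) = (f = g)"
  proof
    assume "dB f g = 0" then show "f = g" unfolding dB_def by (rule B_eqI[OF fg])
  qed (simp add: dB_def Lp_norm_def)
next
  fix f g h assume "f \<in> B" "g \<in> B" "h \<in> B"
  then have "(\<lambda>x. f x - g x) \<in> L" "(\<lambda>x. g x - h x) \<in> L" by (simp_all add: B_in_L B_diff)
  from Lp_add(2)[OF this p] show "dB f h \<le> dB f g + dB g h" by (simp add: dB_def)
qed

text \<open>
  A Cauchy sequence converges pointwise, because point evaluations are bounded. Fatou's lemma turns pointwise
  convergence into convergence in norm, and the eigenvalue equation passes to the limit.
\<close>

lemma metB_complete: "metB.mcomplete"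
  unfolding metB.mcomplete_def
proof (intro allI impI)
  fix \<sigma> :: "nat \<Rightarrow> real \<times> real \<Rightarrow> complex" assume "metB.MCauchy \<sigma>"
  then have \<sigma>B: "\<sigma> n \<in> B" and cau: "e > 0 \<Longrightarrow> \<exists>K. \<forall>n m. K \<le> n \<longrightarrow> K \<le> m \<longrightarrow> dB (\<sigma> n) (\<sigma> m) < e" for n e
    unfolding metB.MCauchy_def by auto
  have \<sigma>L: "\<sigma> n \<in> L" and \<sigma>m: "\<sigma> n \<in> borel_measurable haar" for n
    using B_in_L[OF \<sigma>B] L_measurable by simp_all
  have conv: "convergent (\<lambda>n. \<sigma> n y)" for y
  proof (cases "y \<in> carrier G")
    case True
    obtain c where c: "c \<ge> 0" "\<And>f. f \<in> B \<Longrightarrow> cmod (f y) \<le> c * nrm f"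
      by (rule B_point_bound[OF True]) blast
    have "Cauchy (\<lambda>n. \<sigma> n y)"
    proof (rule CauchyI)
      fix e :: real assume e: "e > 0"
      then have "e / (c + 1) > 0" using c(1) by simp
      then obtain K where K: "\<And>n m. K \<le> n \<Longrightarrow> K \<le> m \<Longrightarrow> dB (\<sigma> n) (\<sigma> m) < e / (c + 1)" using cau by blast
      show "\<exists>K. \<forall>m\<ge>K. \<forall>n\<ge>K. cmod (\<sigma> m y - \<sigma> n y) < e"
      proof (intro exI allI impI)
        fix m n assume "K \<le> m" "K \<le> n"
        have "cmod (\<sigma> m y - \<sigma> n y) \<le> c * dB (\<sigma> m) (\<sigma> n)"
          unfolding dB_def by (rule c(2)[OF B_diff[OF \<sigma>B \<sigma>B]])
        also have "\<dots> \<le> c * (e / (c + 1))"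
          using K[OF \<open>K \<le> m\<close> \<open>K \<le> n\<close>] c(1) by (intro mult_left_mono) simp_all
        also have "\<dots> < e" using c(1) e by (simp add: field_simps)
        finally show "cmod (\<sigma> m y - \<sigma> n y) < e" .
      qed
    qed
    then show ?thesis by (rule Cauchy_convergent)
  next
    case False
    then have "\<sigma> n y = 0" for n using \<sigma>B[of n] unfolding conv_space_iff by blast
    then show ?thesis by (simp add: convergent_const)
  qed
  define f where "f y = lim (\<lambda>n. \<sigma> n y)" for y
  have lim: "(\<lambda>n. \<sigma> n y) \<longlonglongrightarrow> f y" for y
    using conv[of y] unfolding f_def by (simp add: convergent_LIMSEQ_iff)
  have fm: "f \<in> borel_measurable haar" by (rule borel_measurable_LIMSEQ_metric[OF \<sigma>m lim])
  have close: "(\<lambda>x. \<sigma> n x - f x) \<in> L \<and> nrm (\<lambda>x. \<sigma> n x - f x) \<le> e"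
    if e: "e > 0" and K: "\<And>n m. K \<le> n \<Longrightarrow> K \<le> m \<Longrightarrow> dB (\<sigma> n) (\<sigma> m) < e" and n: "K \<le> n" for e K n
  proof -
    have dm: "(\<lambda>x. \<sigma> n x - f x) \<in> borel_measurable haar" using \<sigma>m fm by simp
    have "Phi p r (\<lambda>x. \<sigma> n x - f x) = (\<integral>\<^sup>+x. liminf (\<lambda>m. ennreal (cmod ((\<sigma> n x - \<sigma> m x) * weight r x) powr p)) \<partial>haar)"
      unfolding Phi_def
    proof (rule nn_integral_cong)
      fix x
      have "(\<lambda>m. cmod ((\<sigma> n x - \<sigma> m x) * weight r x) powr p) \<longlonglongrightarrow> cmod ((\<sigma> n x - f x) * weight r x) powr p"
        using p by (intro tendsto_powr' tendsto_norm tendsto_mult tendsto_diff tendsto_const lim) simp_all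
      then have "(\<lambda>m. ennreal (cmod ((\<sigma> n x - \<sigma> m x) * weight r x) powr p)) \<longlonglongrightarrow> ennreal (cmod ((\<sigma> n x - f x) * weight r x) powr p)"
        by (rule tendsto_ennrealI)
      then show "ennreal (cmod ((\<sigma> n x - f x) * weight r x) powr p) = liminf (\<lambda>m. ennreal (cmod ((\<sigma> n x - \<sigma> m x) * weight r x) powr p))"
        by (intro lim_imp_Liminf[symmetric]) simp_all
    qed
    also have "\<dots> \<le> liminf (\<lambda>m. Phi p r (\<lambda>x. \<sigma> n x - \<sigma> m x))"
      unfolding Phi_def using \<sigma>m by (intro nn_integral_liminf) simp
    also have "\<dots> \<le> ennreal (e powr p)"
    proof -
      have "Phi p r (\<lambda>x. \<sigma> n x - \<sigma> m x) \<le> ennreal (e powr p)" if "K \<le> m" for m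
      proof -
        have "Phi p r (\<lambda>x. \<sigma> n x - \<sigma> m x) = ennreal (dB (\<sigma> n) (\<sigma> m) powr p)"
          unfolding dB_def by (rule Phi_eq_norm[OF Lp_diff(1)[OF \<sigma>L \<sigma>L p] p])
        also have "\<dots> \<le> ennreal (e powr p)"
          using K[OF n that] p by (intro ennreal_leI powr_mono2) (simp_all add: dB_def Lp_norm_nonneg)
        finally show ?thesis .
      qed
      then have "eventually (\<lambda>m. Phi p r (\<lambda>x. \<sigma> n x - \<sigma> m x) \<le> ennreal (e powr p)) sequentially"
        unfolding eventually_sequentially by blast
      then have "limsup (\<lambda>m. Phi p r (\<lambda>x. \<sigma> n x - \<sigma> m x)) \<le> ennreal (e powr p)" by (rule Limsup_bounded)
      then show ?thesis using Liminf_le_Limsup[of sequentially "\<lambda>m. Phi p r (\<lambda>x. \<sigma> n x - \<sigma> m x)"] by (simp add: order_trans)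
    qed
    finally have le: "Phi p r (\<lambda>x. \<sigma> n x - f x) \<le> ennreal (e powr p)" .
    show ?thesis using Lp_norm_leI[OF dm p less_imp_le[OF e] le] by blast
  qed
  obtain K1 where K1: "\<And>n m. K1 \<le> n \<Longrightarrow> K1 \<le> m \<Longrightarrow> dB (\<sigma> n) (\<sigma> m) < 1" using cau[of 1] by auto
  have "(\<lambda>x. \<sigma> K1 x - f x) \<in> L" using close[OF zero_less_one K1] by blast
  from Lp_diff(1)[OF \<sigma>L[of K1] this p] have fL: "f \<in> L" by simp
  have fB: "f \<in> B"
    unfolding conv_space_iff
  proof (intro conjI ballI allI impI fL)
    fix y assume y: "y \<notin> carrier G"
    have "\<sigma> n y = 0" for n using \<sigma>B[of n] y unfolding conv_space_iff by blast
    then show "f y = 0" using lim[of y] by (simp add: LIMSEQ_const_iff)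
  next
    fix y assume y: "y \<in> carrier G"
    obtain c where c: "c \<ge> 0" "\<And>f. f \<in> L \<Longrightarrow> absK s f y \<le> c * nrm f"
      by (rule absK_point_bound[OF y]) blast
    have "(\<lambda>n. conv (\<sigma> n) (W s) y) \<longlonglongrightarrow> conv f (W s) y"
    proof (rule LIMSEQ_I)
      fix e :: real assume e: "e > 0"
      define e' where "e' = e / (2 * c + 1)"
      have e': "e' > 0" using e c(1) by (simp add: e'_def)
      obtain K where K: "\<And>n m. K \<le> n \<Longrightarrow> K \<le> m \<Longrightarrow> dB (\<sigma> n) (\<sigma> m) < e'" using cau[OF e'] by blast
      show "\<exists>K. \<forall>n\<ge>K. cmod (conv (\<sigma> n) (W s) y - conv f (W s) y) < e"
      proof (intro exI allI impI)
        fix n assume "K \<le> n"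
        have d: "(\<lambda>x. \<sigma> n x - f x) \<in> L" "nrm (\<lambda>x. \<sigma> n x - f x) \<le> e'"
          using close[OF e' K \<open>K \<le> n\<close>] by auto
        have "conv (\<sigma> n) (W s) y - conv f (W s) y = conv (\<lambda>x. \<sigma> n x - f x) (W s) y"
          using conv_linear[OF \<sigma>L[of n] fL y, of 1 "- 1"] by simp
        also have "cmod \<dots> \<le> 2 * absK s (\<lambda>x. \<sigma> n x - f x) y"
          unfolding conv_eq_wconv by (rule wconv_integrand(2)[OF node_map_id d(1) y])
        also have "\<dots> \<le> 2 * (c * nrm (\<lambda>x. \<sigma> n x - f x))" using c(2)[OF d(1)] by simp
        also have "\<dots> \<le> 2 * (c * e')" using d(2) c(1) by (intro mult_left_mono) simp_all
        also have "\<dots> < e" using e c(1) by (simp add: e'_def field_simps)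
        finally show "cmod (conv (\<sigma> n) (W s) y - conv f (W s) y) < e" .
      qed
    qed
    moreover have "(\<lambda>n. conv (\<sigma> n) (W s) y) = (\<lambda>n. complex_of_real C * \<sigma> n y)"
      using \<sigma>B y by (auto simp: conv_space_iff)
    moreover have "(\<lambda>n. complex_of_real C * \<sigma> n y) \<longlonglongrightarrow> complex_of_real C * f y"
      by (intro tendsto_mult tendsto_const lim)
    ultimately show "conv f (W s) y = complex_of_real C * f y" using LIMSEQ_unique by metis
  qed
  have "limitin metB.mtopology \<sigma> f sequentially"
    unfolding metB.limitin_metric
  proof (intro conjI allI impI fB)
    fix e :: real assume e: "e > 0"
    then obtain K where K: "\<And>n m. K \<le> n \<Longrightarrow> K \<le> m \<Longrightarrow> dB (\<sigma> n) (\<sigma> m) < e / 2" using cau[of "e / 2"] by auto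
    have "\<sigma> n \<in> B \<and> dB (\<sigma> n) f < e" if "K \<le> n" for n
      using close[of "e / 2" K n] K e that \<sigma>B by (auto simp: dB_def)
    then show "\<forall>\<^sub>F n in sequentially. \<sigma> n \<in> B \<and> dB (\<sigma> n) f < e"
      unfolding eventually_sequentially by blast
  qed
  then show "\<exists>f. limitin metB.mtopology \<sigma> f sequentially" by blast
qed

text \<open>
  An operator whose distance from \<open>C\<close> times the identity is less than \<open>C\<close> is bounded below, which gives injectivity
  and the continuity of the inverse. Banach's fixed point theorem gives surjectivity.
\<close>

theorem near_multiple_invertible:
  assumes T: "\<And>f. f \<in> B \<Longrightarrow> T f \<in> B"
    and lin: "\<And>f g. f \<in> B \<Longrightarrow> g \<in> B \<Longrightarrow> T (\<lambda>y. f y - g y) = (\<lambda>y. T f y - T g y)"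
    and near: "\<And>f. f \<in> B \<Longrightarrow> nrm (\<lambda>y. T f y - complex_of_real C * f y) \<le> \<kappa> * nrm f"
    and \<kappa>: "\<kappa> < C"
  shows "continuously_invertible p r B T"
proof -
  have lower: "(C - \<kappa>) * nrm (\<lambda>y. f y - g y) \<le> nrm (\<lambda>y. T f y - T g y)" if f: "f \<in> B" and g: "g \<in> B" for f g
  proof -
    define h where "h = (\<lambda>y. f y - g y)"
    have h: "h \<in> B" unfolding h_def by (rule B_diff[OF f g])
    have Th: "T h = (\<lambda>y. T f y - T g y)" unfolding h_def by (rule lin[OF f g])
    have Ch: "(\<lambda>y. complex_of_real C * h y) \<in> L" by (rule Lp_scale(1)[OF B_in_L[OF h] p])
    have "h = (\<lambda>y. complex_of_real (1 / C) * (complex_of_real C * h y))" using C_pos by (simp add: fun_eq_iff)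
    then have "nrm h \<le> 1 / C * nrm (\<lambda>y. complex_of_real C * h y)"
      using Lp_scale(2)[OF Ch p, of "complex_of_real (1 / C)"] C_pos by (simp add: norm_divide)
    then have "C * nrm h \<le> nrm (\<lambda>y. complex_of_real C * h y)" using C_pos by (simp add: field_simps)
    also have "(\<lambda>y. complex_of_real C * h y) = (\<lambda>y. T h y - (T h y - complex_of_real C * h y))" by simp
    also have "nrm \<dots> \<le> nrm (T h) + nrm (\<lambda>y. T h y - complex_of_real C * h y)"
      by (rule Lp_diff(2)[OF B_in_L[OF T[OF h]] Lp_diff(1)[OF B_in_L[OF T[OF h]] Ch p] p])
    also have "\<dots> \<le> nrm (T h) + \<kappa> * nrm h" using near[OF h] by simp
    finally show ?thesis
      unfolding Th[symmetric] h_def[symmetric] by (simp add: left_diff_distrib)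
  qed
  have \<kappa>C: "C - \<kappa> > 0" using \<kappa> by simp
  have inj: "inj_on T B"
  proof (rule inj_onI)
    fix f g assume fg: "f \<in> B" "g \<in> B" "T f = T g"
    have "(C - \<kappa>) * nrm (\<lambda>y. f y - g y) \<le> 0" using lower[OF fg(1,2)] fg(3) by (simp add: Lp_norm_def)
    then have "nrm (\<lambda>y. f y - g y) \<le> 0" using \<kappa>C by (simp add: mult_le_0_iff)
    then show "f = g" using B_eqI[OF fg(1,2)] Lp_norm_nonneg[of p r "\<lambda>y. f y - g y"] by simp
  qed
  have surj: "\<exists>f\<in>B. T f = h" if h: "h \<in> B" for h
  proof -
    \<comment> \<open>One step of the Neumann iteration for \<open>T f = h\<close>.\<close>
    define \<Phi> where "\<Phi> f = (\<lambda>y. f y - complex_of_real (1 / C) * (T f y - h y))" for f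
    have \<Phi>B: "\<Phi> f \<in> B" if f: "f \<in> B" for f
      using B_linear[OF f B_diff[OF T[OF f] h], of 1 "- complex_of_real (1 / C)"] by (simp add: \<Phi>_def)
    have con: "dB (\<Phi> f) (\<Phi> g) \<le> (\<kappa> / C) * dB f g" if f: "f \<in> B" and g: "g \<in> B" for f g
    proof -
      define k where "k = (\<lambda>y. f y - g y)"
      have k: "k \<in> B" unfolding k_def by (rule B_diff[OF f g])
      have Tk: "T k = (\<lambda>y. T f y - T g y)" unfolding k_def by (rule lin[OF f g])
      have m: "(\<lambda>y. T k y - complex_of_real C * k y) \<in> L"
        by (intro Lp_diff(1) Lp_scale(1) B_in_L T k p)
      have "(\<lambda>y. \<Phi> f y - \<Phi> g y) = (\<lambda>y. complex_of_real (- 1 / C) * (T k y - complex_of_real C * k y))"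
      proof
        fix y
        have "T k y = T f y - T g y" by (rule fun_cong[OF Tk])
        moreover have "k y = f y - g y" by (simp add: k_def)
        ultimately show "\<Phi> f y - \<Phi> g y = complex_of_real (- 1 / C) * (T k y - complex_of_real C * k y)"
        proof -
          define c where "c = complex_of_real (1 / C)"
          have c1: "c * complex_of_real C = 1" using C_pos by (simp add: c_def)
          have c2: "complex_of_real (- 1 / C) = - c" by (simp add: c_def)
          assume e: "T k y = T f y - T g y" "k y = f y - g y"
          have "\<Phi> f y - \<Phi> g y = (f y - g y) - c * (T f y - T g y)"
            unfolding \<Phi>_def c_def[symmetric] by (simp add: algebra_simps)
          also have "\<dots> = (c * complex_of_real C) * k y - c * T k y" unfolding e c1 by simp
          also have "\<dots> = - c * (T k y - complex_of_real C * k y)" by (simp add: right_diff_distrib mult.assoc)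
          finally show ?thesis unfolding c2 .
        qed
      qed
      then have "dB (\<Phi> f) (\<Phi> g) \<le> 1 / C * nrm (\<lambda>y. T k y - complex_of_real C * k y)"
        unfolding dB_def using Lp_scale(2)[OF m p, of "complex_of_real (- 1 / C)"] C_pos by (simp add: norm_divide)
      also have "\<dots> \<le> 1 / C * (\<kappa> * nrm k)" using near[OF k] C_pos by (intro mult_left_mono) simp_all
      finally show ?thesis by (simp add: dB_def k_def)
    qed
    have "\<kappa> / C < 1" using \<kappa> C_pos by simp
    moreover have "\<Phi> \<in> B \<rightarrow> B" using \<Phi>B by blast
    moreover have "B \<noteq> {}" using h by blast
    ultimately obtain f where f: "f \<in> B" "\<Phi> f = f"
      using metB.Banach_fixedpoint_thm[OF metB_complete, of \<Phi> "\<kappa> / C"] con by metis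
    have "T f y = h y" for y
      using fun_cong[OF f(2), of y] C_pos by (simp add: \<Phi>_def)
    then show ?thesis using f(1) by blast
  qed
  have bij: "bij_betw T B B"
    unfolding bij_betw_def using inj T surj by (auto simp: image_iff)
  have "Lp_continuous_on p r B (inv_into B T)"
    unfolding Lp_continuous_on_def
  proof (intro ballI allI impI)
    fix f and e :: real assume f: "f \<in> B" and e: "e > 0"
    have inv: "inv_into B T h \<in> B" "T (inv_into B T h) = h" if "h \<in> B" for h
      using bij that by (auto simp: bij_betw_def inv_into_into f_inv_into_f)
    show "\<exists>\<delta>>0. \<forall>g\<in>B. nrm (\<lambda>y. g y - f y) < \<delta> \<longrightarrow> nrm (\<lambda>y. inv_into B T g y - inv_into B T f y) < e"
    proof (intro exI[of _ "(C - \<kappa>) * e"] conjI ballI impI)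
      show "(C - \<kappa>) * e > 0" using \<kappa>C e by simp
      fix g assume g: "g \<in> B" and lt: "nrm (\<lambda>y. g y - f y) < (C - \<kappa>) * e"
      have "(C - \<kappa>) * nrm (\<lambda>y. inv_into B T g y - inv_into B T f y) \<le> nrm (\<lambda>y. g y - f y)"
        using lower[OF inv(1)[OF g] inv(1)[OF f]] by (simp only: inv(2)[OF g] inv(2)[OF f])
      also note lt
      finally show "nrm (\<lambda>y. inv_into B T g y - inv_into B T f y) < e" using \<kappa>C by simp
    qed
  qed
  then show ?thesis unfolding continuously_invertible_def using bij by blast
qed

end

section \<open>Discretised convolution operators\<close>

lemma Lp_has_sum_cong:
  assumes "\<And>i y. i \<in> I \<Longrightarrow> y \<in> carrier G \<Longrightarrow> t i y = t' i y"
    and sum: "Lp_has_sum p r t' g I"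
  shows "Lp_has_sum p r t g I"
  unfolding Lp_has_sum_def
proof (intro conjI ballI)
  fix i assume i: "i \<in> I"
  then have "t' i \<in> Lp_space p r" using sum by (simp add: Lp_has_sum_def)
  then show "t i \<in> Lp_space p r" using Lp_cong(2)[of "t i" "t' i"] assms(1)[OF i] by blast
next
  show "g \<in> Lp_space p r" using sum by (simp add: Lp_has_sum_def)
  have "eventually (\<lambda>F. Lp_norm p r (\<lambda>y. (\<Sum>i\<in>F. t' i y) - g y) = Lp_norm p r (\<lambda>y. (\<Sum>i\<in>F. t i y) - g y)) (finite_subsets_at_top I)"
  proof (rule eventually_finite_subsets_at_top_weakI)
    fix F assume "F \<subseteq> I"
    then show "Lp_norm p r (\<lambda>y. (\<Sum>i\<in>F. t' i y) - g y) = Lp_norm p r (\<lambda>y. (\<Sum>i\<in>F. t i y) - g y)"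
      using assms(1) by (intro Lp_cong(1) arg_cong2[where f="(-)"] sum.cong) auto
  qed
  then show "((\<lambda>F. Lp_norm p r (\<lambda>y. (\<Sum>i\<in>F. t i y) - g y)) \<longlongrightarrow> 0) (finite_subsets_at_top I)"
    by (rule Lim_transform_eventually[rotated]) (use sum in \<open>simp add: Lp_has_sum_def\<close>)
qed

lemma indicator_finite_split:
  assumes "finite F" "disjoint_family_on E F" "x \<in> X"
  shows "(\<Sum>i\<in>F. indicator (E i) x) + indicator (X - (\<Union>i\<in>F. E i)) x = (1 :: 'b :: comm_ring_1)"
  unfolding indicator_UN_disjoint[OF assms(1,2), symmetric] using assms(3) by (auto simp: indicator_def)

context bounded_kernel
begin

lemma L_restrict:
  assumes "g \<in> L" "A \<in> sets haar"
  shows "(\<lambda>x. indicator A x * g x) \<in> L"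
proof (rule Lp_mono(1)[OF assms(1) p])
  have [measurable]: "g \<in> borel_measurable haar" using assms(1) by (rule L_measurable)
  have [measurable]: "A \<in> sets haar" by fact
  show "(\<lambda>x. indicator A x * g x) \<in> borel_measurable haar" by measurable
qed (simp add: indicator_def)

text \<open>
  The remainder over a finite set of cells is the same operator applied to the restriction of \<open>g\<close> to the other
  cells. Its norm is at most \<open>2 M\<close> times the norm of that restriction, which is the tail of a convergent series.
\<close>

lemma wconv_Lp_has_sum:
  fixes E :: "nat \<Rightarrow> (real \<times> real) set"
  assumes \<tau>: "node_map s \<tau>" and g: "g \<in> L"
    and E: "\<And>i. E i \<in> sets haar" "disjoint_family E" "(\<Union>i. E i) = carrier G"
  shows "Lp_has_sum p r (\<lambda>i. wconv s \<tau> (\<lambda>x. indicator (E i) x * g x)) (wconv s \<tau> g) UNIV"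
proof -
  let ?fin = "finite_subsets_at_top (UNIV :: nat set)"
  define gA where "gA A = (\<lambda>x. indicator A x * g x)" for A :: "(real \<times> real) set"
  have gA: "gA A \<in> L" if "A \<in> sets haar" for A
    unfolding gA_def by (rule L_restrict[OF g that])
  define \<rho> where "\<rho> x = cmod (g x * weight r x) powr p" for x
  have \<rho>0: "\<rho> x \<ge> 0" for x by (simp add: \<rho>_def)
  have \<rho>_int: "integrable haar \<rho>" using g unfolding \<rho>_def by (simp add: Lp_space_def)
  define a where "a A = (LINT x|haar. indicator A x * \<rho> x)" for A :: "(real \<times> real) set"
  have a_int: "integrable haar (\<lambda>x. indicator A x * \<rho> x)" if "A \<in> sets haar" for A
    using integrable_mult_indicator[OF that \<rho>_int] by simp
  have a0: "a A \<ge> 0" for A unfolding a_def by (rule integral_nonneg_AE) (simp add: \<rho>0)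
  have nrm_gA: "nrm (gA A) = a A powr (1 / p)" for A
  proof -
    have "cmod (gA A x * weight r x) powr p = indicator A x * \<rho> x" for x
      using p by (simp add: gA_def \<rho>_def indicator_def)
    then show ?thesis by (simp add: Lp_norm_def a_def)
  qed
  define R where "R F = carrier G - (\<Union>i\<in>F. E i)" for F
  have sets_UF: "(\<Union>i\<in>F. E i) \<in> sets haar" if "finite F" for F using that E(1) by (intro sets.finite_UN) auto
  have sets_R: "R F \<in> sets haar" if "finite F" for F
    unfolding R_def using sets.compl_sets[OF sets_UF[OF that]] by simp
  have disj: "disjoint_family_on E F" for F using E(2) by (rule disjoint_family_on_mono[rotated]) simp
  note ind_split = indicator_finite_split[OF _ disj, where X = "carrier G", folded R_def]
  have aR: "a (R F) = (LINT x|haar. \<rho> x) - (\<Sum>i\<in>F. a (E i))" if F: "finite F" for F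
  proof -
    have "(LINT x|haar. \<rho> x) = (LINT x|haar. (\<Sum>i\<in>F. indicator (E i) x * \<rho> x) + indicator (R F) x * \<rho> x)"
      using ind_split[OF F, where 'b=real]
      by (intro Bochner_Integration.integral_cong[OF refl]) (simp flip: sum_distrib_right distrib_right)
    also have "\<dots> = (\<Sum>i\<in>F. a (E i)) + a (R F)"
      unfolding a_def using a_int E(1) sets_R[OF F] by (subst Bochner_Integration.integral_add) auto
    finally show ?thesis by simp
  qed
  have diff: "(\<Sum>i\<in>F. wconv s \<tau> (gA (E i)) y) - wconv s \<tau> g y = - wconv s \<tau> (gA (R F)) y"
    if F: "finite F" and y: "y \<in> carrier G" for F y
  proof -
    note int = wconv_integrand(1)[OF \<tau> gA y]
    have "wconv s \<tau> g y = (LINT x|haar. (\<Sum>i\<in>F. gA (E i) x * W s (ginv (\<tau> x) \<cdot> y)) + gA (R F) x * W s (ginv (\<tau> x) \<cdot> y))"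
      unfolding wconv_def gA_def using y ind_split[OF F, where 'b=complex]
      by (auto intro!: Bochner_Integration.integral_cong simp flip: sum_distrib_right distrib_right)
    also have "\<dots> = (\<Sum>i\<in>F. wconv s \<tau> (gA (E i)) y) + wconv s \<tau> (gA (R F)) y"
      unfolding wconv_def using y int E(1) sets_R[OF F] by (subst Bochner_Integration.integral_add) auto
    finally show ?thesis by simp
  qed
  have "summable (\<lambda>i. a (E i))"
  proof (rule bounded_imp_summable)
    show "(\<Sum>k\<le>n. a (E k)) \<le> (LINT x|haar. \<rho> x)" for n
      using aR[of "{..n}"] a0[of "R {..n}"] by simp
  qed (rule a0)
  moreover have "(LINT x|haar. \<rho> x) = (\<Sum>i. a (E i))"
  proof -
    have "set_integrable haar (\<Union>i. E i) \<rho>"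
      unfolding set_integrable_def E(3) using integrable_mult_indicator[OF _ \<rho>_int, of "carrier G"] sets.top[of haar] by simp
    then have "(LINT x:(\<Union>i. E i)|haar. \<rho> x) = (\<Sum>i. LINT x:E i|haar. \<rho> x)"
      using E(2) by (intro lebesgue_integral_countable_add E(1)) (auto simp: disjoint_family_on_def)
    moreover have "(LINT x:(\<Union>i. E i)|haar. \<rho> x) = (LINT x|haar. \<rho> x)"
      unfolding set_lebesgue_integral_def E(3) by (intro Bochner_Integration.integral_cong) simp_all
    ultimately show ?thesis by (simp add: set_lebesgue_integral_def a_def)
  qed
  ultimately have sums: "(\<lambda>i. a (E i)) sums (LINT x|haar. \<rho> x)" by (simp add: summable_sums)
  have "((\<lambda>i. a (E i)) has_sum (LINT x|haar. \<rho> x)) UNIV"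
    by (rule norm_summable_imp_has_sum[OF _ sums]) (use sums a0 in \<open>simp add: sums_iff\<close>)
  then have "((\<lambda>F. \<Sum>i\<in>F. a (E i)) \<longlongrightarrow> (LINT x|haar. \<rho> x)) (?fin)"
    by (simp add: has_sum_def)
  then have "((\<lambda>F. (LINT x|haar. \<rho> x) - (\<Sum>i\<in>F. a (E i))) \<longlongrightarrow> (LINT x|haar. \<rho> x) - (LINT x|haar. \<rho> x)) (?fin)"
    by (intro tendsto_diff tendsto_const)
  then have "((\<lambda>F. (LINT x|haar. \<rho> x) - (\<Sum>i\<in>F. a (E i))) \<longlongrightarrow> 0) (?fin)" by simp
  then have "((\<lambda>F. a (R F)) \<longlongrightarrow> 0) (?fin)"
    by (rule Lim_transform_eventually) (intro eventually_finite_subsets_at_top_weakI aR[symmetric])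
  then have "((\<lambda>F. a (R F) powr (1 / p)) \<longlongrightarrow> 0 powr (1 / p)) (?fin)"
    using p a0 by (intro tendsto_powr') (auto intro!: tendsto_const eventually_finite_subsets_at_top_weakI)
  then have "((\<lambda>F. 2 * M * a (R F) powr (1 / p)) \<longlongrightarrow> 2 * M * 0) (?fin)"
    using p by (intro tendsto_mult tendsto_const) simp
  then have lim: "((\<lambda>F. 2 * M * a (R F) powr (1 / p)) \<longlongrightarrow> 0) (?fin)" by simp
  have "((\<lambda>F. nrm (\<lambda>y. (\<Sum>i\<in>F. wconv s \<tau> (gA (E i)) y) - wconv s \<tau> g y)) \<longlongrightarrow> 0) (?fin)"
  proof (rule tendsto_sandwich[OF _ _ tendsto_const lim])
    show "\<forall>\<^sub>F F in ?fin. nrm (\<lambda>y. (\<Sum>i\<in>F. wconv s \<tau> (gA (E i)) y) - wconv s \<tau> g y) \<le> 2 * M * a (R F) powr (1 / p)"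
    proof (rule eventually_finite_subsets_at_top_weakI)
      fix F :: "nat set" assume F: "finite F"
      have "nrm (\<lambda>y. (\<Sum>i\<in>F. wconv s \<tau> (gA (E i)) y) - wconv s \<tau> g y) = nrm (\<lambda>y. - wconv s \<tau> (gA (R F)) y)"
        by (rule Lp_cong(1)) (rule diff[OF F])
      also have "\<dots> = nrm (wconv s \<tau> (gA (R F)))" by (simp add: Lp_norm_def)
      also have "\<dots> \<le> 2 * M * nrm (gA (R F))" by (rule wconv_in_L(2)[OF \<tau> gA[OF sets_R[OF F]]])
      finally show "nrm (\<lambda>y. (\<Sum>i\<in>F. wconv s \<tau> (gA (E i)) y) - wconv s \<tau> g y) \<le> 2 * M * a (R F) powr (1 / p)"
        by (simp add: nrm_gA)
    qed
  qed (simp add: Lp_norm_nonneg)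
  then show ?thesis
    unfolding Lp_has_sum_def gA_def using wconv_in_L(1)[OF \<tau> g] wconv_in_L(1)[OF \<tau> L_restrict[OF g E(1)]] by simp
qed

text \<open>
  The three operators of the theorem are instances, with \<open>\<gamma> f\<close> being \<open>f\<close> or its samples, and \<open>\<tau>\<close> being the
  identity or the map to the nodes. The difference to \<open>C f = f * W\<close> is dominated pointwise by the positive kernel
  operator applied to a small multiple of \<open>\<bar>f\<bar> + absK s f\<close>.
\<close>

lemma sampled_operator:
  fixes E :: "nat \<Rightarrow> (real \<times> real) set"
  assumes \<tau>: "node_map s \<tau>"
    and \<tau>_near: "\<And>x y. x \<in> carrier G \<Longrightarrow> y \<in> carrier G \<Longrightarrow>
      cmod (W s (ginv (\<tau> x) \<cdot> y) - W s (ginv x \<cdot> y)) \<le> \<delta>2 * kern s x y"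
    and \<gamma>m: "\<And>f. f \<in> B \<Longrightarrow> \<gamma> f \<in> borel_measurable haar"
    and \<gamma>lin: "\<And>f g x. \<gamma> (\<lambda>y. f y - g y) x = \<gamma> f x - \<gamma> g x"
    and \<gamma>_near: "\<And>f x. f \<in> B \<Longrightarrow> x \<in> carrier G \<Longrightarrow> cmod (\<gamma> f x - f x) \<le> \<delta>1 * absK s f x"
    and \<delta>: "\<delta>1 \<ge> 0" "\<delta>2 \<ge> 0" "M * (2 * \<delta>1 * M + \<delta>2) < C"
    and E: "\<And>i. E i \<in> sets haar" "disjoint_family E" "(\<Union>i. E i) = carrier G"
    and t: "\<And>f i y. f \<in> B \<Longrightarrow> y \<in> carrier G \<Longrightarrow> t f i y = wconv s \<tau> (\<lambda>x. indicator (E i) x * \<gamma> f x) y"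
  shows "\<exists>T. sum_operator p r UNIV B t T \<and> continuously_invertible p r B T"
proof -
  define T where "T f = wconv s \<tau> (\<gamma> f)" for f
  have \<gamma>L: "\<gamma> f \<in> L" if f: "f \<in> B" for f
  proof -
    have fL: "f \<in> L" by (rule B_in_L[OF f])
    have bd: "(\<lambda>x. complex_of_real \<delta>1 * complex_of_real (absK s f x)) \<in> L"
      by (rule Lp_scale(1)[OF absK_Lp[OF fL] p])
    have "(\<lambda>x. \<gamma> f x - f x) \<in> L"
    proof (rule Lp_mono(1)[OF bd p])
      show "(\<lambda>x. \<gamma> f x - f x) \<in> borel_measurable haar" using \<gamma>m[OF f] L_measurable[OF fL] by simp
      show "cmod (\<gamma> f x - f x) \<le> cmod (complex_of_real \<delta>1 * complex_of_real (absK s f x))" if "x \<in> carrier G" for x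
        using \<gamma>_near[OF f that] \<delta>(1) by (simp add: norm_mult absK_nonneg)
    qed
    from Lp_add(1)[OF this fL p] show ?thesis by simp
  qed
  have sum: "sum_operator p r UNIV B t T"
    unfolding sum_operator_def
  proof (intro ballI conjI)
    fix f assume f: "f \<in> B"
    show "T f \<in> B" unfolding T_def by (rule wconv_in_B[OF \<tau> \<gamma>L[OF f]])
    show "Lp_has_sum p r (t f) (T f) UNIV" unfolding T_def
      by (rule Lp_has_sum_cong[OF _ wconv_Lp_has_sum[OF \<tau> \<gamma>L[OF f] E]]) (rule t[OF f])
  qed
  have "continuously_invertible p r B T"
  proof (rule near_multiple_invertible)
    show "T f \<in> B" if "f \<in> B" for f unfolding T_def by (rule wconv_in_B[OF \<tau> \<gamma>L[OF that]])
    show "T (\<lambda>y. f y - g y) = (\<lambda>y. T f y - T g y)" if f: "f \<in> B" and g: "g \<in> B" for f g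
    proof
      fix y
      show "T (\<lambda>y. f y - g y) y = T f y - T g y"
        using wconv_integrand(1)[OF \<tau> \<gamma>L[OF f], of y] wconv_integrand(1)[OF \<tau> \<gamma>L[OF g], of y]
        by (simp add: T_def wconv_def \<gamma>lin left_diff_distrib)
    qed
    show "M * (2 * \<delta>1 * M + \<delta>2) < C" by fact
    fix f assume f: "f \<in> B"
    have fL: "f \<in> L" by (rule B_in_L[OF f])
    define H where "H x = complex_of_real (2 * \<delta>1) * complex_of_real (absK s f x) + complex_of_real \<delta>2 * complex_of_real (cmod (f x))" for x
    note H1 = Lp_scale[OF absK_Lp[OF fL] p, of "complex_of_real (2 * \<delta>1)"]
    note H2 = Lp_scale[OF Lp_cmod(1)[OF fL p] p, of "complex_of_real \<delta>2"]
    have HL: "H \<in> L" unfolding H_def by (rule Lp_add(1)[OF H1(1) H2(1) p])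
    have "nrm H \<le> nrm (\<lambda>x. complex_of_real (2 * \<delta>1) * complex_of_real (absK s f x)) + nrm (\<lambda>x. complex_of_real \<delta>2 * complex_of_real (cmod (f x)))"
      unfolding H_def by (rule Lp_add(2)[OF H1(1) H2(1) p])
    also have "\<dots> \<le> 2 * \<delta>1 * nrm (\<lambda>x. complex_of_real (absK s f x)) + \<delta>2 * nrm f"
      using H1(2) H2(2) \<delta> unfolding Lp_cmod(2)[OF fL p] by simp
    also have "\<dots> \<le> 2 * \<delta>1 * (M * nrm f) + \<delta>2 * nrm f"
      using absK_norm[OF fL] \<delta>(1) by (intro add_right_mono mult_left_mono) simp_all
    finally have Hn: "nrm H \<le> (2 * \<delta>1 * M + \<delta>2) * nrm f"
      by (simp only: distrib_right mult.assoc)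
    have Hval: "H x = complex_of_real (2 * \<delta>1 * absK s f x + \<delta>2 * cmod (f x))" for x by (simp add: H_def)
    have cH: "cmod (H x) = 2 * \<delta>1 * absK s f x + \<delta>2 * cmod (f x)" for x
      unfolding Hval norm_of_real using \<delta> absK_nonneg[of s f x] by simp
    have ptw: "cmod (T f y - complex_of_real C * f y) \<le> absK s H y" if y: "y \<in> carrier G" for y
    proof -
      note i1 = wconv_integrand(1)[OF \<tau> \<gamma>L[OF f] y]
      note i2 = wconv_integrand(1)[OF node_map_id fL y]
      define D where "D x = \<gamma> f x * W s (ginv (\<tau> x) \<cdot> y) - f x * W s (ginv x \<cdot> y)" for x
      have iD: "integrable haar D" unfolding D_def using i1 i2 by simp
      have "complex_of_real C * f y = conv f (W s) y" using f y by (simp add: conv_space_iff)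
      then have "T f y - complex_of_real C * f y = (LINT x|haar. D x)"
        unfolding D_def T_def wconv_def conv_def using y i1 i2 by simp
      then have "ennreal (cmod (T f y - complex_of_real C * f y)) \<le> (\<integral>\<^sup>+x. ennreal (cmod (D x)) \<partial>haar)"
        using integral_norm_bound_ennreal[OF iD] by simp
      also have "\<dots> \<le> KF s (\<lambda>x. cmod (H x)) y"
        unfolding KF_def
      proof (rule nn_integral_mono)
        fix x assume "x \<in> space haar"
        then have x: "x \<in> carrier G" by simp
        have k: "kern s (\<tau> x) y \<le> 2 * kern s x y" using \<tau> x y by (simp add: node_map_def)
        have "D x = (\<gamma> f x - f x) * W s (ginv (\<tau> x) \<cdot> y) + f x * (W s (ginv (\<tau> x) \<cdot> y) - W s (ginv x \<cdot> y))"
          by (simp add: D_def algebra_simps)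
        then have "cmod (D x) \<le> cmod (\<gamma> f x - f x) * kern s (\<tau> x) y + cmod (f x) * cmod (W s (ginv (\<tau> x) \<cdot> y) - W s (ginv x \<cdot> y))"
          unfolding norm_mult[symmetric] by (simp only: norm_triangle_ineq)
        also have "\<dots> \<le> (\<delta>1 * absK s f x) * (2 * kern s x y) + cmod (f x) * (\<delta>2 * kern s x y)"
          using \<gamma>_near[OF f x] \<tau>_near[OF x y] k \<delta> absK_nonneg[of s f x]
          by (intro add_mono mult_mono mult_left_mono) simp_all
        also have "\<dots> = cmod (H x) * kern s x y" unfolding cH by (simp add: algebra_simps)
        finally have "ennreal (cmod (D x)) \<le> ennreal (cmod (H x) * kern s x y)" by (rule ennreal_leI)
        then show "ennreal (cmod (D x)) \<le> ennreal (cmod (H x)) * ennreal (kern s x y)" by (simp add: ennreal_mult)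
      qed
      also have "\<dots> = ennreal (absK s H y)" by (rule KF_eq_absK[OF HL y])
      finally show ?thesis by (simp add: ennreal_le_iff absK_nonneg)
    qed
    have "nrm (\<lambda>y. T f y - complex_of_real C * f y) \<le> nrm (\<lambda>y. complex_of_real (absK s H y))"
    proof (rule Lp_mono(2)[OF absK_Lp[OF HL] p])
      show "(\<lambda>y. T f y - complex_of_real C * f y) \<in> borel_measurable haar"
        unfolding T_def using L_measurable[OF fL] wconv_measurable[OF \<tau> \<gamma>L[OF f]] by simp
      show "cmod (T f y - complex_of_real C * f y) \<le> cmod (complex_of_real (absK s H y))" if "y \<in> carrier G" for y
        using ptw[OF that] by (simp add: absK_nonneg)
    qed
    also have "\<dots> \<le> M * nrm H" by (rule absK_norm[OF HL])
    also have "\<dots> \<le> M * ((2 * \<delta>1 * M + \<delta>2) * nrm f)" using Hn M by (intro mult_left_mono) simp_all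
    finally show "nrm (\<lambda>y. T f y - complex_of_real C * f y) \<le> M * (2 * \<delta>1 * M + \<delta>2) * nrm f"
      by (simp only: mult.assoc)
  qed
  then show ?thesis using sum by blast
qed

text \<open>
  The reproducing formula transfers the uniform relative oscillation of the kernel to every function of the space.
\<close>

lemma B_oscillation:
  assumes osc: "\<And>u z. u \<in> U \<Longrightarrow> z \<in> carrier G \<Longrightarrow> cmod (W s (z \<cdot> u) - W s z) \<le> \<epsilon> * cmod (W s z)"
    and \<epsilon>: "0 \<le> \<epsilon>" "\<epsilon> \<le> 1 / 2"
    and q: "q \<in> carrier G" and x: "x \<in> carrier G" "ginv q \<cdot> x \<in> U" and f: "f \<in> B"
  shows "cmod (f q - f x) \<le> 2 * \<epsilon> / C * absK s f x"
proof -
  interpret group G by (rule group_G)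
  have fL: "f \<in> L" by (rule B_in_L[OF f])
  note i1 = wconv_integrand(1)[OF node_map_id fL q]
  note i2 = wconv_integrand(1)[OF node_map_id fL x(1)]
  define D where "D v = f v * W s (ginv v \<cdot> q) - f v * W s (ginv v \<cdot> x)" for v
  have iD: "integrable haar D" unfolding D_def using i1 i2 by simp
  have fm: "(\<lambda>v. cmod (f v)) \<in> borel_measurable haar" using L_measurable[OF fL] by simp
  have "complex_of_real C * f q = conv f (W s) q" "complex_of_real C * f x = conv f (W s) x"
    using f q x by (simp_all add: conv_space_iff)
  then have "complex_of_real C * (f q - f x) = (LINT v|haar. D v)"
    unfolding D_def conv_def using q x i1 i2 by (simp add: right_diff_distrib)
  then have "ennreal (cmod (complex_of_real C * (f q - f x))) \<le> (\<integral>\<^sup>+v. ennreal (cmod (D v)) \<partial>haar)"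
    using integral_norm_bound_ennreal[OF iD] by simp
  also have "\<dots> \<le> (\<integral>\<^sup>+v. ennreal (2 * \<epsilon>) * (ennreal (cmod (f v)) * ennreal (kern s v x)) \<partial>haar)"
  proof (rule nn_integral_mono)
    fix v assume "v \<in> space haar"
    then have v: "v \<in> carrier G" by simp
    have eq: "ginv v \<cdot> q \<cdot> (ginv q \<cdot> x) = ginv v \<cdot> x"
      using x(1) q v by (metis G_closed(1) G_closed(2) inv_closed m_assoc r_inv r_one l_one)
    have z: "ginv v \<cdot> q \<in> carrier G" using v q by simp
    have d: "cmod (W s (ginv v \<cdot> x) - W s (ginv v \<cdot> q)) \<le> \<epsilon> * kern s v q"
      using osc[OF x(2) z] unfolding eq .
    have "\<epsilon> * kern s v q \<le> 1 / 2 * kern s v q" using \<epsilon> by (intro mult_right_mono) simp_all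
    then have "kern s v q \<le> 2 * kern s v x"
      using d norm_triangle_ineq2[of "W s (ginv v \<cdot> q)" "W s (ginv v \<cdot> x)"] by (simp add: norm_minus_commute)
    then have "\<epsilon> * kern s v q \<le> \<epsilon> * (2 * kern s v x)" using \<epsilon> by (intro mult_left_mono)
    then have "cmod (f v) * cmod (W s (ginv v \<cdot> q) - W s (ginv v \<cdot> x)) \<le> cmod (f v) * (\<epsilon> * (2 * kern s v x))"
      using d by (intro mult_left_mono) (simp_all add: norm_minus_commute)
    then have "cmod (D v) \<le> 2 * \<epsilon> * (cmod (f v) * kern s v x)"
      unfolding D_def right_diff_distrib[symmetric] norm_mult by (simp only: mult_ac)
    then have "ennreal (cmod (D v)) \<le> ennreal (2 * \<epsilon> * (cmod (f v) * kern s v x))" by (rule ennreal_leI)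
    then show "ennreal (cmod (D v)) \<le> ennreal (2 * \<epsilon>) * (ennreal (cmod (f v)) * ennreal (kern s v x))"
      using \<epsilon> by (simp add: ennreal_mult)
  qed
  also have "\<dots> = ennreal (2 * \<epsilon>) * KF s (\<lambda>v. cmod (f v)) x"
    unfolding KF_def by (rule nn_integral_cmult[OF measurable_KF_integrand[OF fm x(1)]])
  also have "\<dots> = ennreal (2 * \<epsilon> * absK s f x)"
    unfolding KF_eq_absK[OF fL x(1)] using \<epsilon> by (simp add: ennreal_mult absK_nonneg)
  finally have "C * cmod (f q - f x) \<le> 2 * \<epsilon> * absK s f x"
    using \<epsilon> C_pos by (simp add: ennreal_le_iff absK_nonneg norm_mult)
  then show ?thesis using C_pos by (simp add: pos_le_divide_eq mult.commute)
qed

end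

section \<open>Choice of the nodes\<close>

lemma mem_l_coset_iff:
  assumes "x \<in> carrier G" "y \<in> carrier G" "U \<subseteq> carrier G"
  shows "y \<in> x <#\<^bsub>G\<^esub> U \<longleftrightarrow> ginv x \<cdot> y \<in> U"
proof -
  interpret group G by (rule group_G)
  show ?thesis
  proof
    assume "y \<in> x <#\<^bsub>G\<^esub> U"
    then obtain u where "u \<in> U" "y = x \<cdot> u" by (auto simp: l_coset_def)
    then show "ginv x \<cdot> y \<in> U" using assms by (auto simp: m_assoc[symmetric])
  next
    assume u: "ginv x \<cdot> y \<in> U"
    have "y = x \<cdot> (ginv x \<cdot> y)" using assms by (simp add: m_assoc[symmetric])
    then show "y \<in> x <#\<^bsub>G\<^esub> U" using u unfolding l_coset_def by blast
  qed
qed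

lemma compact_l_coset:
  assumes x: "x \<in> carrier G" and U: "compact U" "U \<subseteq> carrier G"
  shows "compact (x <#\<^bsub>G\<^esub> U)"
proof -
  have "x <#\<^bsub>G\<^esub> U = (\<lambda>u. x \<cdot> u) ` U" by (auto simp: l_coset_def)
  moreover have "continuous_on U (\<lambda>u. x \<cdot> u)"
    unfolding gmult_eq using U(2) by (intro continuous_intros) (auto simp: carrier_G)
  ultimately show ?thesis using U(1) compact_continuous_image by metis
qed

text \<open>
  A countable dense set works: the nodes whose translate of the interior of \<open>U\<close> contains \<open>y\<close> form a nonempty
  open set.
\<close>

lemma ex_U_dense_sequence:
  assumes U: "compact_nhd_one U"
  obtains x :: "nat \<Rightarrow> real \<times> real" where "U_dense U UNIV x"
proof -
  interpret group G by (rule group_G)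
  have UG: "U \<subseteq> carrier G" and one: "\<one>\<^bsub>G\<^esub> \<in> interior U" using U by (auto simp: compact_nhd_one_def)
  obtain D :: "(real \<times> real) set" where D: "countable D" "\<And>X. open X \<Longrightarrow> X \<noteq> {} \<Longrightarrow> \<exists>d\<in>D. d \<in> X"
    by (rule countable_dense_setE) blast
  define D' where "D' = D \<inter> carrier G"
  have cD': "countable D'" using D(1) by (simp add: D'_def)
  have hit: "\<exists>d\<in>D'. ginv d \<cdot> y \<in> U" if y: "y \<in> carrier G" for y
  proof -
    define X where "X = (\<lambda>d. (inverse (fst d) * fst y, inverse (fst d) * snd y - snd d * inverse (fst y))) -` interior U \<inter> carrier G"
    have "open X" unfolding X_def
      using y by (intro continuous_on_open_vimage[THEN iffD1, rule_format] open_carrier_G open_interior continuous_intros)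
        (auto simp: carrier_G)
    moreover have "y \<in> X"
      using one y by (auto simp: X_def G_def carrier_G)
    ultimately obtain d where d: "d \<in> D" "d \<in> X" using D(2) by blast
    then have "ginv d \<cdot> y \<in> interior U" by (auto simp: X_def gquot_eq)
    then show ?thesis using d interior_subset[of U] by (auto simp: D'_def X_def)
  qed
  have "D' \<noteq> {}" using hit[of "\<one>\<^bsub>G\<^esub>"] by auto
  define x where "x = from_nat_into D'"
  have ran: "range x = D'" unfolding x_def using cD' \<open>D' \<noteq> {}\<close> by (rule range_from_nat_into[rotated])
  have xG: "x i \<in> carrier G" for i using ran by (auto simp: D'_def)
  have "(\<Union>i. x i <#\<^bsub>G\<^esub> U) = carrier G"
  proof
    show "(\<Union>i. x i <#\<^bsub>G\<^esub> U) \<subseteq> carrier G" using xG UG by (auto simp: l_coset_def)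
    show "carrier G \<subseteq> (\<Union>i. x i <#\<^bsub>G\<^esub> U)"
    proof
      fix y assume y: "y \<in> carrier G"
      obtain d where "d \<in> D'" "ginv d \<cdot> y \<in> U" using hit[OF y] by blast
      moreover from this ran obtain i where "d = x i" by auto
      ultimately show "y \<in> (\<Union>i. x i <#\<^bsub>G\<^esub> U)" using mem_l_coset_iff[OF xG y UG] by auto
    qed
  qed
  then show ?thesis using xG by (intro that[of x]) (auto simp: U_dense_def)
qed

theorem proposition4p10:
  fixes s r p :: real
  assumes "s > 1" and "r \<ge> 0" and "1 \<le> p" and "2 - s < r + 2 / p" and "r + 2 / p < s"
  shows "\<exists>(U :: (real \<times> real) set) (I :: nat set) (x :: nat \<Rightarrow> real \<times> real)
            (\<psi> :: nat \<Rightarrow> real \<times> real \<Rightarrow> real).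
     compact_nhd_one U \<and> U_dense U I x \<and> partition_of_unity I \<psi> \<and>
     (\<forall>i\<in>I. supp (\<psi> i) \<subseteq> x i <#\<^bsub>G\<^esub> U) \<and>
     (\<exists>T1 T2 T3.
        sum_operator p r I (conv_space p r s)
          (\<lambda>f i y. f (x i) * conv (\<lambda>z. complex_of_real (\<psi> i z)) (W s) y) T1 \<and>
        sum_operator p r I (conv_space p r s)
          (\<lambda>f i y. complex_of_real (LINT z|haar. \<psi> i z) * f (x i) * ltrans (x i) (W s) y) T2 \<and>
        sum_operator p r I (conv_space p r s)
          (\<lambda>f i y. (LINT z|haar. f z * complex_of_real (\<psi> i z)) * ltrans (x i) (W s) y) T3 \<and>
        continuously_invertible p r (conv_space p r s) T1 \<and>
        continuously_invertible p r (conv_space p r s) T2 \<and>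
        continuously_invertible p r (conv_space p r s) T3)"
proof -
  obtain M where M: "M > 0"
    "\<And>f y. f \<in> Lp_space p r \<Longrightarrow> y \<in> carrier G \<Longrightarrow> KF s (\<lambda>x. cmod (f x)) y < \<infinity>"
    "\<And>f. f \<in> Lp_space p r \<Longrightarrow> (\<lambda>y. complex_of_real (absK s f y)) \<in> Lp_space p r"
    "\<And>f. f \<in> Lp_space p r \<Longrightarrow> Lp_norm p r (\<lambda>y. complex_of_real (absK s f y)) \<le> M * Lp_norm p r f"
    by (rule Lp_absK[OF assms(1,3,4,5)]) blast
  interpret bounded_kernel s r p M
    by (unfold_locales) (use assms M in auto)
  interpret group G by (rule group_G)
  \<comment> \<open>The bound of the perturbation in all three cases is at most \<open>\<epsilon> M (4 M / C + 1)\<close>, which has to stay below \<open>C\<close>.\<close>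
  define \<epsilon> where "\<epsilon> = min (1 / 2) (C / (2 * (M * (4 * M / C + 1))))"
  have Q: "M * (4 * M / C + 1) > 0" using M(1) C_pos by (simp add: add_pos_pos)
  have \<epsilon>: "\<epsilon> > 0" "\<epsilon> \<le> 1 / 2"
  proof -
    have "C / (2 * (M * (4 * M / C + 1))) > 0" using Q C_pos by (intro divide_pos_pos) simp_all
    then show "\<epsilon> > 0" unfolding \<epsilon>_def by simp
    show "\<epsilon> \<le> 1 / 2" unfolding \<epsilon>_def by (rule min.cobounded1)
  qed
  have small: "M * (2 * (2 * \<epsilon> / C) * M + \<epsilon>) < C"
  proof -
    have "M * (2 * (2 * \<epsilon> / C) * M + \<epsilon>) = \<epsilon> * (M * (4 * M / C + 1))" by (simp add: algebra_simps)
    also have "\<dots> \<le> C / (2 * (M * (4 * M / C + 1))) * (M * (4 * M / C + 1))"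
      by (rule mult_right_mono) (use Q in \<open>simp_all add: \<epsilon>_def\<close>)
    also have "\<dots> = C / 2"
    proof -
      have "C / (2 * k) * k = C / 2" if "k > 0" for k using that by simp
      from this[OF Q] show ?thesis .
    qed
    also have "\<dots> < C" using C_pos by simp
    finally show ?thesis .
  qed
  have small': "M * (2 * 0 * M + \<epsilon>) < C" "M * (2 * (2 * \<epsilon> / C) * M + 0) < C"
  proof -
    have "M * \<epsilon> \<ge> 0" "M * (2 * (2 * \<epsilon> / C) * M) \<ge> 0" using M(1) \<epsilon> C_pos by simp_all
    then show "M * (2 * 0 * M + \<epsilon>) < C" "M * (2 * (2 * \<epsilon> / C) * M + 0) < C"
      using small by (simp_all add: distrib_left)
  qed
  obtain U where U: "compact_nhd_one U"
    and oscr: "\<And>u z. u \<in> U \<Longrightarrow> z \<in> carrier G \<Longrightarrow> cmod (W s (z \<cdot> u) - W s z) \<le> \<epsilon> * cmod (W s z)"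
    and oscl: "\<And>u z. u \<in> U \<Longrightarrow> z \<in> carrier G \<Longrightarrow> cmod (W s (u \<cdot> z) - W s z) \<le> \<epsilon> * cmod (W s z)"
    by (rule W_oscillation[OF \<epsilon>(1), of s]) blast
  have UG: "U \<subseteq> carrier G" and cU: "compact U" using U by (simp_all add: compact_nhd_one_def)
  obtain x :: "nat \<Rightarrow> real \<times> real" where x: "U_dense U UNIV x" by (rule ex_U_dense_sequence[OF U])
  have xG: "x i \<in> carrier G" for i using x by (auto simp: U_dense_def)
  \<comment> \<open>The first translate that contains a point determines its node, which makes the cells disjoint.\<close>
  define idx where "idx y = (LEAST j. ginv (x j) \<cdot> y \<in> U)" for y
  define E where "E i = {y \<in> carrier G. idx y = i}" for i
  define \<pi> where "\<pi> y = x (idx y)" for y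
  \<comment> \<open>The indicators of the cells form a partition of unity; some cells may be empty.\<close>
  define \<psi> :: "nat \<Rightarrow> real \<times> real \<Rightarrow> real" where "\<psi> i = indicator (E i)" for i
  have idx: "ginv (\<pi> y) \<cdot> y \<in> U" if y: "y \<in> carrier G" for y
  proof -
    obtain j where "y \<in> x j <#\<^bsub>G\<^esub> U" using x y by (auto simp: U_dense_def)
    then have "ginv (x j) \<cdot> y \<in> U" using mem_l_coset_iff[OF xG y UG] by simp
    then show ?thesis unfolding \<pi>_def idx_def by (rule LeastI)
  qed
  have Us: "U \<in> sets haar"
    using cU UG by (auto simp: sets_haar sets_restrict_space image_iff intro!: bexI[of _ U] borel_closed compact_imp_closed)
  have idx_m: "idx \<in> measurable haar (count_space UNIV)"
    unfolding idx_def
  proof (rule measurable_Least)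
    fix j
    note [measurable] = measurable_const_haar[OF xG[of j]] Us
    show "Measurable.pred haar (\<lambda>y. ginv (x j) \<cdot> y \<in> U)" by measurable
  qed
  have Es: "E i \<in> sets haar" for i
    using measurable_sets[OF idx_m, of "{i}"] by (simp add: E_def vimage_def Int_def conj_commute)
  have Ed: "disjoint_family E" by (auto simp: E_def disjoint_family_on_def)
  have EG: "(\<Union>i. E i) = carrier G" by (auto simp: E_def)
  have \<pi>_m: "\<pi> \<in> measurable haar haar"
    unfolding \<pi>_def by (rule measurable_compose[OF idx_m]) (use xG in simp)
  have \<pi>G: "\<pi> y \<in> carrier G" for y by (simp add: \<pi>_def xG)
  have \<pi>_near: "cmod (W s (ginv (\<pi> y) \<cdot> z) - W s (ginv y \<cdot> z)) \<le> \<epsilon> * kern s y z"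
    if y: "y \<in> carrier G" and z: "z \<in> carrier G" for y z
  proof -
    have "ginv (\<pi> y) \<cdot> y \<cdot> (ginv y \<cdot> z) = ginv (\<pi> y) \<cdot> z"
      using \<pi>G[of y] y z by (metis G_closed(1) G_closed(2) m_assoc r_inv r_one l_one)
    then show ?thesis using oscl[OF idx[OF y], of "ginv y \<cdot> z"] y z by simp
  qed
  have node: "node_map s \<pi>"
    unfolding node_map_def
  proof (intro conjI ballI \<pi>_m)
    fix y z assume y: "y \<in> carrier G" and z: "z \<in> carrier G"
    have "\<epsilon> * kern s y z \<le> 1 * kern s y z" using \<epsilon>(2) by (intro mult_right_mono) simp_all
    then show "kern s (\<pi> y) z \<le> 2 * kern s y z"
      using \<pi>_near[OF y z] norm_triangle_ineq2[of "W s (ginv (\<pi> y) \<cdot> z)" "W s (ginv y \<cdot> z)"] by simp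
  qed
  have samp: "cmod (f (\<pi> y) - f y) \<le> 2 * \<epsilon> / C * absK s f y" if "f \<in> B" "y \<in> carrier G" for f y
    by (rule B_oscillation[OF oscr less_imp_le[OF \<epsilon>(1)] \<epsilon>(2) \<pi>G that(2) idx[OF that(2)] that(1)])
  have fm: "f \<in> borel_measurable haar" if "f \<in> B" for f by (rule L_measurable[OF B_in_L[OF that]])
  have f\<pi>m: "(\<lambda>y. f (\<pi> y)) \<in> borel_measurable haar" if "f \<in> B" for f
    by (rule measurable_compose[OF \<pi>_m fm[OF that]])
  have d1: "2 * \<epsilon> / C \<ge> 0" using \<epsilon> C_pos by simp
  have \<pi>E: "\<pi> y = x i" if "y \<in> E i" for y i using that by (simp add: E_def \<pi>_def)
  have "\<exists>T1. sum_operator p r UNIV B (\<lambda>f i y. f (x i) * conv (\<lambda>z. complex_of_real (\<psi> i z)) (W s) y) T1 \<and>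
      continuously_invertible p r B T1"
  proof (rule sampled_operator[OF node_map_id, where \<gamma> = "\<lambda>f y. f (\<pi> y)" and ?\<delta>1.0 = "2 * \<epsilon> / C" and ?\<delta>2.0 = 0 and E = E])
    show "f (x i) * conv (\<lambda>z. complex_of_real (\<psi> i z)) (W s) y = wconv s (\<lambda>z. z) (\<lambda>z. indicator (E i) z * f (\<pi> z)) y"
      if "f \<in> B" "y \<in> carrier G" for f i y
    proof -
      have "f (x i) * conv (\<lambda>z. complex_of_real (\<psi> i z)) (W s) y =
          (LINT z|haar. f (x i) * (complex_of_real (\<psi> i z) * W s (ginv z \<cdot> y)))"
        using that by (simp add: conv_def)
      also have "\<dots> = (LINT z|haar. indicator (E i) z * f (\<pi> z) * W s (ginv z \<cdot> y))"
        by (intro Bochner_Integration.integral_cong) (auto simp: \<psi>_def indicator_def \<pi>E)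
      finally show ?thesis using that by (simp add: wconv_def)
    qed
  qed (use f\<pi>m samp d1 small'(2) Es Ed EG in auto)
  moreover have "\<exists>T2. sum_operator p r UNIV B
        (\<lambda>f i y. complex_of_real (LINT z|haar. \<psi> i z) * f (x i) * ltrans (x i) (W s) y) T2 \<and>
      continuously_invertible p r B T2"
  proof (rule sampled_operator[OF node, where \<gamma> = "\<lambda>f y. f (\<pi> y)" and ?\<delta>1.0 = "2 * \<epsilon> / C" and ?\<delta>2.0 = \<epsilon> and E = E])
    show "complex_of_real (LINT z|haar. \<psi> i z) * f (x i) * ltrans (x i) (W s) y = wconv s \<pi> (\<lambda>z. indicator (E i) z * f (\<pi> z)) y"
      if "f \<in> B" "y \<in> carrier G" for f i y
    proof -
      have "complex_of_real (LINT z|haar. \<psi> i z) * f (x i) * ltrans (x i) (W s) y =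
          (LINT z|haar. complex_of_real (\<psi> i z) * (f (x i) * W s (ginv (x i) \<cdot> y)))"
        by (simp add: ltrans_def mult.assoc)
      also have "\<dots> = (LINT z|haar. indicator (E i) z * f (\<pi> z) * W s (ginv (\<pi> z) \<cdot> y))"
        by (intro Bochner_Integration.integral_cong) (auto simp: \<psi>_def indicator_def \<pi>E)
      finally show ?thesis using that by (simp add: wconv_def)
    qed
  qed (use f\<pi>m samp d1 small \<pi>_near \<epsilon> Es Ed EG in auto)
  moreover have "\<exists>T3. sum_operator p r UNIV B
        (\<lambda>f i y. (LINT z|haar. f z * complex_of_real (\<psi> i z)) * ltrans (x i) (W s) y) T3 \<and>
      continuously_invertible p r B T3"
  proof (rule sampled_operator[OF node, where \<gamma> = "\<lambda>f. f" and ?\<delta>1.0 = 0 and ?\<delta>2.0 = \<epsilon> and E = E])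
    show "(LINT z|haar. f z * complex_of_real (\<psi> i z)) * ltrans (x i) (W s) y = wconv s \<pi> (\<lambda>z. indicator (E i) z * f z) y"
      if "f \<in> B" "y \<in> carrier G" for f i y
    proof -
      have "(LINT z|haar. f z * complex_of_real (\<psi> i z)) * ltrans (x i) (W s) y =
          (LINT z|haar. f z * complex_of_real (\<psi> i z) * W s (ginv (x i) \<cdot> y))"
        by (simp add: ltrans_def)
      also have "\<dots> = (LINT z|haar. indicator (E i) z * f z * W s (ginv (\<pi> z) \<cdot> y))"
        by (intro Bochner_Integration.integral_cong) (auto simp: \<psi>_def indicator_def \<pi>E)
      finally show ?thesis using that by (simp add: wconv_def)
    qed
  qed (use fm small'(1) \<pi>_near \<epsilon> Es Ed EG in auto)
  moreover have "partition_of_unity UNIV \<psi>"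
    unfolding partition_of_unity_def
  proof (intro conjI ballI)
    fix i show "\<psi> i \<in> borel_measurable haar" unfolding \<psi>_def using Es by simp
    fix y show "\<psi> i y \<ge> 0" by (simp add: \<psi>_def)
  next
    fix y assume y: "y \<in> carrier G"
    have "((\<lambda>i. \<psi> i y) has_sum 1) UNIV \<longleftrightarrow> ((\<lambda>i. \<psi> i y) has_sum 1) {idx y}"
      by (rule has_sum_cong_neutral) (auto simp: \<psi>_def E_def indicator_def)
    moreover have "((\<lambda>i. \<psi> i y) has_sum 1) {idx y}"
      using has_sum_finite[of "{idx y}" "\<lambda>i. \<psi> i y"] y by (simp add: \<psi>_def E_def)
    ultimately show "((\<lambda>i. \<psi> i y) has_sum 1) UNIV" by blast
  qed
  moreover have "\<forall>i\<in>UNIV. supp (\<psi> i) \<subseteq> x i <#\<^bsub>G\<^esub> U"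
  proof
    fix i
    have "{y \<in> carrier G. \<psi> i y \<noteq> 0} \<subseteq> x i <#\<^bsub>G\<^esub> U"
      using idx mem_l_coset_iff[OF xG _ UG] by (auto simp: \<psi>_def indicator_def \<pi>E E_def \<pi>_def)
    moreover have "closedin (top_of_set (carrier G)) (x i <#\<^bsub>G\<^esub> U)"
    proof (rule closed_subset)
      show "x i <#\<^bsub>G\<^esub> U \<subseteq> carrier G" using xG UG by (auto simp: l_coset_def)
      show "closed (x i <#\<^bsub>G\<^esub> U)" by (intro compact_imp_closed compact_l_coset xG cU UG)
    qed
    ultimately show "supp (\<psi> i) \<subseteq> x i <#\<^bsub>G\<^esub> U"
      unfolding supp_def by (rule closure_of_minimal)
  qed
  ultimately show ?thesis using U x by blast
qed

end
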